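(* Let $R$ be an associative ring with identity and let $\mathcal Y$ be any class of right $R$-modules. Then the class ${}^{\perp}\big((\mathcal M^{\mathcal Y})^{\perp}\big)$ contains all totally ordered direct limits of modules belonging to $\mathcal M^{\mathcal Y}$, and the class ${}^{\perp}\big((\mathcal{FM}^{\mathcal Y})^{\perp}\big)$ contains all totally ordered direct limits of modules belonging to $\mathcal{FM}^{\mathcal Y}$.
   Context: $R$ is a not necessarily commutative ring with identity. For a class $\mathcal X$ of left $R$-modules, $\mathcal X^{\perp}=\{Y : \operatorname{Ext}^1_R(X,Y)=0 \text{ for all } X\in\mathcal X\}$ and ${}^{\perp}\mathcal X=\{Y : \operatorname{Ext}^1_R(Y,X)=0 \text{ for all } X\in\mathcal X\}$ (classes of left $R$-modules). A left $R$-module $M$ is $\mathcal Y$-Mittag-Leffler if for each family $\{Y_i : i\in I\}$ of right $R$-modules belonging to $\mathcal Y$, the canonical morphism $\left(\prod_{i\in I}Y_i\right)\otimes_R M\to\prod_{i\in I}(Y_i\otimes_R M)$ is monic. $\mathcal M^{\mathcal Y}$ denotes the class of all $\mathcal Y$-Mittag-Leffler left $R$-modules, and $\mathcal{FM}^{\mathcal Y}$ the class of all left $R$-modules that are both flat and $\mathcal Y$-Mittag-Leffler. A totally ordered direct limit of modules belonging to a class $\mathcal X$ is a module which is the direct limit of a direct system $(X_i,f_{ij})_{i,j\in I}$ with all $X_i\in\mathcal X$ and $I$ a totally ordered set. *)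

theory Defs
  imports "HOL-Algebra.Module" "HOL-Algebra.Product_Groups" "HOL-Algebra.Free_Abelian_Groups"
begin

unbundle cardinal_syntax

section \<open>The universe\<close>

text \<open>
  A class of modules is a set of module records over one fixed carrier type \<open>'u\<close>.  This type plays
  the role of the class of all sets: sets of cardinality smaller than \<open>'u\<close> are the "sets"
  (\<open>small\<close>), arbitrary subsets of \<open>'u\<close> are the "classes".  The axioms of \<open>set_universe\<close> say that
  the cardinality of \<open>'u\<close> is strongly inaccessible, i.e. that the small sets are closed under the
  set-forming operations of ZFC.
\<close>

definition small :: "'u set \<Rightarrow> bool"
  where "small A \<longleftrightarrow> |A| <o |UNIV :: 'u set|"

definition set_universe :: "'u itself \<Rightarrow> bool"
  where "set_universe (_ :: 'u itself) \<longleftrightarrow>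
     natLeq <o |UNIV :: 'u set| \<and>
     (\<forall>A :: 'u set. small A \<longrightarrow> |Pow A| <o |UNIV :: 'u set| ) \<and>
     (\<forall>(I :: 'u set) (A :: 'u \<Rightarrow> 'u set). small I \<longrightarrow> (\<forall>i\<in>I. small (A i)) \<longrightarrow> small (\<Union>i\<in>I. A i))"


section \<open>Modules over a not necessarily commutative ring\<close>

text \<open>
  Only the fields \<open>carrier\<close>, \<open>add\<close>, \<open>zero\<close> and \<open>smult\<close> of a \<open>module\<close> record are relevant; the
  inherited fields \<open>mult\<close> and \<open>one\<close> are junk.
\<close>

locale left_module = R?: ring R + M?: abelian_group M
  for R :: "('r, 'e) ring_scheme" (structure) and M :: "('r, 'a, 'f) module_scheme" (structure) +
  assumes smult_closed: "\<lbrakk>r \<in> carrier R; x \<in> carrier M\<rbrakk> \<Longrightarrow> r \<odot>\<^bsub>M\<^esub> x \<in> carrier M"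
    and smult_add_left: "\<lbrakk>r \<in> carrier R; s \<in> carrier R; x \<in> carrier M\<rbrakk>
      \<Longrightarrow> (r \<oplus>\<^bsub>R\<^esub> s) \<odot>\<^bsub>M\<^esub> x = r \<odot>\<^bsub>M\<^esub> x \<oplus>\<^bsub>M\<^esub> s \<odot>\<^bsub>M\<^esub> x"
    and smult_add_right: "\<lbrakk>r \<in> carrier R; x \<in> carrier M; y \<in> carrier M\<rbrakk>
      \<Longrightarrow> r \<odot>\<^bsub>M\<^esub> (x \<oplus>\<^bsub>M\<^esub> y) = r \<odot>\<^bsub>M\<^esub> x \<oplus>\<^bsub>M\<^esub> r \<odot>\<^bsub>M\<^esub> y"
    and smult_assoc: "\<lbrakk>r \<in> carrier R; s \<in> carrier R; x \<in> carrier M\<rbrakk>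
      \<Longrightarrow> (r \<otimes>\<^bsub>R\<^esub> s) \<odot>\<^bsub>M\<^esub> x = r \<odot>\<^bsub>M\<^esub> (s \<odot>\<^bsub>M\<^esub> x)"
    and smult_one: "x \<in> carrier M \<Longrightarrow> \<one>\<^bsub>R\<^esub> \<odot>\<^bsub>M\<^esub> x = x"

text \<open>In a right module, \<open>r \<odot>\<^bsub>M\<^esub> x\<close> stands for \<open>x \<cdot> r\<close>.\<close>

locale right_module = R?: ring R + M?: abelian_group M
  for R :: "('r, 'e) ring_scheme" (structure) and M :: "('r, 'a, 'f) module_scheme" (structure) +
  assumes smult_closed: "\<lbrakk>r \<in> carrier R; x \<in> carrier M\<rbrakk> \<Longrightarrow> r \<odot>\<^bsub>M\<^esub> x \<in> carrier M"
    and smult_add_left: "\<lbrakk>r \<in> carrier R; s \<in> carrier R; x \<in> carrier M\<rbrakk>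
      \<Longrightarrow> (r \<oplus>\<^bsub>R\<^esub> s) \<odot>\<^bsub>M\<^esub> x = r \<odot>\<^bsub>M\<^esub> x \<oplus>\<^bsub>M\<^esub> s \<odot>\<^bsub>M\<^esub> x"
    and smult_add_right: "\<lbrakk>r \<in> carrier R; x \<in> carrier M; y \<in> carrier M\<rbrakk>
      \<Longrightarrow> r \<odot>\<^bsub>M\<^esub> (x \<oplus>\<^bsub>M\<^esub> y) = r \<odot>\<^bsub>M\<^esub> x \<oplus>\<^bsub>M\<^esub> r \<odot>\<^bsub>M\<^esub> y"
    and smult_assoc: "\<lbrakk>r \<in> carrier R; s \<in> carrier R; x \<in> carrier M\<rbrakk>
      \<Longrightarrow> (r \<otimes>\<^bsub>R\<^esub> s) \<odot>\<^bsub>M\<^esub> x = s \<odot>\<^bsub>M\<^esub> (r \<odot>\<^bsub>M\<^esub> x)"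
    and smult_one: "x \<in> carrier M \<Longrightarrow> \<one>\<^bsub>R\<^esub> \<odot>\<^bsub>M\<^esub> x = x"

definition left_modules :: "('r, 'e) ring_scheme \<Rightarrow> ('r, 'u) module set"
  where "left_modules R = {M. left_module R M \<and> small (carrier M)}"

definition right_modules :: "('r, 'e) ring_scheme \<Rightarrow> ('r, 'u) module set"
  where "right_modules R = {M. right_module R M \<and> small (carrier M)}"

text \<open>Homomorphisms, for left as well as for right modules.\<close>

definition module_Hom ::
    "('r, 'e) ring_scheme \<Rightarrow> ('r, 'a) module \<Rightarrow> ('r, 'b) module \<Rightarrow> ('a \<Rightarrow> 'b) set"
  where "module_Hom R M N = {f \<in> carrier M \<rightarrow>\<^sub>E carrier N.
     (\<forall>x\<in>carrier M. \<forall>y\<in>carrier M. f (x \<oplus>\<^bsub>M\<^esub> y) = f x \<oplus>\<^bsub>N\<^esub> f y) \<and>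
     (\<forall>r\<in>carrier R. \<forall>x\<in>carrier M. f (r \<odot>\<^bsub>M\<^esub> x) = r \<odot>\<^bsub>N\<^esub> f x)}"

definition product_module :: "'i set \<Rightarrow> ('i \<Rightarrow> ('r, 'a) module) \<Rightarrow> ('r, 'i \<Rightarrow> 'a) module"
  where "product_module I Y =
     \<lparr>carrier = (\<Pi>\<^sub>E i\<in>I. carrier (Y i)),
      monoid.mult = undefined, one = undefined,
      ring.zero = (\<lambda>i\<in>I. \<zero>\<^bsub>Y i\<^esub>),
      ring.add = (\<lambda>x y. \<lambda>i\<in>I. x i \<oplus>\<^bsub>Y i\<^esub> y i),
      smult = (\<lambda>r x. \<lambda>i\<in>I. r \<odot>\<^bsub>Y i\<^esub> x i)\<rparr>"


section \<open>Tensor products, flat and Mittag-Leffler modules\<close>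

text \<open>
  The tensor product of a right module \<open>Y\<close> and a left module \<open>M\<close> is the free abelian group on the
  set of pairs modulo the bilinearity and balancing relations.  The group is written
  multiplicatively, following \<open>free_Abelian_group\<close>.
\<close>

definition pairs_group ::
    "('r, 'a) module \<Rightarrow> ('r, 'b) module \<Rightarrow> ('a \<times> 'b \<Rightarrow>\<^sub>0 int) monoid"
  where "pairs_group Y M = free_Abelian_group (carrier Y \<times> carrier M)"

definition tensor_relators ::
    "('r, 'e) ring_scheme \<Rightarrow> ('r, 'a) module \<Rightarrow> ('r, 'b) module \<Rightarrow> ('a \<times> 'b \<Rightarrow>\<^sub>0 int) set"
  where "tensor_relators R Y M =
     {frag_of (y \<oplus>\<^bsub>Y\<^esub> y', m) - frag_of (y, m) - frag_of (y', m) | y y' m.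
        y \<in> carrier Y \<and> y' \<in> carrier Y \<and> m \<in> carrier M} \<union>
     {frag_of (y, m \<oplus>\<^bsub>M\<^esub> m') - frag_of (y, m) - frag_of (y, m') | y m m'.
        y \<in> carrier Y \<and> m \<in> carrier M \<and> m' \<in> carrier M} \<union>
     {frag_of (r \<odot>\<^bsub>Y\<^esub> y, m) - frag_of (y, r \<odot>\<^bsub>M\<^esub> m) | r y m.
        r \<in> carrier R \<and> y \<in> carrier Y \<and> m \<in> carrier M}"

definition tensor_relations ::
    "('r, 'e) ring_scheme \<Rightarrow> ('r, 'a) module \<Rightarrow> ('r, 'b) module \<Rightarrow> ('a \<times> 'b \<Rightarrow>\<^sub>0 int) set"
  where "tensor_relations R Y M = generate (pairs_group Y M) (tensor_relators R Y M)"

definition tensor ::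
    "('r, 'e) ring_scheme \<Rightarrow> ('r, 'a) module \<Rightarrow> ('r, 'b) module \<Rightarrow> ('a \<times> 'b \<Rightarrow>\<^sub>0 int) set monoid"
  where "tensor R Y M = pairs_group Y M Mod tensor_relations R Y M"

text \<open>
  The map \<open>f \<otimes> M\<close> induced by a homomorphism \<open>f\<close> from \<open>Y\<close> to \<open>Y'\<close>: it sends the class of a formal
  sum of pairs \<open>(y, m)\<close> to the class of the corresponding formal sum of pairs \<open>(f y, m)\<close>.
\<close>

definition tensor_map ::
    "('r, 'e) ring_scheme \<Rightarrow> ('r, 'a) module \<Rightarrow> ('r, 'b) module \<Rightarrow> ('r, 'c) module \<Rightarrow>
     ('a \<Rightarrow> 'b) \<Rightarrow> ('a \<times> 'c \<Rightarrow>\<^sub>0 int) set \<Rightarrow> ('b \<times> 'c \<Rightarrow>\<^sub>0 int) set"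
  where "tensor_map R Y Y' M f t =
     the_elem ((\<lambda>c. tensor_relations R Y' M #>\<^bsub>pairs_group Y' M\<^esub>
                     frag_extend (\<lambda>(y, m). frag_of (f y, m)) c) ` t)"

definition flat :: "('r, 'e) ring_scheme \<Rightarrow> ('r, 'u) module \<Rightarrow> bool"
  where "flat R M \<longleftrightarrow>
     (\<forall>(A :: ('r, 'u) module) \<in> right_modules R. \<forall>(B :: ('r, 'u) module) \<in> right_modules R.
      \<forall>f \<in> module_Hom R A B.
        inj_on f (carrier A) \<longrightarrow> inj_on (tensor_map R A B M f) (carrier (tensor R A M)))"

text \<open>
  The canonical map from \<open>(\<Prod>\<^sub>i Y\<^sub>i) \<otimes> M\<close> to \<open>\<Prod>\<^sub>i (Y\<^sub>i \<otimes> M)\<close>; its \<open>i\<close>-th component is induced by the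
  \<open>i\<close>-th projection.  Its codomain is the carrier of
  \<open>product_group I (\<lambda>i. tensor R (Y i) M)\<close>.
\<close>

definition product_tensor_map ::
    "('r, 'e) ring_scheme \<Rightarrow> 'i set \<Rightarrow> ('i \<Rightarrow> ('r, 'a) module) \<Rightarrow> ('r, 'b) module \<Rightarrow>
     (('i \<Rightarrow> 'a) \<times> 'b \<Rightarrow>\<^sub>0 int) set \<Rightarrow> 'i \<Rightarrow> ('a \<times> 'b \<Rightarrow>\<^sub>0 int) set"
  where "product_tensor_map R I Y M t =
     (\<lambda>i\<in>I. tensor_map R (product_module I Y) (Y i) M (\<lambda>y. y i) t)"

definition mittag_leffler ::
    "('r, 'e) ring_scheme \<Rightarrow> ('r, 'u) module set \<Rightarrow> ('r, 'u) module \<Rightarrow> bool"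
  where "mittag_leffler R \<Y> M \<longleftrightarrow>
     (\<forall>(I :: 'u set) Y. small I \<and> (\<forall>i\<in>I. Y i \<in> \<Y>) \<longrightarrow>
        inj_on (product_tensor_map R I Y M) (carrier (tensor R (product_module I Y) M)))"

definition mittag_leffler_modules :: "('r, 'e) ring_scheme \<Rightarrow> ('r, 'u) module set \<Rightarrow> ('r, 'u) module set"
  where "mittag_leffler_modules R \<Y> = {M \<in> left_modules R. mittag_leffler R \<Y> M}"

definition flat_mittag_leffler_modules :: "('r, 'e) ring_scheme \<Rightarrow> ('r, 'u) module set \<Rightarrow> ('r, 'u) module set"
  where "flat_mittag_leffler_modules R \<Y> = {M \<in> left_modules R. flat R M \<and> mittag_leffler R \<Y> M}"


section \<open>The first Ext group\<close>

text \<open>The free left module on \<open>S\<close>: finitely supported functions, extended by zero outside \<open>S\<close>.\<close>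

definition free_module :: "('r, 'e) ring_scheme \<Rightarrow> 's set \<Rightarrow> ('r, 's \<Rightarrow> 'r) module"
  where "free_module R S =
     \<lparr>carrier = {f. (\<forall>s\<in>S. f s \<in> carrier R) \<and> (\<forall>s. s \<notin> S \<longrightarrow> f s = \<zero>\<^bsub>R\<^esub>) \<and> finite {s. f s \<noteq> \<zero>\<^bsub>R\<^esub>}},
      monoid.mult = undefined, one = undefined,
      ring.zero = (\<lambda>s. \<zero>\<^bsub>R\<^esub>),
      ring.add = (\<lambda>f g s. f s \<oplus>\<^bsub>R\<^esub> g s),
      smult = (\<lambda>r f s. r \<otimes>\<^bsub>R\<^esub> f s)\<rparr>"

text \<open>The canonical epimorphism from the free module on the carrier of \<open>M\<close> onto \<open>M\<close>, and its kernel.\<close>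

definition free_eval ::
    "('r, 'e) ring_scheme \<Rightarrow> ('r, 'a) module \<Rightarrow> ('a \<Rightarrow> 'r) \<Rightarrow> 'a"
  where "free_eval R M f = (\<Oplus>\<^bsub>M\<^esub>x\<in>{x. f x \<noteq> \<zero>\<^bsub>R\<^esub>}. f x \<odot>\<^bsub>M\<^esub> x)"

definition syzygy :: "('r, 'e) ring_scheme \<Rightarrow> ('r, 'a) module \<Rightarrow> ('r, 'a \<Rightarrow> 'r) module"
  where "syzygy R M = (free_module R (carrier M))
     \<lparr>carrier := {f \<in> carrier (free_module R (carrier M)). free_eval R M f = \<zero>\<^bsub>M\<^esub>}\<rparr>"

definition Hom_group ::
    "('r, 'e) ring_scheme \<Rightarrow> ('r, 'a) module \<Rightarrow> ('r, 'b) module \<Rightarrow> ('a \<Rightarrow> 'b) monoid"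
  where "Hom_group R M N =
     \<lparr>carrier = module_Hom R M N,
      monoid.mult = (\<lambda>f g. \<lambda>x\<in>carrier M. f x \<oplus>\<^bsub>N\<^esub> g x),
      one = (\<lambda>x\<in>carrier M. \<zero>\<^bsub>N\<^esub>)\<rparr>"

text \<open>
  \<open>Ext1 R X Y\<close> is the first cohomology group of the complex \<open>Hom (P\<^sub>\<bullet>, Y)\<close>, where \<open>P\<^sub>\<bullet>\<close> is the
  canonical free resolution of \<open>X\<close>: \<open>P\<^sub>0\<close>, \<open>P\<^sub>1\<close>, \<open>P\<^sub>2\<close> are the free modules on the elements of \<open>X\<close>,
  of the syzygy \<open>K\<^sub>0\<close> of \<open>X\<close>, and of the syzygy \<open>K\<^sub>1\<close> of \<open>K\<^sub>0\<close>.  The differentials are the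
  \<open>free_eval\<close> maps from \<open>P\<^sub>1\<close> to \<open>K\<^sub>0\<close> and from \<open>P\<^sub>2\<close> to \<open>K\<^sub>1\<close>, since \<open>K\<^sub>0\<close> and \<open>K\<^sub>1\<close> are submodules of
  \<open>P\<^sub>0\<close> and \<open>P\<^sub>1\<close>.
\<close>

definition ext_cocycles ::
    "('r, 'e) ring_scheme \<Rightarrow> ('r, 'a) module \<Rightarrow> ('r, 'b) module \<Rightarrow> ((('a \<Rightarrow> 'r) \<Rightarrow> 'r) \<Rightarrow> 'b) set"
  where "ext_cocycles R X Y =
     (let K0 = syzygy R X; P1 = free_module R (carrier K0);
          K1 = syzygy R K0; P2 = free_module R (carrier K1)
      in {g \<in> module_Hom R P1 Y. \<forall>p\<in>carrier P2. g (free_eval R K1 p) = \<zero>\<^bsub>Y\<^esub>})"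

definition ext_coboundaries ::
    "('r, 'e) ring_scheme \<Rightarrow> ('r, 'a) module \<Rightarrow> ('r, 'b) module \<Rightarrow> ((('a \<Rightarrow> 'r) \<Rightarrow> 'r) \<Rightarrow> 'b) set"
  where "ext_coboundaries R X Y =
     (let P0 = free_module R (carrier X); K0 = syzygy R X; P1 = free_module R (carrier K0)
      in (\<lambda>h. \<lambda>p\<in>carrier P1. h (free_eval R K0 p)) ` module_Hom R P0 Y)"

definition Ext1 ::
    "('r, 'e) ring_scheme \<Rightarrow> ('r, 'a) module \<Rightarrow> ('r, 'b) module \<Rightarrow> ((('a \<Rightarrow> 'r) \<Rightarrow> 'r) \<Rightarrow> 'b) set monoid"
  where "Ext1 R X Y =
     (Hom_group R (free_module R (carrier (syzygy R X))) Y) \<lparr>carrier := ext_cocycles R X Y\<rparr>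
       Mod ext_coboundaries R X Y"

definition right_perp :: "('r, 'e) ring_scheme \<Rightarrow> ('r, 'u) module set \<Rightarrow> ('r, 'u) module set"
  where "right_perp R \<X> = {Y \<in> left_modules R. \<forall>X\<in>\<X>. trivial_group (Ext1 R X Y)}"

definition left_perp :: "('r, 'e) ring_scheme \<Rightarrow> ('r, 'u) module set \<Rightarrow> ('r, 'u) module set"
  where "left_perp R \<X> = {Y \<in> left_modules R. \<forall>X\<in>\<X>. trivial_group (Ext1 R Y X)}"


section \<open>Totally ordered direct limits\<close>

text \<open>In the following, \<open>(i, j) \<in> leq\<close> means \<open>i \<leq> j\<close>.\<close>

definition direct_system ::
    "('r, 'e) ring_scheme \<Rightarrow> 'i set \<Rightarrow> 'i rel \<Rightarrow> ('i \<Rightarrow> ('r, 'u) module) \<Rightarrow> ('i \<Rightarrow> 'i \<Rightarrow> 'u \<Rightarrow> 'u) \<Rightarrow> bool"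
  where "direct_system R I leq X f \<longleftrightarrow>
     (\<forall>i\<in>I. X i \<in> left_modules R) \<and>
     (\<forall>i\<in>I. \<forall>j\<in>I. (i, j) \<in> leq \<longrightarrow> f i j \<in> module_Hom R (X i) (X j)) \<and>
     (\<forall>i\<in>I. \<forall>x\<in>carrier (X i). f i i x = x) \<and>
     (\<forall>i\<in>I. \<forall>j\<in>I. \<forall>k\<in>I. (i, j) \<in> leq \<longrightarrow> (j, k) \<in> leq \<longrightarrow>
        (\<forall>x\<in>carrier (X i). f j k (f i j x) = f i k x))"

definition cocone ::
    "('r, 'e) ring_scheme \<Rightarrow> 'i set \<Rightarrow> 'i rel \<Rightarrow> ('i \<Rightarrow> ('r, 'u) module) \<Rightarrow> ('i \<Rightarrow> 'i \<Rightarrow> 'u \<Rightarrow> 'u) \<Rightarrow>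
     ('r, 'u) module \<Rightarrow> ('i \<Rightarrow> 'u \<Rightarrow> 'u) \<Rightarrow> bool"
  where "cocone R I leq X f N g \<longleftrightarrow>
     N \<in> left_modules R \<and>
     (\<forall>i\<in>I. g i \<in> module_Hom R (X i) N) \<and>
     (\<forall>i\<in>I. \<forall>j\<in>I. (i, j) \<in> leq \<longrightarrow> (\<forall>x\<in>carrier (X i). g j (f i j x) = g i x))"

definition direct_limit ::
    "('r, 'e) ring_scheme \<Rightarrow> 'i set \<Rightarrow> 'i rel \<Rightarrow> ('i \<Rightarrow> ('r, 'u) module) \<Rightarrow> ('i \<Rightarrow> 'i \<Rightarrow> 'u \<Rightarrow> 'u) \<Rightarrow>
     ('r, 'u) module \<Rightarrow> ('i \<Rightarrow> 'u \<Rightarrow> 'u) \<Rightarrow> bool"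
  where "direct_limit R I leq X f N g \<longleftrightarrow>
     cocone R I leq X f N g \<and>
     (\<forall>T h. cocone R I leq X f T h \<longrightarrow>
        (\<exists>!u. u \<in> module_Hom R N T \<and> (\<forall>i\<in>I. \<forall>x\<in>carrier (X i). u (g i x) = h i x)))"

definition totally_ordered_limits ::
    "('r, 'e) ring_scheme \<Rightarrow> ('r, 'u) module set \<Rightarrow> ('r, 'u) module set"
  where "totally_ordered_limits R \<X> =
     {N. \<exists>(I :: 'u set) leq X f g.
        small I \<and> linear_order_on I leq \<and> direct_system R I leq X f \<and> (\<forall>i\<in>I. X i \<in> \<X>) \<and>
        direct_limit R I leq X f N g}"

end

theory Submission
  imports Defs
begin

text \<open>
  Let \<open>N\<close> be the limit of a totally ordered system of modules \<open>X i\<close> from a class \<open>\<X>\<close>, and let \<open>C\<close> be a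
  module with \<open>Ext(X, C) = 0\<close> for all \<open>X\<close> in \<open>\<X>\<close>.  To prove \<open>Ext(N, C) = 0\<close>, one builds a module \<open>L\<close> in \<open>\<X>\<close>
  that is so large that, for reasons of cardinality, \<open>Ext(L, C)\<close> cannot vanish unless \<open>Ext(N, C)\<close> does.
  The modules \<open>L\<close> that serve this purpose are known as tree modules.

  An empty system has limit zero, and if the system has a last term then \<open>N\<close> is that term.  Otherwise a cofinal well-ordered subset \<open>W\<close>
  replaces the index set, and one chooses an increasing family of sets \<open>A i\<close> with \<open>i\<close> in \<open>W\<close> and with
  union \<open>V\<close>, such that the iterated power set of each \<open>A i\<close> is at most as large as \<open>V\<close>.  Branches are
  the subsets \<open>b\<close> of \<open>V\<close>; a branch passes through the node \<open>b \<inter> A i\<close> at level \<open>i\<close>.  In the product of the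
  modules \<open>X i\<close> over all nodes, \<open>L\<close> is generated by the threads: an element of \<open>X i\<close> is put at a node of
  level \<open>i\<close> and is transported along a branch to all higher levels.  Two facts make this work.

  The finitely many elements of a finite subset of \<open>L\<close> involve finitely many branches, and once the
  threads are cut at the levels where these branches part, each of the elements is the sum of the
  segments that start with its values at finitely many nodes.  Hence each finite subset is fixed by
  an endomorphism that is a finite sum of maps factoring through modules \<open>X i\<close> (\<open>tree_module_locally_factors\<close>).  A tensor involves only
  finitely many elements, so flatness and the Mittag-Leffler property pass from the \<open>X i\<close> to \<open>L\<close>
  (\<open>jointly_injective_tensor_local\<close>).

  Each branch gives an epimorphism from \<open>L\<close> onto \<open>N\<close>, the limit of the values along the branch, and
  every set \<open>\<epsilon>\<close> of branches gives a homomorphism, the sum over the branches in \<open>\<epsilon>\<close>.  All of them vanish on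
  the set \<open>D\<close> of the elements of \<open>L\<close> that are zero from some level on.  By the choice of the \<open>A i\<close>, the
  set \<open>D\<close> is at most as large as \<open>V\<close>, and the same can be arranged for \<open>C\<close>.  So there are
  at most \<open>2^V\<close> maps from \<open>D\<close> to \<open>C\<close>, but there are \<open>2^(2^V)\<close> sets of branches.
  An extension of \<open>N\<close> by \<open>C\<close> splits when it is pulled back to \<open>L\<close> along any of these homomorphisms.  For some two different sets of branches the splittings agree on \<open>D\<close>,
  and their difference along a branch that lies in only one of the sets is a splitting over \<open>N\<close>
  (\<open>extends_from_syzygy_by_counting\<close>).
\<close>


section \<open>Modules and homomorphisms\<close>

lemma left_module_abelian_group: "left_module R M \<Longrightarrow> abelian_group M"
  by (simp add: left_module_def)

lemma left_module_ring: "left_module R M \<Longrightarrow> ring R"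
  by (simp add: left_module_def)

lemma left_module_smult_zero:
  assumes "left_module R M" "x \<in> carrier M"
  shows "\<zero>\<^bsub>R\<^esub> \<odot>\<^bsub>M\<^esub> x = \<zero>\<^bsub>M\<^esub>"
proof -
  interpret R: ring R using assms(1) by (rule left_module_ring)
  interpret M: abelian_group M using assms(1) by (rule left_module_abelian_group)
  have c: "\<zero>\<^bsub>R\<^esub> \<odot>\<^bsub>M\<^esub> x \<in> carrier M"
    using assms by (simp add: left_module.smult_closed)
  have "\<zero>\<^bsub>R\<^esub> \<odot>\<^bsub>M\<^esub> x \<oplus>\<^bsub>M\<^esub> \<zero>\<^bsub>R\<^esub> \<odot>\<^bsub>M\<^esub> x = \<zero>\<^bsub>R\<^esub> \<odot>\<^bsub>M\<^esub> x"
    using left_module.smult_add_left[OF assms(1), of "\<zero>\<^bsub>R\<^esub>" "\<zero>\<^bsub>R\<^esub>" x] assms(2) by simp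
  then show ?thesis using c by simp
qed

lemma left_module_smult_minus_one:
  assumes "left_module R M" "x \<in> carrier M"
  shows "(\<ominus>\<^bsub>R\<^esub> \<one>\<^bsub>R\<^esub>) \<odot>\<^bsub>M\<^esub> x = \<ominus>\<^bsub>M\<^esub> x"
proof -
  interpret R: ring R using assms(1) by (rule left_module_ring)
  interpret M: abelian_group M using assms(1) by (rule left_module_abelian_group)
  have "(\<ominus>\<^bsub>R\<^esub> \<one>\<^bsub>R\<^esub>) \<odot>\<^bsub>M\<^esub> x \<oplus>\<^bsub>M\<^esub> \<one>\<^bsub>R\<^esub> \<odot>\<^bsub>M\<^esub> x = \<zero>\<^bsub>M\<^esub>"
    using left_module.smult_add_left[OF assms(1), of "\<ominus>\<^bsub>R\<^esub> \<one>\<^bsub>R\<^esub>" "\<one>\<^bsub>R\<^esub>" x] assms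
    by (simp add: R.l_neg left_module_smult_zero)
  then show ?thesis
    using assms by (simp add: left_module.smult_one left_module.smult_closed M.minus_equality)
qed

lemma left_module_smult_zero_right:
  assumes "left_module R M" "r \<in> carrier R"
  shows "r \<odot>\<^bsub>M\<^esub> \<zero>\<^bsub>M\<^esub> = \<zero>\<^bsub>M\<^esub>"
proof -
  interpret R: ring R using assms(1) by (rule left_module_ring)
  interpret M: abelian_group M using assms(1) by (rule left_module_abelian_group)
  show ?thesis
    using left_module.smult_assoc[OF assms R.zero_closed M.zero_closed]
      left_module_smult_zero[OF assms(1) M.zero_closed] assms(2) by simp
qed

lemma (in abelian_group) minus_eq_zeroD:
  assumes "a \<ominus> b = \<zero>" "a \<in> carrier G" "b \<in> carrier G"
  shows "a = b"
  using assms minus_equality[of a "\<ominus> b"] by (simp add: a_minus_def)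

lemma (in abelian_group) add_minus_cancel:
  assumes "x \<in> carrier G" "y \<in> carrier G"
  shows "y \<oplus> (x \<ominus> y) = x"
  using assms a_lcomm[of y x "\<ominus> y"] by (simp add: a_minus_def r_neg)

lemma (in abelian_group) minus_zero_right: "x \<in> carrier G \<Longrightarrow> x \<ominus> \<zero> = x"
  using add_minus_cancel[of x \<zero>] by (simp add: a_minus_def)

text \<open>
  Negatives are supplied by multiplication with \<open>- 1\<close>; it remains to know that \<open>0\<close> acts as zero.
\<close>

lemma left_moduleI:
  assumes ring: "ring R"
    and zero: "\<zero>\<^bsub>M\<^esub> \<in> carrier M"
    and add: "\<And>x y. \<lbrakk>x \<in> carrier M; y \<in> carrier M\<rbrakk> \<Longrightarrow> x \<oplus>\<^bsub>M\<^esub> y \<in> carrier M"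
    and assoc: "\<And>x y z. \<lbrakk>x \<in> carrier M; y \<in> carrier M; z \<in> carrier M\<rbrakk>
        \<Longrightarrow> (x \<oplus>\<^bsub>M\<^esub> y) \<oplus>\<^bsub>M\<^esub> z = x \<oplus>\<^bsub>M\<^esub> (y \<oplus>\<^bsub>M\<^esub> z)"
    and comm: "\<And>x y. \<lbrakk>x \<in> carrier M; y \<in> carrier M\<rbrakk> \<Longrightarrow> x \<oplus>\<^bsub>M\<^esub> y = y \<oplus>\<^bsub>M\<^esub> x"
    and l_zero: "\<And>x. x \<in> carrier M \<Longrightarrow> \<zero>\<^bsub>M\<^esub> \<oplus>\<^bsub>M\<^esub> x = x"
    and smult: "\<And>r x. \<lbrakk>r \<in> carrier R; x \<in> carrier M\<rbrakk> \<Longrightarrow> r \<odot>\<^bsub>M\<^esub> x \<in> carrier M"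
    and smult_zero: "\<And>x. x \<in> carrier M \<Longrightarrow> \<zero>\<^bsub>R\<^esub> \<odot>\<^bsub>M\<^esub> x = \<zero>\<^bsub>M\<^esub>"
    and add_left: "\<And>r s x. \<lbrakk>r \<in> carrier R; s \<in> carrier R; x \<in> carrier M\<rbrakk>
        \<Longrightarrow> (r \<oplus>\<^bsub>R\<^esub> s) \<odot>\<^bsub>M\<^esub> x = r \<odot>\<^bsub>M\<^esub> x \<oplus>\<^bsub>M\<^esub> s \<odot>\<^bsub>M\<^esub> x"
    and add_right: "\<And>r x y. \<lbrakk>r \<in> carrier R; x \<in> carrier M; y \<in> carrier M\<rbrakk>
        \<Longrightarrow> r \<odot>\<^bsub>M\<^esub> (x \<oplus>\<^bsub>M\<^esub> y) = r \<odot>\<^bsub>M\<^esub> x \<oplus>\<^bsub>M\<^esub> r \<odot>\<^bsub>M\<^esub> y"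
    and smult_assoc: "\<And>r s x. \<lbrakk>r \<in> carrier R; s \<in> carrier R; x \<in> carrier M\<rbrakk>
        \<Longrightarrow> (r \<otimes>\<^bsub>R\<^esub> s) \<odot>\<^bsub>M\<^esub> x = r \<odot>\<^bsub>M\<^esub> (s \<odot>\<^bsub>M\<^esub> x)"
    and one: "\<And>x. x \<in> carrier M \<Longrightarrow> \<one>\<^bsub>R\<^esub> \<odot>\<^bsub>M\<^esub> x = x"
  shows "left_module R M"
proof -
  interpret R: ring R by (rule ring)
  have "abelian_group M"
  proof (rule abelian_groupI)
    fix x assume x: "x \<in> carrier M"
    have "(\<ominus>\<^bsub>R\<^esub> \<one>\<^bsub>R\<^esub>) \<odot>\<^bsub>M\<^esub> x \<oplus>\<^bsub>M\<^esub> \<one>\<^bsub>R\<^esub> \<odot>\<^bsub>M\<^esub> x = \<zero>\<^bsub>M\<^esub>"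
      using add_left[of "\<ominus>\<^bsub>R\<^esub> \<one>\<^bsub>R\<^esub>" "\<one>\<^bsub>R\<^esub>" x] x by (simp add: R.l_neg smult_zero)
    then show "\<exists>y\<in>carrier M. y \<oplus>\<^bsub>M\<^esub> x = \<zero>\<^bsub>M\<^esub>"
      using x by (metis R.add.inv_closed R.one_closed one smult)
  qed (use assms in auto)
  with assms show ?thesis
    by (intro left_module.intro left_module_axioms.intro) auto
qed

lemma left_module_submodule:
  assumes M: "left_module R M" and sub: "S \<subseteq> carrier M" and zero: "\<zero>\<^bsub>M\<^esub> \<in> S"
    and add: "\<And>x y. \<lbrakk>x \<in> S; y \<in> S\<rbrakk> \<Longrightarrow> x \<oplus>\<^bsub>M\<^esub> y \<in> S"
    and smult: "\<And>r x. \<lbrakk>r \<in> carrier R; x \<in> S\<rbrakk> \<Longrightarrow> r \<odot>\<^bsub>M\<^esub> x \<in> S"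
  shows "left_module R (M\<lparr>carrier := S\<rparr>)"
proof -
  interpret M: abelian_group M using M by (rule left_module_abelian_group)
  have *: "x \<in> carrier M" if "x \<in> S" for x using that sub by auto
  show ?thesis
    by (rule left_moduleI[OF left_module_ring[OF M]])
      (simp_all add: * zero add smult M.a_ac left_module_smult_zero[OF M]
        left_module.smult_add_left[OF M] left_module.smult_add_right[OF M]
        left_module.smult_assoc[OF M] left_module.smult_one[OF M])
qed

lemma left_module_product:
  assumes ring: "ring R" and X: "\<And>i. i \<in> I \<Longrightarrow> left_module R (X i)"
  shows "left_module R (product_module I X)"
proof -
  have ab: "abelian_group (X i)" if "i \<in> I" for i
    using X[OF that] by (rule left_module_abelian_group)
  show ?thesis
  proof (rule left_moduleI[OF ring], goal_cases)
    case 1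
    show ?case using ab by (auto simp: product_module_def abelian_group.axioms(1) abelian_monoid.zero_closed)
  next
    case (2 x y)
    then show ?case using ab
      by (auto simp: product_module_def PiE_iff abelian_group.axioms(1) abelian_monoid.a_closed)
  next
    case (3 x y z)
    then show ?case using ab
      by (auto simp: product_module_def PiE_iff abelian_group.axioms(1) abelian_monoid.a_assoc
        intro!: restrict_ext)
  next
    case (4 x y)
    then show ?case using ab
      by (auto simp: product_module_def PiE_iff abelian_group.axioms(1) abelian_monoid.a_comm
        intro!: restrict_ext)
  next
    case (5 x)
    then show ?case using ab
      by (auto simp: product_module_def PiE_iff abelian_group.axioms(1) abelian_monoid.l_zero
        intro!: extensionalityI[of _ I])
  next
    case (6 r x)
    then show ?case using X
      by (auto simp: product_module_def PiE_iff intro: left_module.smult_closed)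
  next
    case (7 x)
    then show ?case using X
      by (auto simp: product_module_def PiE_iff left_module_smult_zero intro!: restrict_ext)
  next
    case (8 r s x)
    then show ?case using X
      by (auto simp: product_module_def PiE_iff left_module.smult_add_left intro!: restrict_ext)
  next
    case (9 r x y)
    then show ?case using X
      by (auto simp: product_module_def PiE_iff intro!: restrict_ext left_module.smult_add_right)
  next
    case (10 r s x)
    then show ?case using X
      by (auto simp: product_module_def PiE_iff left_module.smult_assoc intro!: restrict_ext)
  next
    case (11 x)
    then show ?case using X
      by (auto simp: product_module_def PiE_iff left_module.smult_one
        intro!: extensionalityI[of _ I])
  qed
qed

text \<open>
  The quotient of \<open>M\<close> by the congruence \<open>q x = q y\<close>, with the values of \<open>q\<close> as its elements.  For
  injective \<open>q\<close> this is a copy of \<open>M\<close> on another carrier.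
\<close>

definition image_module :: "('a \<Rightarrow> 'b) \<Rightarrow> ('r, 'a) module \<Rightarrow> ('r, 'b) module"
  where "image_module q M =
     \<lparr>carrier = q ` carrier M,
      monoid.mult = undefined, one = undefined,
      ring.zero = q \<zero>\<^bsub>M\<^esub>,
      ring.add = (\<lambda>a b. q (inv_into (carrier M) q a \<oplus>\<^bsub>M\<^esub> inv_into (carrier M) q b)),
      smult = (\<lambda>r a. q (r \<odot>\<^bsub>M\<^esub> inv_into (carrier M) q a))\<rparr>"

lemma
  assumes M: "left_module R M"
    and add_cong: "\<And>x x' y y'. \<lbrakk>x \<in> carrier M; x' \<in> carrier M; y \<in> carrier M; y' \<in> carrier M;
        q x = q x'; q y = q y'\<rbrakk> \<Longrightarrow> q (x \<oplus>\<^bsub>M\<^esub> y) = q (x' \<oplus>\<^bsub>M\<^esub> y')"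
    and smult_cong: "\<And>r x x'. \<lbrakk>r \<in> carrier R; x \<in> carrier M; x' \<in> carrier M; q x = q x'\<rbrakk>
        \<Longrightarrow> q (r \<odot>\<^bsub>M\<^esub> x) = q (r \<odot>\<^bsub>M\<^esub> x')"
  shows left_module_image_module: "left_module R (image_module q M)" (is ?T1)
    and image_module_Hom: "restrict q (carrier M) \<in> module_Hom R M (image_module q M)" (is ?T2)
proof -
  interpret M: abelian_group M using M by (rule left_module_abelian_group)
  let ?N = "image_module q M"
  have add: "q x \<oplus>\<^bsub>?N\<^esub> q y = q (x \<oplus>\<^bsub>M\<^esub> y)" if "x \<in> carrier M" "y \<in> carrier M" for x y
    using that by (auto simp: image_module_def inv_into_into f_inv_into_f intro!: add_cong)
  have smult: "r \<odot>\<^bsub>?N\<^esub> q x = q (r \<odot>\<^bsub>M\<^esub> x)" if "r \<in> carrier R" "x \<in> carrier M" for r x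
    using that by (auto simp: image_module_def inv_into_into f_inv_into_f intro!: smult_cong)
  have car: "carrier ?N = q ` carrier M" and zero: "\<zero>\<^bsub>?N\<^esub> = q \<zero>\<^bsub>M\<^esub>"
    by (simp_all add: image_module_def)
  note [simp] = left_module.smult_closed[OF M]
  interpret R: ring R using M by (rule left_module_ring)
  show ?T1
    by (rule left_moduleI)
      (auto simp: R.ring_axioms car zero add smult M.a_ac left_module_smult_zero[OF M]
        left_module.smult_add_left[OF M] left_module.smult_add_right[OF M]
        left_module.smult_assoc[OF M] left_module.smult_one[OF M])
  show ?T2
    by (auto simp: module_Hom_def car add smult)
qed

lemma module_HomI:
  assumes "\<And>x. x \<in> carrier M \<Longrightarrow> f x \<in> carrier N"
    and "\<And>x y. \<lbrakk>x \<in> carrier M; y \<in> carrier M\<rbrakk> \<Longrightarrow> f (x \<oplus>\<^bsub>M\<^esub> y) = f x \<oplus>\<^bsub>N\<^esub> f y"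
    and "\<And>r x. \<lbrakk>r \<in> carrier R; x \<in> carrier M\<rbrakk> \<Longrightarrow> f (r \<odot>\<^bsub>M\<^esub> x) = r \<odot>\<^bsub>N\<^esub> f x"
    and M: "left_module R M"
  shows "restrict f (carrier M) \<in> module_Hom R M N"
proof -
  interpret M: abelian_group M using M by (rule left_module_abelian_group)
  show ?thesis
    using assms by (auto simp: module_Hom_def left_module.smult_closed)
qed

lemma module_Hom_closed: "\<lbrakk>f \<in> module_Hom R M N; x \<in> carrier M\<rbrakk> \<Longrightarrow> f x \<in> carrier N"
  by (auto simp: module_Hom_def)

lemma module_Hom_add: "\<lbrakk>f \<in> module_Hom R M N; x \<in> carrier M; y \<in> carrier M\<rbrakk>
    \<Longrightarrow> f (x \<oplus>\<^bsub>M\<^esub> y) = f x \<oplus>\<^bsub>N\<^esub> f y"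
  by (auto simp: module_Hom_def)

lemma module_Hom_smult: "\<lbrakk>f \<in> module_Hom R M N; r \<in> carrier R; x \<in> carrier M\<rbrakk>
    \<Longrightarrow> f (r \<odot>\<^bsub>M\<^esub> x) = r \<odot>\<^bsub>N\<^esub> f x"
  by (auto simp: module_Hom_def)

lemma module_Hom_extensional: "f \<in> module_Hom R M N \<Longrightarrow> f \<in> extensional (carrier M)"
  by (auto simp: module_Hom_def PiE_def)

lemma identity_Hom: "left_module R M \<Longrightarrow> (\<lambda>x\<in>carrier M. x) \<in> module_Hom R M M"
  by (rule module_HomI) auto

lemma image_module_iso:
  assumes M: "left_module R M" and inj: "inj_on enc (carrier M)"
  shows "left_module R (image_module enc M)"
    and "restrict enc (carrier M) \<in> module_Hom R M (image_module enc M)"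
    and "restrict (inv_into (carrier M) enc) (enc ` carrier M) \<in> module_Hom R (image_module enc M) M"
proof -
  let ?M = "image_module enc M"
  have add: "enc (x \<oplus>\<^bsub>M\<^esub> y) = enc (x' \<oplus>\<^bsub>M\<^esub> y')"
    if "x \<in> carrier M" "x' \<in> carrier M" "y \<in> carrier M" "y' \<in> carrier M" "enc x = enc x'" "enc y = enc y'"
    for x x' y y' using that inj_onD[OF inj] by metis
  have smult: "enc (r \<odot>\<^bsub>M\<^esub> x) = enc (r \<odot>\<^bsub>M\<^esub> x')"
    if "r \<in> carrier R" "x \<in> carrier M" "x' \<in> carrier M" "enc x = enc x'" for r x x'
    using that inj_onD[OF inj] by metis
  show M': "left_module R ?M" by (rule left_module_image_module[OF M add smult])
  show enc: "restrict enc (carrier M) \<in> module_Hom R M ?M" by (rule image_module_Hom[OF M add smult])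
  interpret M: abelian_group M by (rule left_module_abelian_group[OF M])
  have car: "carrier ?M = enc ` carrier M" by (simp add: image_module_def)
  have "restrict (inv_into (carrier M) enc) (carrier ?M) \<in> module_Hom R ?M M"
    by (rule module_HomI[OF _ _ _ M'])
      (auto simp: image_module_def inv_into_f_f[OF inj] left_module.smult_closed[OF M])
  then show "restrict (inv_into (carrier M) enc) (enc ` carrier M) \<in> module_Hom R ?M M"
    by (simp add: car)
qed

lemma module_Hom_zero:
  assumes "f \<in> module_Hom R M N" "left_module R M" "left_module R N"
  shows "f \<zero>\<^bsub>M\<^esub> = \<zero>\<^bsub>N\<^esub>"
proof -
  interpret R: ring R using assms(2) by (rule left_module_ring)
  interpret M: abelian_group M using assms(2) by (rule left_module_abelian_group)
  have "f (\<zero>\<^bsub>R\<^esub> \<odot>\<^bsub>M\<^esub> \<zero>\<^bsub>M\<^esub>) = \<zero>\<^bsub>R\<^esub> \<odot>\<^bsub>N\<^esub> f \<zero>\<^bsub>M\<^esub>"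
    using assms by (simp add: module_Hom_smult)
  then show ?thesis
    using assms by (simp add: left_module_smult_zero module_Hom_closed)
qed

lemma module_Hom_neg:
  assumes "f \<in> module_Hom R M N" "left_module R M" "left_module R N" "x \<in> carrier M"
  shows "f (\<ominus>\<^bsub>M\<^esub> x) = \<ominus>\<^bsub>N\<^esub> f x"
proof -
  interpret R: ring R using assms(2) by (rule left_module_ring)
  have "f ((\<ominus>\<^bsub>R\<^esub> \<one>\<^bsub>R\<^esub>) \<odot>\<^bsub>M\<^esub> x) = (\<ominus>\<^bsub>R\<^esub> \<one>\<^bsub>R\<^esub>) \<odot>\<^bsub>N\<^esub> f x"
    using assms by (simp add: module_Hom_smult)
  then show ?thesis
    using assms by (simp add: left_module_smult_minus_one module_Hom_closed)
qed

lemma module_Hom_minus: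
  assumes "f \<in> module_Hom R M N" "left_module R M" "left_module R N" "x \<in> carrier M" "y \<in> carrier M"
  shows "f (x \<ominus>\<^bsub>M\<^esub> y) = f x \<ominus>\<^bsub>N\<^esub> f y"
proof -
  interpret M: abelian_group M using assms(2) by (rule left_module_abelian_group)
  show ?thesis using assms by (simp add: a_minus_def module_Hom_add module_Hom_neg)
qed

lemma module_Hom_compose:
  assumes "f \<in> module_Hom R M N" "g \<in> module_Hom R N P" "left_module R M"
  shows "compose (carrier M) g f \<in> module_Hom R M P"
  unfolding compose_def
  by (rule module_HomI) (use assms in \<open>auto simp: module_Hom_add module_Hom_smult module_Hom_closed\<close>)

lemma module_Hom_finsum:
  assumes "h \<in> module_Hom R M N" "left_module R M" "left_module R N" "finite K"
    and "\<And>k. k \<in> K \<Longrightarrow> f k \<in> carrier M"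
  shows "h (\<Oplus>\<^bsub>M\<^esub>k\<in>K. f k) = (\<Oplus>\<^bsub>N\<^esub>k\<in>K. h (f k))"
proof -
  interpret M: abelian_group M using assms(2) by (rule left_module_abelian_group)
  interpret N: abelian_group N using assms(3) by (rule left_module_abelian_group)
  show ?thesis
    using assms(4,5)
  proof (induct K)
    case empty
    then show ?case using assms by (simp add: module_Hom_zero)
  next
    case (insert k K)
    then have "(\<lambda>k. f k) \<in> K \<rightarrow> carrier M" "(\<lambda>k. h (f k)) \<in> K \<rightarrow> carrier N"
      using assms(1) by (auto simp: module_Hom_closed)
    with insert assms(1) show ?case
      by (simp add: module_Hom_add module_Hom_closed)
  qed
qed


lemma left_module_smult_neg:
  assumes M: "left_module R M" and r: "r \<in> carrier R" and x: "x \<in> carrier M"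
  shows "r \<odot>\<^bsub>M\<^esub> (\<ominus>\<^bsub>M\<^esub> x) = \<ominus>\<^bsub>M\<^esub> (r \<odot>\<^bsub>M\<^esub> x)"
proof -
  interpret M: abelian_group M using M by (rule left_module_abelian_group)
  note c = left_module.smult_closed[OF M r]
  have "r \<odot>\<^bsub>M\<^esub> (\<ominus>\<^bsub>M\<^esub> x) \<oplus>\<^bsub>M\<^esub> r \<odot>\<^bsub>M\<^esub> x = \<zero>\<^bsub>M\<^esub>"
    using x left_module.smult_add_right[OF M r, of "\<ominus>\<^bsub>M\<^esub> x" x]
    by (simp add: M.l_neg left_module_smult_zero_right[OF M r])
  then show ?thesis using x c M.minus_equality by simp
qed

lemma module_Hom_diff:
  assumes u: "u \<in> module_Hom R M N" and v: "v \<in> module_Hom R M N"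
    and M: "left_module R M" and N: "left_module R N"
  shows "(\<lambda>x\<in>carrier M. u x \<ominus>\<^bsub>N\<^esub> v x) \<in> module_Hom R M N"
proof -
  interpret N: abelian_group N using N by (rule left_module_abelian_group)
  note c = module_Hom_closed[OF u] module_Hom_closed[OF v] left_module.smult_closed[OF N]
  show ?thesis
    by (rule module_HomI[OF _ _ _ M])
      (simp_all add: c a_minus_def module_Hom_add[OF u] module_Hom_add[OF v] module_Hom_smult[OF u]
        module_Hom_smult[OF v] N.minus_add N.a_ac left_module.smult_add_right[OF N]
        left_module_smult_neg[OF N])
qed

lemma factor_through_epimorphism:
  assumes E: "left_module R E" and X: "left_module R X" and C: "left_module R C"
    and \<pi>: "\<pi> \<in> module_Hom R E X" and onto: "\<pi> ` carrier E = carrier X"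
    and \<Phi>: "\<Phi> \<in> module_Hom R E C"
    and ker: "\<And>x. \<lbrakk>x \<in> carrier E; \<pi> x = \<zero>\<^bsub>X\<^esub>\<rbrakk> \<Longrightarrow> \<Phi> x = \<zero>\<^bsub>C\<^esub>"
  shows "\<exists>\<Psi>\<in>module_Hom R X C. \<forall>x\<in>carrier E. \<Psi> (\<pi> x) = \<Phi> x"
proof -
  interpret E: abelian_group E using E by (rule left_module_abelian_group)
  interpret X: abelian_group X using X by (rule left_module_abelian_group)
  interpret C: abelian_group C using C by (rule left_module_abelian_group)
  have eq: "\<Phi> x = \<Phi> y" if xy: "x \<in> carrier E" "y \<in> carrier E" "\<pi> x = \<pi> y" for x y
  proof -
    have "\<pi> (x \<ominus>\<^bsub>E\<^esub> y) = \<zero>\<^bsub>X\<^esub>"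
      using xy module_Hom_closed[OF \<pi>] by (simp add: module_Hom_minus[OF \<pi> E X] X.r_neg a_minus_def[of X])
    then have "\<Phi> x \<ominus>\<^bsub>C\<^esub> \<Phi> y = \<zero>\<^bsub>C\<^esub>"
      using xy ker[of "x \<ominus>\<^bsub>E\<^esub> y"] by (simp add: module_Hom_minus[OF \<Phi> E C])
    then show ?thesis using xy module_Hom_closed[OF \<Phi>] by (auto intro: C.minus_eq_zeroD)
  qed
  define s where "s = inv_into (carrier E) \<pi>"
  have s: "s x \<in> carrier E" "\<pi> (s x) = x" if "x \<in> carrier X" for x
    using that onto by (auto simp: s_def inv_into_into f_inv_into_f)
  have s_eq: "\<Phi> (s (\<pi> x)) = \<Phi> x" if "x \<in> carrier E" for x
    using that s module_Hom_closed[OF \<pi>] by (intro eq) auto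
  have "(\<lambda>x\<in>carrier X. \<Phi> (s x)) \<in> module_Hom R X C"
  proof (rule module_HomI)
    fix x y assume xy: "x \<in> carrier X" "y \<in> carrier X"
    show "\<Phi> (s (x \<oplus>\<^bsub>X\<^esub> y)) = \<Phi> (s x) \<oplus>\<^bsub>C\<^esub> \<Phi> (s y)"
      using s_eq[of "s x \<oplus>\<^bsub>E\<^esub> s y"] xy by (simp add: s module_Hom_add[OF \<pi>] module_Hom_add[OF \<Phi>])
  next
    fix r x assume rx: "r \<in> carrier R" "x \<in> carrier X"
    show "\<Phi> (s (r \<odot>\<^bsub>X\<^esub> x)) = r \<odot>\<^bsub>C\<^esub> \<Phi> (s x)"
      using s_eq[of "r \<odot>\<^bsub>E\<^esub> s x"] rx
      by (simp add: s module_Hom_smult[OF \<pi>] module_Hom_smult[OF \<Phi>] left_module.smult_closed[OF E])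
  qed (use s X in \<open>auto intro: module_Hom_closed[OF \<Phi>]\<close>)
  moreover have "\<forall>x\<in>carrier E. (\<lambda>x\<in>carrier X. \<Phi> (s x)) (\<pi> x) = \<Phi> x"
    by (simp add: s_eq module_Hom_closed[OF \<pi>])
  ultimately show ?thesis by blast
qed

definition hom_kernel :: "('a \<Rightarrow> 'b) \<Rightarrow> ('r, 'a) module \<Rightarrow> ('r, 'b) module \<Rightarrow> ('r, 'a) module"
  where "hom_kernel f M N = M\<lparr>carrier := {x \<in> carrier M. f x = \<zero>\<^bsub>N\<^esub>}\<rparr>"

lemma left_module_kernel:
  assumes f: "f \<in> module_Hom R M N" and M: "left_module R M" and N: "left_module R N"
  shows "left_module R (hom_kernel f M N)"
proof -
  interpret M: abelian_group M using M by (rule left_module_abelian_group)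
  interpret N: abelian_group N using N by (rule left_module_abelian_group)
  show ?thesis
    unfolding hom_kernel_def
    by (rule left_module_submodule[OF M])
      (auto simp: module_Hom_zero[OF f M N] module_Hom_add[OF f] module_Hom_smult[OF f]
        left_module_smult_zero_right[OF N] left_module.smult_closed[OF M])
qed

definition pair_module :: "('r, 'a) module \<Rightarrow> ('r, 'b) module \<Rightarrow> ('r, 'a \<times> 'b) module"
  where "pair_module M N =
     \<lparr>carrier = carrier M \<times> carrier N,
      monoid.mult = undefined, one = undefined,
      ring.zero = (\<zero>\<^bsub>M\<^esub>, \<zero>\<^bsub>N\<^esub>),
      ring.add = (\<lambda>x y. (fst x \<oplus>\<^bsub>M\<^esub> fst y, snd x \<oplus>\<^bsub>N\<^esub> snd y)),
      smult = (\<lambda>r x. (r \<odot>\<^bsub>M\<^esub> fst x, r \<odot>\<^bsub>N\<^esub> snd x))\<rparr>"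

lemma left_module_pair:
  assumes M: "left_module R M" and N: "left_module R N"
  shows "left_module R (pair_module M N)"
proof -
  interpret M: abelian_group M using M by (rule left_module_abelian_group)
  interpret N: abelian_group N using N by (rule left_module_abelian_group)
  show ?thesis
    by (rule left_moduleI[OF left_module_ring[OF M]])
      (auto simp: pair_module_def M.a_ac N.a_ac left_module.smult_closed[OF M] left_module.smult_closed[OF N]
        left_module_smult_zero[OF M] left_module_smult_zero[OF N]
        left_module.smult_add_left[OF M] left_module.smult_add_left[OF N]
        left_module.smult_add_right[OF M] left_module.smult_add_right[OF N]
        left_module.smult_assoc[OF M] left_module.smult_assoc[OF N]
        left_module.smult_one[OF M] left_module.smult_one[OF N])
qed

lemma pair_module_Hom:
  assumes M: "left_module R M" and N: "left_module R N" and P: "left_module R P"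
    and u: "u \<in> module_Hom R M P" and v: "v \<in> module_Hom R N P"
  shows "(\<lambda>x\<in>carrier (pair_module M N). u (fst x) \<oplus>\<^bsub>P\<^esub> v (snd x)) \<in> module_Hom R (pair_module M N) P"
proof -
  interpret P: abelian_group P using P by (rule left_module_abelian_group)
  note c = module_Hom_closed[OF u] module_Hom_closed[OF v]
  show ?thesis
    by (rule module_HomI[OF _ _ _ left_module_pair[OF M N]])
      (auto simp: pair_module_def c module_Hom_add[OF u] module_Hom_add[OF v] module_Hom_smult[OF u]
        module_Hom_smult[OF v] P.a_ac left_module.smult_add_right[OF P])
qed

definition pullback_module :: "('r, 'a) module \<Rightarrow> ('r, 'b) module \<Rightarrow> ('a \<Rightarrow> 'n) \<Rightarrow> ('b \<Rightarrow> 'n) \<Rightarrow> ('r, 'a \<times> 'b) module"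
  where "pullback_module L M h k =
    (pair_module L M)\<lparr>carrier := {x \<in> carrier L \<times> carrier M. h (fst x) = k (snd x)}\<rparr>"

lemma
  assumes L: "left_module R L" and M: "left_module R M" and N: "left_module R N"
    and h: "h \<in> module_Hom R L N" and k: "k \<in> module_Hom R M N"
  shows left_module_pullback: "left_module R (pullback_module L M h k)" (is ?T1)
    and pullback_fst: "(\<lambda>x\<in>carrier (pullback_module L M h k). fst x) \<in> module_Hom R (pullback_module L M h k) L" (is ?T2)
    and pullback_snd: "(\<lambda>x\<in>carrier (pullback_module L M h k). snd x) \<in> module_Hom R (pullback_module L M h k) M" (is ?T3)
proof -
  interpret L: abelian_group L using L by (rule left_module_abelian_group)
  interpret M: abelian_group M using M by (rule left_module_abelian_group)
  show P: ?T1
    unfolding pullback_module_def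
    by (rule left_module_submodule[OF left_module_pair[OF L M]])
      (auto simp: pair_module_def module_Hom_zero[OF h L N] module_Hom_zero[OF k M N] module_Hom_add[OF h]
        module_Hom_add[OF k] module_Hom_smult[OF h] module_Hom_smult[OF k]
        left_module.smult_closed[OF L] left_module.smult_closed[OF M])
  show ?T2
    by (rule module_HomI[OF _ _ _ P]) (auto simp: pullback_module_def pair_module_def)
  show ?T3
    by (rule module_HomI[OF _ _ _ P]) (auto simp: pullback_module_def pair_module_def)
qed

lemma pullback_module_simps:
  "x \<in> carrier (pullback_module L M h k) \<longleftrightarrow>
    fst x \<in> carrier L \<and> snd x \<in> carrier M \<and> h (fst x) = k (snd x)"
  "x \<oplus>\<^bsub>pullback_module L M h k\<^esub> y = (fst x \<oplus>\<^bsub>L\<^esub> fst y, snd x \<oplus>\<^bsub>M\<^esub> snd y)"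
  "r \<odot>\<^bsub>pullback_module L M h k\<^esub> x = (r \<odot>\<^bsub>L\<^esub> fst x, r \<odot>\<^bsub>M\<^esub> snd x)"
  "\<zero>\<^bsub>pullback_module L M h k\<^esub> = (\<zero>\<^bsub>L\<^esub>, \<zero>\<^bsub>M\<^esub>)"
  by (auto simp: pullback_module_def pair_module_def mem_Times_iff)


section \<open>Free modules\<close>

definition free_basis :: "('r, 'e) ring_scheme \<Rightarrow> 's \<Rightarrow> 's \<Rightarrow> 'r"
  where "free_basis R x = (\<lambda>s. if s = x then \<one>\<^bsub>R\<^esub> else \<zero>\<^bsub>R\<^esub>)"

text \<open>The linear extension of a map \<open>t\<close> that is given on the basis.\<close>

definition free_lift :: "('r, 'e) ring_scheme \<Rightarrow> ('r, 'a) module \<Rightarrow> ('s \<Rightarrow> 'a) \<Rightarrow> ('s \<Rightarrow> 'r) \<Rightarrow> 'a"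
  where "free_lift R E t f = (\<Oplus>\<^bsub>E\<^esub>x\<in>{x. f x \<noteq> \<zero>\<^bsub>R\<^esub>}. f x \<odot>\<^bsub>E\<^esub> t x)"

lemma free_eval_conv_lift: "free_eval R M = free_lift R M (\<lambda>x. x)"
  by (simp add: fun_eq_iff free_eval_def free_lift_def)


lemma free_module_val:
  assumes "ring R" "f \<in> carrier (free_module R S)"
  shows "f s \<in> carrier R"
proof -
  interpret R: ring R by fact
  show ?thesis using assms(2) by (cases "s \<in> S") (auto simp: free_module_def)
qed

lemma free_module_support:
  assumes "f \<in> carrier (free_module R S)"
  shows "finite {x. f x \<noteq> \<zero>\<^bsub>R\<^esub>}" "{x. f x \<noteq> \<zero>\<^bsub>R\<^esub>} \<subseteq> S"
  using assms by (auto simp: free_module_def)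

lemma free_module_ops:
  "f \<oplus>\<^bsub>free_module R S\<^esub> g = (\<lambda>s. f s \<oplus>\<^bsub>R\<^esub> g s)"
  "r \<odot>\<^bsub>free_module R S\<^esub> f = (\<lambda>s. r \<otimes>\<^bsub>R\<^esub> f s)"
  "\<zero>\<^bsub>free_module R S\<^esub> = (\<lambda>s. \<zero>\<^bsub>R\<^esub>)"
  by (simp_all add: free_module_def)

lemma left_module_free:
  assumes ring: "ring R"
  shows "left_module R (free_module R S)"
proof -
  interpret R: ring R by (rule ring)
  note val = free_module_val[OF ring, of _ S]
  show ?thesis
  proof (rule left_moduleI[OF ring], goal_cases)
    case 1
    show ?case by (simp add: free_module_def)
  next
    case (2 f g)
    then have "finite ({s. f s \<noteq> \<zero>\<^bsub>R\<^esub>} \<union> {s. g s \<noteq> \<zero>\<^bsub>R\<^esub>})"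
      by (auto simp: free_module_def)
    then have "finite {s. f s \<oplus>\<^bsub>R\<^esub> g s \<noteq> \<zero>\<^bsub>R\<^esub>}"
      by (rule finite_subset[rotated]) auto
    with 2 show ?case by (auto simp: free_module_def)
  next
    case (6 r f)
    then have "finite {s. f s \<noteq> \<zero>\<^bsub>R\<^esub>}"
      by (auto simp: free_module_def)
    then have "finite {s. r \<otimes>\<^bsub>R\<^esub> f s \<noteq> \<zero>\<^bsub>R\<^esub>}"
      by (rule finite_subset[rotated]) (use 6 in auto)
    with 6 show ?case by (auto simp: free_module_def)
  next
    case (3 x y z) then show ?case by (auto simp: free_module_ops val R.a_assoc)
  next
    case (4 x y) then show ?case by (auto simp: free_module_ops val R.a_comm)
  next
    case (5 x) then show ?case by (auto simp: free_module_ops val)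
  next
    case (7 x) then show ?case by (auto simp: free_module_ops val)
  next
    case (8 r s x) then show ?case by (auto simp: free_module_ops val R.l_distr)
  next
    case (9 r x y) then show ?case by (auto simp: free_module_ops val R.r_distr)
  next
    case (10 r s x) then show ?case by (auto simp: free_module_ops val R.m_assoc)
  next
    case (11 x) then show ?case by (auto simp: free_module_ops val)
  qed
qed

lemma free_basis_closed:
  assumes "ring R" "x \<in> S"
  shows "free_basis R x \<in> carrier (free_module R S)"
proof -
  interpret R: ring R by fact
  have "finite {s. free_basis R x s \<noteq> \<zero>\<^bsub>R\<^esub>}"
    by (rule finite_subset[of _ "{x}"]) (auto simp: free_basis_def)
  with assms(2) show ?thesis by (auto simp: free_module_def free_basis_def)
qed

lemma free_lift_superset:
  assumes E: "left_module R E" and f: "f \<in> carrier (free_module R S)"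
    and t: "\<And>x. x \<in> S \<Longrightarrow> t x \<in> carrier E"
    and F: "finite F" "{x. f x \<noteq> \<zero>\<^bsub>R\<^esub>} \<subseteq> F" "F \<subseteq> S"
  shows "free_lift R E t f = (\<Oplus>\<^bsub>E\<^esub>x\<in>F. f x \<odot>\<^bsub>E\<^esub> t x)"
proof -
  interpret E: abelian_group E using E by (rule left_module_abelian_group)
  have v: "f x \<in> carrier R" for x by (rule free_module_val[OF left_module_ring[OF E] f])
  show ?thesis
    unfolding free_lift_def
    by (rule E.add.finprod_mono_neutral_cong_left)
      (use F t v in \<open>auto simp: left_module_smult_zero[OF E] left_module.smult_closed[OF E]\<close>)
qed

lemma left_module_smult_finsum:
  assumes E: "left_module R E" and r: "r \<in> carrier R" and "finite F"
    and t: "\<And>x. x \<in> F \<Longrightarrow> t x \<in> carrier E"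
  shows "r \<odot>\<^bsub>E\<^esub> (\<Oplus>\<^bsub>E\<^esub>x\<in>F. t x) = (\<Oplus>\<^bsub>E\<^esub>x\<in>F. r \<odot>\<^bsub>E\<^esub> t x)"
proof -
  interpret E: abelian_group E using E by (rule left_module_abelian_group)
  note c = left_module.smult_closed[OF E]
  show ?thesis
    using \<open>finite F\<close> t
  proof (induct F)
    case empty
    then show ?case by (simp add: left_module_smult_zero_right[OF E r])
  next
    case (insert x F)
    then have "t \<in> F \<rightarrow> carrier E" "(\<lambda>x. r \<odot>\<^bsub>E\<^esub> t x) \<in> F \<rightarrow> carrier E"
      using c[OF r] by auto
    with insert show ?case
      by (simp add: c[OF r] left_module.smult_add_right[OF E r])
  qed
qed

lemma free_lift_Hom:
  assumes E: "left_module R E" and t: "\<And>x. x \<in> S \<Longrightarrow> t x \<in> carrier E"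
  shows "restrict (free_lift R E t) (carrier (free_module R S)) \<in> module_Hom R (free_module R S) E"
    (is "_ \<in> module_Hom R ?F E")
proof -
  have ring: "ring R" by (rule left_module_ring[OF E])
  interpret E: abelian_group E using E by (rule left_module_abelian_group)
  interpret R: ring R by (rule ring)
  note c = left_module.smult_closed[OF E]
  note v = free_module_val[OF ring, of _ S]
  note F = left_module_free[OF ring, of S]
  interpret F: abelian_group ?F using F by (rule left_module_abelian_group)
  show ?thesis
  proof (rule module_HomI, goal_cases)
    case (1 f)
    then show ?case unfolding free_lift_def
      using t v free_module_support(2)[OF 1] by (intro E.finsum_closed) (auto intro!: c)
  next
    case (2 f g)
    let ?G = "{x. f x \<noteq> \<zero>\<^bsub>R\<^esub>} \<union> {x. g x \<noteq> \<zero>\<^bsub>R\<^esub>}"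
    have G: "finite ?G" "?G \<subseteq> S"
      using free_module_support[OF 2(1)] free_module_support[OF 2(2)] by auto
    have fg: "f \<oplus>\<^bsub>?F\<^esub> g \<in> carrier ?F" using 2 by simp
    have supp: "{x. (f \<oplus>\<^bsub>?F\<^esub> g) x \<noteq> \<zero>\<^bsub>R\<^esub>} \<subseteq> ?G"
      by (auto simp: free_module_ops)
    have "free_lift R E t (f \<oplus>\<^bsub>?F\<^esub> g) = (\<Oplus>\<^bsub>E\<^esub>x\<in>?G. (f \<oplus>\<^bsub>?F\<^esub> g) x \<odot>\<^bsub>E\<^esub> t x)"
      by (rule free_lift_superset[OF E fg t G(1) supp G(2)])
    also have "\<dots> = (\<Oplus>\<^bsub>E\<^esub>x\<in>?G. f x \<odot>\<^bsub>E\<^esub> t x \<oplus>\<^bsub>E\<^esub> g x \<odot>\<^bsub>E\<^esub> t x)"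
      by (rule E.finsum_cong')
        (use G(2) t v 2 in \<open>auto simp: free_module_ops subset_iff intro!: c left_module.smult_add_left[OF E]\<close>)
    also have "\<dots> = (\<Oplus>\<^bsub>E\<^esub>x\<in>?G. f x \<odot>\<^bsub>E\<^esub> t x) \<oplus>\<^bsub>E\<^esub> (\<Oplus>\<^bsub>E\<^esub>x\<in>?G. g x \<odot>\<^bsub>E\<^esub> t x)"
      by (rule E.finsum_addf) (use G(2) t v 2 in \<open>auto simp: subset_iff intro!: c\<close>)
    also have "\<dots> = free_lift R E t f \<oplus>\<^bsub>E\<^esub> free_lift R E t g"
      using free_lift_superset[OF E 2(1) t G(1) _ G(2)] free_lift_superset[OF E 2(2) t G(1) _ G(2)]
      by auto
    finally show ?case .
  next
    case (3 r f)
    let ?G = "{x. f x \<noteq> \<zero>\<^bsub>R\<^esub>}"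
    note G = free_module_support[OF 3(2)]
    have fg: "r \<odot>\<^bsub>?F\<^esub> f \<in> carrier ?F" using 3 by (simp add: left_module.smult_closed[OF F])
    have supp: "{x. (r \<odot>\<^bsub>?F\<^esub> f) x \<noteq> \<zero>\<^bsub>R\<^esub>} \<subseteq> ?G"
      using 3(1) by (auto simp: free_module_ops)
    have "free_lift R E t (r \<odot>\<^bsub>?F\<^esub> f) = (\<Oplus>\<^bsub>E\<^esub>x\<in>?G. (r \<odot>\<^bsub>?F\<^esub> f) x \<odot>\<^bsub>E\<^esub> t x)"
      by (rule free_lift_superset[OF E fg t G(1) supp G(2)])
    also have "\<dots> = (\<Oplus>\<^bsub>E\<^esub>x\<in>?G. r \<odot>\<^bsub>E\<^esub> (f x \<odot>\<^bsub>E\<^esub> t x))"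
      by (rule E.finsum_cong')
        (use G(2) t v 3 in \<open>auto simp: free_module_ops subset_iff intro!: c left_module.smult_assoc[OF E]\<close>)
    also have "\<dots> = r \<odot>\<^bsub>E\<^esub> free_lift R E t f"
      unfolding free_lift_def
      by (rule left_module_smult_finsum[symmetric, OF E 3(1) G(1)])
        (use G(2) t v 3 in \<open>auto simp: subset_iff intro!: c\<close>)
    finally show ?case .
  qed (rule F)
qed

lemma free_lift_basis:
  assumes E: "left_module R E" and t: "\<And>x. x \<in> S \<Longrightarrow> t x \<in> carrier E" and x: "x \<in> S"
  shows "free_lift R E t (free_basis R x) = t x"
proof -
  have ring: "ring R" by (rule left_module_ring[OF E])
  interpret E: abelian_group E using E by (rule left_module_abelian_group)
  have "free_lift R E t (free_basis R x) = (\<Oplus>\<^bsub>E\<^esub>y\<in>{x}. free_basis R x y \<odot>\<^bsub>E\<^esub> t y)"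
    by (rule free_lift_superset[OF E free_basis_closed[OF ring x] t])
      (auto simp: x free_basis_def)
  then show ?thesis
    using t[OF x] by (simp add: free_basis_def left_module.smult_one[OF E])
qed

lemma module_Hom_free_lift:
  assumes E: "left_module R E" and E': "left_module R E'" and k: "k \<in> module_Hom R E E'"
    and t: "\<And>x. x \<in> S \<Longrightarrow> t x \<in> carrier E" and p: "p \<in> carrier (free_module R S)"
  shows "k (free_lift R E t p) = free_lift R E' (\<lambda>x. k (t x)) p"
proof -
  have ring: "ring R" by (rule left_module_ring[OF E])
  interpret E': abelian_group E' using E' by (rule left_module_abelian_group)
  note v = free_module_val[OF ring p] and supp = free_module_support[OF p]
  have "k (free_lift R E t p) = (\<Oplus>\<^bsub>E'\<^esub>x\<in>{x. p x \<noteq> \<zero>\<^bsub>R\<^esub>}. k (p x \<odot>\<^bsub>E\<^esub> t x))"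
    unfolding free_lift_def
    by (rule module_Hom_finsum[OF k E E' supp(1)])
      (use v supp(2) t in \<open>auto simp: subset_iff intro!: left_module.smult_closed[OF E]\<close>)
  also have "\<dots> = free_lift R E' (\<lambda>x. k (t x)) p"
    unfolding free_lift_def
    by (rule E'.finsum_cong')
      (use v supp(2) t in \<open>auto simp: subset_iff module_Hom_smult[OF k] module_Hom_closed[OF k]
        intro!: left_module.smult_closed[OF E']\<close>)
  finally show ?thesis .
qed

lemma free_lift_cong:
  assumes "left_module R E" "p \<in> carrier (free_module R S)"
    and "\<And>x. x \<in> S \<Longrightarrow> t x = t' x" and t': "\<And>x. x \<in> S \<Longrightarrow> t' x \<in> carrier E"
  shows "free_lift R E t p = free_lift R E t' p"
proof -
  interpret E: abelian_group E using assms(1) by (rule left_module_abelian_group)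
  show ?thesis
    unfolding free_lift_def
    by (rule E.finsum_cong')
      (use free_module_support[OF assms(2)] assms(3) t'
          free_module_val[OF left_module_ring[OF assms(1)] assms(2)]
        in \<open>auto simp: subset_iff intro!: left_module.smult_closed[OF assms(1)]\<close>)
qed

lemma free_eval_Hom:
  "left_module R M \<Longrightarrow>
    restrict (free_eval R M) (carrier (free_module R (carrier M)))
      \<in> module_Hom R (free_module R (carrier M)) M"
  unfolding free_eval_conv_lift by (rule free_lift_Hom)

lemma free_eval_basis:
  "\<lbrakk>left_module R M; x \<in> carrier M\<rbrakk> \<Longrightarrow> free_eval R M (free_basis R x) = x"
  unfolding free_eval_conv_lift by (rule free_lift_basis)


section \<open>Vanishing of the first Ext group\<close>

lemma carrier_syzygy:
  "carrier (syzygy R M) = {p \<in> carrier (free_module R (carrier M)). free_eval R M p = \<zero>\<^bsub>M\<^esub>}"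
  by (simp add: syzygy_def)

lemma syzygy_ops:
  "x \<oplus>\<^bsub>syzygy R M\<^esub> y = x \<oplus>\<^bsub>free_module R (carrier M)\<^esub> y"
  "r \<odot>\<^bsub>syzygy R M\<^esub> x = r \<odot>\<^bsub>free_module R (carrier M)\<^esub> x"
  "\<zero>\<^bsub>syzygy R M\<^esub> = \<zero>\<^bsub>free_module R (carrier M)\<^esub>"
  by (simp_all add: syzygy_def)

abbreviation canonical_epi :: "('r, 'e) ring_scheme \<Rightarrow> ('r, 'a) module \<Rightarrow> ('a \<Rightarrow> 'r) \<Rightarrow> 'a"
  where "canonical_epi R M \<equiv> restrict (free_eval R M) (carrier (free_module R (carrier M)))"

lemma hom_kernel_canonical_epi:
  "hom_kernel (canonical_epi R M) (free_module R (carrier M)) M = syzygy R M"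
  unfolding hom_kernel_def syzygy_def
  by (rule arg_cong[where f = "\<lambda>S. (free_module R (carrier M))\<lparr>carrier := S\<rparr>"]) auto

lemma canonical_epi_onto:
  assumes M: "left_module R M"
  shows "canonical_epi R M ` carrier (free_module R (carrier M)) = carrier M"
proof (intro equalityI subsetI)
  fix x assume x: "x \<in> carrier M"
  show "x \<in> canonical_epi R M ` carrier (free_module R (carrier M))"
    by (rule image_eqI[of _ _ "free_basis R x"])
      (use x in \<open>auto simp: free_eval_basis[OF M] free_basis_closed[OF left_module_ring[OF M]]\<close>)
qed (use module_Hom_closed[OF free_eval_Hom[OF M]] in auto)

lemma left_module_syzygy:
  assumes M: "left_module R M"
  shows "left_module R (syzygy R M)"
proof -
  show ?thesis
    using left_module_kernel[OF free_eval_Hom[OF M] left_module_free[OF left_module_ring[OF M]] M]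
    by (simp only: hom_kernel_canonical_epi)
qed

context
  fixes R :: "('r, 'e) ring_scheme" and M :: "('r, 'a) module"
  assumes M: "left_module R M"
begin

private abbreviation (input) "F \<equiv> free_module R (carrier M)"

lemma free_eval_closed: "p \<in> carrier F \<Longrightarrow> free_eval R M p \<in> carrier M"
  using module_Hom_closed[OF free_eval_Hom[OF M], of p] by simp

lemma free_eval_add: "\<lbrakk>p \<in> carrier F; q \<in> carrier F\<rbrakk>
    \<Longrightarrow> free_eval R M (p \<oplus>\<^bsub>F\<^esub> q) = free_eval R M p \<oplus>\<^bsub>M\<^esub> free_eval R M q"
  using module_Hom_add[OF free_eval_Hom[OF M], of p q]
    abelian_monoid.a_closed[OF abelian_group.axioms(1)[OF left_module_abelian_group[OF
      left_module_free[OF left_module_ring[OF M]]]], of p "carrier M" q]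
  by simp

lemma free_eval_smult: "\<lbrakk>r \<in> carrier R; p \<in> carrier F\<rbrakk>
    \<Longrightarrow> free_eval R M (r \<odot>\<^bsub>F\<^esub> p) = r \<odot>\<^bsub>M\<^esub> free_eval R M p"
  using module_Hom_smult[OF free_eval_Hom[OF M], of r p]
    left_module.smult_closed[OF left_module_free[OF left_module_ring[OF M]], of r p "carrier M"]
  by simp

end

text \<open>
  The vanishing of \<open>Ext1 R X Y\<close> in terms of the first syzygy alone, for modules on arbitrary
  carrier types.
\<close>

definition extends_from_syzygy :: "('r, 'e) ring_scheme \<Rightarrow> ('r, 'a) module \<Rightarrow> ('r, 'b) module \<Rightarrow> bool"
  where "extends_from_syzygy R X Y \<longleftrightarrow>
    (\<forall>\<phi>\<in>module_Hom R (syzygy R X) Y. \<exists>h\<in>module_Hom R (free_module R (carrier X)) Y.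
       \<forall>p\<in>carrier (syzygy R X). h p = \<phi> p)"

text \<open>
  A homomorphism on \<open>P\<^sub>1\<close> is a cocycle iff it vanishes on the kernel of the epimorphism onto the syzygy
  of \<open>X\<close>, that is, iff it is induced by a homomorphism \<open>\<phi>\<close> on the syzygy.  It is a coboundary iff this
  \<open>\<phi>\<close> extends to \<open>P\<^sub>0\<close>.
\<close>

lemma trivial_Ext1_iff:
  assumes X: "left_module R X" and Y: "left_module R Y"
  shows "trivial_group (Ext1 R X Y) \<longleftrightarrow> extends_from_syzygy R X Y"
proof -
  define P0 where "P0 = free_module R (carrier X)"
  define K0 where "K0 = syzygy R X"
  define P1 where "P1 = free_module R (carrier K0)"
  define K1 where "K1 = syzygy R K0"
  define P2 where "P2 = free_module R (carrier K1)"
  define e where "e = free_eval R K0"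
  define G where "G = (Hom_group R P1 Y)\<lparr>carrier := ext_cocycles R X Y\<rparr>"
  define H where "H = ext_coboundaries R X Y"
  have ring: "ring R" by (rule left_module_ring[OF X])
  have P0: "left_module R P0" unfolding P0_def by (rule left_module_free[OF ring])
  have K0: "left_module R K0" unfolding K0_def by (rule left_module_syzygy[OF X])
  have P1: "left_module R P1" unfolding P1_def by (rule left_module_free[OF ring])
  have K1: "left_module R K1" unfolding K1_def by (rule left_module_syzygy[OF K0])
  interpret Y: abelian_group Y using Y by (rule left_module_abelian_group)
  have K0_sub: "carrier K0 \<subseteq> carrier P0" and K1_sub: "carrier K1 \<subseteq> carrier P1"
    by (auto simp: K0_def P0_def K1_def P1_def carrier_syzygy)
  have K0_ops: "x \<oplus>\<^bsub>K0\<^esub> y = x \<oplus>\<^bsub>P0\<^esub> y" "r \<odot>\<^bsub>K0\<^esub> x = r \<odot>\<^bsub>P0\<^esub> x" for x y r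
    by (simp_all add: K0_def P0_def syzygy_ops)
  have e_closed: "e p \<in> carrier K0" if "p \<in> carrier P1" for p
    using free_eval_closed[OF K0] that by (simp add: e_def P1_def)
  have e_add: "e (p \<oplus>\<^bsub>P1\<^esub> q) = e p \<oplus>\<^bsub>K0\<^esub> e q" if "p \<in> carrier P1" "q \<in> carrier P1" for p q
    using free_eval_add[OF K0] that by (simp add: e_def P1_def)
  have e_smult: "e (r \<odot>\<^bsub>P1\<^esub> p) = r \<odot>\<^bsub>K0\<^esub> e p" if "r \<in> carrier R" "p \<in> carrier P1" for p r
    using free_eval_smult[OF K0] that by (simp add: e_def P1_def)
  have basis: "free_basis R k \<in> carrier P1" "e (free_basis R k) = k" if "k \<in> carrier K0" for k
    using that free_basis_closed[OF ring that] free_eval_basis[OF K0 that]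
    by (simp_all add: e_def P1_def)
  have K1_iff: "p \<in> carrier K1 \<longleftrightarrow> p \<in> carrier P1 \<and> e p = \<zero>\<^bsub>K0\<^esub>" for p
    by (auto simp: K1_def P1_def carrier_syzygy e_def)
  \<comment> \<open>the elements of \<open>P\<^sub>2\<close> evaluate to all elements of \<open>K\<^sub>1\<close>\<close>
  have cocycle_iff: "g \<in> ext_cocycles R X Y \<longleftrightarrow>
      g \<in> module_Hom R P1 Y \<and> (\<forall>p\<in>carrier K1. g p = \<zero>\<^bsub>Y\<^esub>)" (is "?L g \<longleftrightarrow> ?R g") for g
  proof
    assume L: "?L g"
    show "?R g"
    proof (intro conjI ballI)
      fix p assume p: "p \<in> carrier K1"
      have "free_basis R p \<in> carrier P2" "free_eval R K1 (free_basis R p) = p"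
        using p free_basis_closed[OF ring] free_eval_basis[OF K1] by (simp_all add: P2_def)
      then show "g p = \<zero>\<^bsub>Y\<^esub>"
        using L by (force simp: ext_cocycles_def Let_def P2_def K1_def K0_def)
    qed (use L in \<open>auto simp: ext_cocycles_def Let_def P1_def K0_def\<close>)
  next
    assume R: "?R g"
    then show "?L g"
      using free_eval_closed[OF K1]
      by (auto simp: ext_cocycles_def Let_def P1_def K1_def K0_def)
  qed
  have H: "H = (\<lambda>h. \<lambda>p\<in>carrier P1. h (e p)) ` module_Hom R P0 Y"
    by (simp add: H_def ext_coboundaries_def Let_def P1_def P0_def K0_def e_def)
  have comp_cocycle: "(\<lambda>p\<in>carrier P1. \<phi> (e p)) \<in> ext_cocycles R X Y"
    if \<phi>: "\<phi> \<in> module_Hom R K0 Y" for \<phi>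
    unfolding cocycle_iff
  proof
    show "(\<lambda>p\<in>carrier P1. \<phi> (e p)) \<in> module_Hom R P1 Y"
      by (rule module_HomI)
        (use P1 e_closed in \<open>auto simp: e_add e_smult module_Hom_add[OF \<phi>] module_Hom_smult[OF \<phi>]
          module_Hom_closed[OF \<phi>]\<close>)
    show "\<forall>p\<in>carrier K1. (\<lambda>p\<in>carrier P1. \<phi> (e p)) p = \<zero>\<^bsub>Y\<^esub>"
      by (auto simp: K1_iff module_Hom_zero[OF \<phi> K0 Y])
  qed
  have zero_H: "(\<lambda>p\<in>carrier P1. \<zero>\<^bsub>Y\<^esub>) \<in> H"
  proof -
    have *: "(\<lambda>p\<in>carrier P0. \<zero>\<^bsub>Y\<^esub>) \<in> module_Hom R P0 Y"
      by (rule module_HomI) (auto simp: P0 left_module_smult_zero_right[OF Y])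
    show ?thesis
      unfolding H by (rule image_eqI[OF _ *]) (use e_closed K0_sub in \<open>auto simp: fun_eq_iff\<close>)
  qed
  have H_sub: "H \<subseteq> ext_cocycles R X Y"
  proof
    fix g assume "g \<in> H"
    then obtain h where h: "h \<in> module_Hom R P0 Y" and g: "g = (\<lambda>p\<in>carrier P1. h (e p))"
      unfolding H by auto
    have "restrict h (carrier K0) \<in> module_Hom R K0 Y"
      by (rule module_HomI)
        (use h K0 K0_sub in \<open>auto simp: K0_ops module_Hom_add module_Hom_smult module_Hom_closed subset_iff\<close>)
    from comp_cocycle[OF this] show "g \<in> ext_cocycles R X Y"
      unfolding g by (rule back_subst[of "\<lambda>x. x \<in> _"]) (auto simp: e_closed)
  qed
  have coboundary_iff: "(\<forall>g\<in>ext_cocycles R X Y. g \<in> H) \<longleftrightarrow> extends_from_syzygy R X Y"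
  proof
    assume *: "\<forall>g\<in>ext_cocycles R X Y. g \<in> H"
    show "extends_from_syzygy R X Y"
      unfolding extends_from_syzygy_def K0_def[symmetric] P0_def[symmetric]
    proof
      fix \<phi> assume \<phi>: "\<phi> \<in> module_Hom R K0 Y"
      have "(\<lambda>p\<in>carrier P1. \<phi> (e p)) \<in> H"
        using * comp_cocycle[OF \<phi>] by blast
      then obtain h where h: "h \<in> module_Hom R P0 Y"
        and eq: "(\<lambda>p\<in>carrier P1. \<phi> (e p)) = (\<lambda>p\<in>carrier P1. h (e p))"
        unfolding H by auto
      have "h k = \<phi> k" if "k \<in> carrier K0" for k
        using fun_cong[OF eq, of "free_basis R k"] basis[OF that] by simp
      with h show "\<exists>h\<in>module_Hom R P0 Y. \<forall>p\<in>carrier K0. h p = \<phi> p" by blast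
    qed
  next
    assume *: "extends_from_syzygy R X Y"
    show "\<forall>g\<in>ext_cocycles R X Y. g \<in> H"
    proof
      fix g assume "g \<in> ext_cocycles R X Y"
      then have g: "g \<in> module_Hom R P1 Y" and gK: "\<And>p. p \<in> carrier K1 \<Longrightarrow> g p = \<zero>\<^bsub>Y\<^esub>"
        by (auto simp: cocycle_iff)
      have "canonical_epi R K0 ` carrier P1 = carrier K0" and "canonical_epi R K0 \<in> module_Hom R P1 K0"
        unfolding P1_def by (rule canonical_epi_onto[OF K0], rule free_eval_Hom[OF K0])
      from factor_through_epimorphism[OF P1 K0 Y this(2,1) g] gK
      obtain \<phi> where "\<phi> \<in> module_Hom R K0 Y" and g\<phi>: "\<And>p. p \<in> carrier P1 \<Longrightarrow> g p = \<phi> (e p)"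
        by (auto simp: K1_iff e_def P1_def[symmetric])
      then obtain h where h: "h \<in> module_Hom R P0 Y" and eq: "\<And>k. k \<in> carrier K0 \<Longrightarrow> h k = \<phi> k"
        using * unfolding extends_from_syzygy_def K0_def[symmetric] P0_def[symmetric] by blast
      have "g = (\<lambda>p\<in>carrier P1. h (e p))"
        by (rule extensionalityI[OF module_Hom_extensional[OF g]]) (auto simp: g\<phi> eq e_closed)
      then show "g \<in> H" unfolding H using h by blast
    qed
  qed
  have one_G: "\<one>\<^bsub>G\<^esub> = (\<lambda>p\<in>carrier P1. \<zero>\<^bsub>Y\<^esub>)"
    and mult_G: "f \<otimes>\<^bsub>G\<^esub> g = (\<lambda>p\<in>carrier P1. f p \<oplus>\<^bsub>Y\<^esub> g p)" for f g
    by (simp_all add: G_def Hom_group_def)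
  have car_G: "carrier G = ext_cocycles R X Y" by (simp add: G_def)
  have Ext1: "Ext1 R X Y = G Mod H"
    by (simp add: Ext1_def G_def H_def P1_def K0_def)
  have G_closed: "f \<otimes>\<^bsub>G\<^esub> g \<in> carrier G" if "f \<in> carrier G" "g \<in> carrier G" for f g
  proof -
    have f: "f \<in> module_Hom R P1 Y" "\<And>p. p \<in> carrier K1 \<Longrightarrow> f p = \<zero>\<^bsub>Y\<^esub>"
      and g: "g \<in> module_Hom R P1 Y" "\<And>p. p \<in> carrier K1 \<Longrightarrow> g p = \<zero>\<^bsub>Y\<^esub>"
      using that by (auto simp: car_G cocycle_iff)
    have "f \<otimes>\<^bsub>G\<^esub> g \<in> module_Hom R P1 Y"
      unfolding mult_G
      by (rule module_HomI)
        (use f g P1 in \<open>auto simp: module_Hom_add module_Hom_smult module_Hom_closed Y.a_ac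
          left_module.smult_add_right[OF Y]\<close>)
    with f g K1_sub show ?thesis by (auto simp: car_G cocycle_iff mult_G)
  qed
  have G_one: "\<one>\<^bsub>G\<^esub> \<otimes>\<^bsub>G\<^esub> g = g" if "g \<in> carrier G" for g
  proof -
    have g: "g \<in> module_Hom R P1 Y" using that by (simp add: car_G cocycle_iff)
    show ?thesis
      unfolding mult_G one_G
      by (rule extensionalityI[OF _ module_Hom_extensional[OF g]]) (auto simp: module_Hom_closed[OF g])
  qed
  show ?thesis
  proof
    assume "trivial_group (Ext1 R X Y)"
    then have triv: "carrier (G Mod H) = {H}"
      by (simp add: Ext1 trivial_group_def FactGroup_def)
    have "g \<in> H" if g: "g \<in> ext_cocycles R X Y" for g
    proof -
      have "H #>\<^bsub>G\<^esub> g \<in> carrier (G Mod H)"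
        using g by (auto simp: FactGroup_def RCOSETS_def car_G)
      then have "H #>\<^bsub>G\<^esub> g = H" using triv by auto
      moreover have "g \<in> H #>\<^bsub>G\<^esub> g"
        using zero_H G_one[of g] g unfolding r_coset_def one_G[symmetric] car_G by force
      ultimately show ?thesis by simp
    qed
    then show "extends_from_syzygy R X Y" using coboundary_iff by blast
  next
    assume "extends_from_syzygy R X Y"
    then have HG: "H = carrier G" using coboundary_iff H_sub car_G by auto
    interpret G: group G
    proof (rule groupI)
      fix f assume "f \<in> carrier G"
      then have f: "f \<in> module_Hom R P1 Y" "\<And>p. p \<in> carrier K1 \<Longrightarrow> f p = \<zero>\<^bsub>Y\<^esub>"
        by (auto simp: car_G cocycle_iff)
      have z: "(\<lambda>p\<in>carrier P1. \<zero>\<^bsub>Y\<^esub>) \<in> module_Hom R P1 Y"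
        using zero_H H_sub cocycle_iff by blast
      let ?g = "\<lambda>p\<in>carrier P1. (\<lambda>p\<in>carrier P1. \<zero>\<^bsub>Y\<^esub>) p \<ominus>\<^bsub>Y\<^esub> f p"
      have "?g \<in> carrier G"
        using f K1_sub module_Hom_diff[OF z f(1) P1 Y]
        by (auto simp: car_G cocycle_iff Y.minus_zero_right)
      moreover have "?g \<otimes>\<^bsub>G\<^esub> f = \<one>\<^bsub>G\<^esub>"
        unfolding mult_G one_G
        by (rule restrict_ext) (simp add: a_minus_def module_Hom_closed[OF f(1)] Y.l_neg)
      ultimately show "\<exists>g\<in>carrier G. g \<otimes>\<^bsub>G\<^esub> f = \<one>\<^bsub>G\<^esub>" by blast
    next
      fix f g h assume "f \<in> carrier G" "g \<in> carrier G" "h \<in> carrier G"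
      then show "f \<otimes>\<^bsub>G\<^esub> g \<otimes>\<^bsub>G\<^esub> h = f \<otimes>\<^bsub>G\<^esub> (g \<otimes>\<^bsub>G\<^esub> h)"
        by (auto simp: car_G cocycle_iff mult_G Y.a_assoc module_Hom_closed intro!: restrict_ext)
    qed (use G_closed G_one zero_H HG one_G in auto)
    have "group (G Mod carrier G)"
      by (rule normal.factorgroup_is_group) (simp add: G.normal_self)
    moreover have "carrier (G Mod carrier G) = {\<one>\<^bsub>G Mod carrier G\<^esub>}"
      by (auto simp: FactGroup_def RCOSETS_def G.coset_join2 G.subgroup_self)
    ultimately show "trivial_group (Ext1 R X Y)"
      by (simp add: Ext1 HG trivial_group_def)
  qed
qed

text \<open>
  If \<open>Ext(L, C)\<close> vanishes, then homomorphisms to \<open>C\<close> extend not only from the syzygy of \<open>L\<close> but from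
  the kernel of any epimorphism \<open>\<pi>\<close> from \<open>E\<close> onto \<open>L\<close>.  The free module on \<open>L\<close> maps to \<open>E\<close> over \<open>L\<close>, so
  \<open>E\<close> is a quotient of the sum of this free module and the kernel of \<open>\<pi>\<close>.  On the first summand one
  takes an extension from the syzygy, on the second one the given homomorphism.
\<close>

lemma extend_from_kernel:
  assumes L: "left_module R L" and E: "left_module R E" and C: "left_module R C"
    and ext: "extends_from_syzygy R L C"
    and \<pi>: "\<pi> \<in> module_Hom R E L" and onto: "\<pi> ` carrier E = carrier L"
    and \<phi>: "\<phi> \<in> module_Hom R (hom_kernel \<pi> E L) C"
  shows "\<exists>\<Phi>\<in>module_Hom R E C. \<forall>k\<in>carrier (hom_kernel \<pi> E L). \<Phi> k = \<phi> k"
proof -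
  define F where "F = free_module R (carrier L)"
  define K where "K = hom_kernel \<pi> E L"
  define t where "t = inv_into (carrier E) \<pi>"
  define lam where "lam = restrict (free_lift R E t) (carrier F)"
  have F: "left_module R F" unfolding F_def by (rule left_module_free[OF left_module_ring[OF L]])
  have K: "left_module R K" unfolding K_def by (rule left_module_kernel[OF \<pi> E L])
  interpret E: abelian_group E using E by (rule left_module_abelian_group)
  interpret L: abelian_group L using L by (rule left_module_abelian_group)
  interpret C: abelian_group C using C by (rule left_module_abelian_group)
  interpret F: abelian_group F using F by (rule left_module_abelian_group)
  interpret K: abelian_group K using K by (rule left_module_abelian_group)
  have K_simps: "k \<in> carrier K \<longleftrightarrow> k \<in> carrier E \<and> \<pi> k = \<zero>\<^bsub>L\<^esub>" "k \<oplus>\<^bsub>K\<^esub> l = k \<oplus>\<^bsub>E\<^esub> l"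
    "r \<odot>\<^bsub>K\<^esub> k = r \<odot>\<^bsub>E\<^esub> k" "\<zero>\<^bsub>K\<^esub> = \<zero>\<^bsub>E\<^esub>" for k l r
    by (simp_all add: K_def hom_kernel_def)
  have syz: "q \<in> carrier (syzygy R L) \<longleftrightarrow> q \<in> carrier F \<and> free_eval R L q = \<zero>\<^bsub>L\<^esub>" for q
    by (simp add: carrier_syzygy F_def)
  have \<phi>: "\<phi> \<in> module_Hom R K C" using \<phi> by (simp add: K_def)
  have t: "t l \<in> carrier E" "\<pi> (t l) = l" if "l \<in> carrier L" for l
    using that onto by (auto simp: t_def inv_into_into f_inv_into_f)
  have lam: "lam \<in> module_Hom R F E"
    unfolding lam_def F_def by (rule free_lift_Hom[OF E t(1)])
  have \<pi>_lam: "\<pi> (lam q) = free_eval R L q" if q: "q \<in> carrier F" for q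
  proof -
    have q': "q \<in> carrier (free_module R (carrier L))" using q by (simp add: F_def)
    have "\<pi> (lam q) = free_lift R L (\<lambda>l. \<pi> (t l)) q"
      using q module_Hom_free_lift[OF E L \<pi> t(1) q'] by (simp add: lam_def)
    also have "\<dots> = free_eval R L q"
      unfolding free_eval_conv_lift by (rule free_lift_cong[OF L q']) (auto simp: t)
    finally show ?thesis .
  qed
  have lam_K: "lam q \<in> carrier K" if "q \<in> carrier (syzygy R L)" for q
    using that module_Hom_closed[OF lam] by (simp add: K_simps syz \<pi>_lam)
  have "(\<lambda>q\<in>carrier (syzygy R L). \<phi> (lam q)) \<in> module_Hom R (syzygy R L) C"
  proof (rule module_HomI[OF _ _ _ left_module_syzygy[OF L]])
    fix p q assume pq: "p \<in> carrier (syzygy R L)" "q \<in> carrier (syzygy R L)"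
    then have "\<phi> (lam (p \<oplus>\<^bsub>syzygy R L\<^esub> q)) = \<phi> (lam p \<oplus>\<^bsub>K\<^esub> lam q)"
      by (simp add: syz syzygy_ops F_def[symmetric] K_simps module_Hom_add[OF lam])
    then show "\<phi> (lam (p \<oplus>\<^bsub>syzygy R L\<^esub> q)) = \<phi> (lam p) \<oplus>\<^bsub>C\<^esub> \<phi> (lam q)"
      using pq by (simp add: module_Hom_add[OF \<phi>] lam_K)
  next
    fix r q assume rq: "r \<in> carrier R" "q \<in> carrier (syzygy R L)"
    then have "\<phi> (lam (r \<odot>\<^bsub>syzygy R L\<^esub> q)) = \<phi> (r \<odot>\<^bsub>K\<^esub> lam q)"
      by (simp add: syz syzygy_ops F_def[symmetric] K_simps module_Hom_smult[OF lam])
    then show "\<phi> (lam (r \<odot>\<^bsub>syzygy R L\<^esub> q)) = r \<odot>\<^bsub>C\<^esub> \<phi> (lam q)"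
      using rq by (simp add: module_Hom_smult[OF \<phi>] lam_K)
  qed (auto simp: module_Hom_closed[OF \<phi>] lam_K)
  then obtain \<psi> where \<psi>: "\<psi> \<in> module_Hom R F C"
    and \<psi>_eq: "\<And>q. q \<in> carrier (syzygy R L) \<Longrightarrow> \<psi> q = \<phi> (lam q)"
    using ext unfolding extends_from_syzygy_def F_def[symmetric] by fastforce
  define Q where "Q = pair_module F K"
  have Q: "left_module R Q" unfolding Q_def by (rule left_module_pair[OF F K])
  have Q_car: "carrier Q = carrier F \<times> carrier K" by (simp add: Q_def pair_module_def)
  have incl: "(\<lambda>k\<in>carrier K. k) \<in> module_Hom R K E"
    by (rule module_HomI) (auto simp: K K_simps)
  define \<mu> where "\<mu> = (\<lambda>x\<in>carrier Q. lam (fst x) \<oplus>\<^bsub>E\<^esub> (\<lambda>k\<in>carrier K. k) (snd x))"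
  define \<Phi>' where "\<Phi>' = (\<lambda>x\<in>carrier Q. \<psi> (fst x) \<oplus>\<^bsub>C\<^esub> \<phi> (snd x))"
  have \<mu>: "\<mu> \<in> module_Hom R Q E" unfolding \<mu>_def Q_def by (rule pair_module_Hom[OF F K E lam incl])
  have \<Phi>': "\<Phi>' \<in> module_Hom R Q C" unfolding \<Phi>'_def Q_def by (rule pair_module_Hom[OF F K C \<psi> \<phi>])
  have \<mu>_onto: "\<mu> ` carrier Q = carrier E"
  proof (intro equalityI subsetI)
    fix x assume x: "x \<in> carrier E"
    define q where "q = free_basis R (\<pi> x)"
    have \<pi>x: "\<pi> x \<in> carrier L" using x by (rule module_Hom_closed[OF \<pi>])
    have q: "q \<in> carrier F" "free_eval R L q = \<pi> x"
      using free_basis_closed[OF left_module_ring[OF L] \<pi>x] free_eval_basis[OF L \<pi>x]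
      by (simp_all add: q_def F_def)
    have lq: "lam q \<in> carrier E" using q by (simp add: module_Hom_closed[OF lam])
    have k: "x \<ominus>\<^bsub>E\<^esub> lam q \<in> carrier K"
      using x q lq \<pi>x by (simp add: K_simps module_Hom_minus[OF \<pi> E L] \<pi>_lam L.r_neg a_minus_def[of L])
    show "x \<in> \<mu> ` carrier Q"
      by (rule image_eqI[of _ _ "(q, x \<ominus>\<^bsub>E\<^esub> lam q)"])
        (use x q k lq in \<open>auto simp: \<mu>_def Q_car E.add_minus_cancel\<close>)
  qed (auto dest: module_Hom_closed[OF \<mu>])
  have "\<Phi>' x = \<zero>\<^bsub>C\<^esub>" if x: "x \<in> carrier Q" and zero: "\<mu> x = \<zero>\<^bsub>E\<^esub>" for x
  proof -
    obtain q k where qk: "x = (q, k)" "q \<in> carrier F" "k \<in> carrier K" using x by (auto simp: Q_car)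
    have sum: "lam q \<oplus>\<^bsub>E\<^esub> k = \<zero>\<^bsub>E\<^esub>" using zero qk x by (simp add: \<mu>_def)
    have "\<pi> (lam q \<oplus>\<^bsub>E\<^esub> k) = free_eval R L q"
      using qk module_Hom_closed[OF lam] module_Hom_closed[OF \<pi>]
      by (simp add: K_simps module_Hom_add[OF \<pi>] \<pi>_lam[symmetric])
    then have q: "q \<in> carrier (syzygy R L)"
      using qk sum by (simp add: syz module_Hom_zero[OF \<pi> E L])
    have "\<Phi>' x = \<phi> (lam q \<oplus>\<^bsub>K\<^esub> k)"
      using qk x q by (simp add: \<Phi>'_def \<psi>_eq module_Hom_add[OF \<phi>] lam_K)
    also have "\<dots> = \<zero>\<^bsub>C\<^esub>"
      using sum module_Hom_zero[OF \<phi> K C] by (simp add: K_simps)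
    finally show ?thesis .
  qed
  then obtain \<Phi> where \<Phi>: "\<Phi> \<in> module_Hom R E C" "\<forall>x\<in>carrier Q. \<Phi> (\<mu> x) = \<Phi>' x"
    using factor_through_epimorphism[OF Q E C \<mu> \<mu>_onto \<Phi>'] by blast
  have "\<Phi> k = \<phi> k" if k: "k \<in> carrier K" for k
    using \<Phi>(2)[rule_format, of "(\<zero>\<^bsub>F\<^esub>, k)"] k module_Hom_closed[OF \<phi> k]
    by (simp add: Q_car \<mu>_def \<Phi>'_def K_simps module_Hom_zero[OF lam F E] module_Hom_zero[OF \<psi> F C])
  with \<Phi>(1) show ?thesis unfolding K_def by blast
qed

text \<open>
  Composing the canonical epimorphism onto \<open>N\<close> with \<open>h\<close> gives an epimorphism onto \<open>L\<close> which has the same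
  kernel.
\<close>

lemma extends_from_syzygy_bij:
  assumes L: "left_module R L" and N: "left_module R N" and C: "left_module R C"
    and ext: "extends_from_syzygy R L C"
    and h: "h \<in> module_Hom R N L" and bij: "bij_betw h (carrier N) (carrier L)"
  shows "extends_from_syzygy R N C"
proof -
  let ?F = "free_module R (carrier N)"
  let ?\<pi> = "compose (carrier ?F) h (canonical_epi R N)"
  interpret N: abelian_group N using N by (rule left_module_abelian_group)
  have F: "left_module R ?F" by (rule left_module_free[OF left_module_ring[OF L]])
  have \<pi>: "?\<pi> \<in> module_Hom R ?F L"
    by (rule module_Hom_compose[OF free_eval_Hom[OF N] h F])
  have onto: "?\<pi> ` carrier ?F = carrier L"
    using canonical_epi_onto[OF N] bij by (simp add: compose_def image_image[symmetric] bij_betw_def cong: image_cong_simp)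
  have "h n = \<zero>\<^bsub>L\<^esub> \<longleftrightarrow> n = \<zero>\<^bsub>N\<^esub>" if "n \<in> carrier N" for n
    using that bij module_Hom_zero[OF h N L] inj_onD[of h "carrier N" n "\<zero>\<^bsub>N\<^esub>"] by (auto simp: bij_betw_def)
  then have "hom_kernel ?\<pi> ?F L = hom_kernel (canonical_epi R N) ?F N"
    using module_Hom_closed[OF free_eval_Hom[OF N]]
    unfolding hom_kernel_def compose_def by (intro arg_cong[where f = "\<lambda>S. ?F\<lparr>carrier := S\<rparr>"]) auto
  then show ?thesis
    using extend_from_kernel[OF L F C ext \<pi> onto]
    unfolding extends_from_syzygy_def hom_kernel_canonical_epi by simp
qed

lemma extends_from_syzygy_zero_module:
  assumes N: "left_module R N" and zero: "carrier N = {\<zero>\<^bsub>N\<^esub>}"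
  shows "extends_from_syzygy R N C"
proof -
  have "free_eval R N p = \<zero>\<^bsub>N\<^esub>" if "p \<in> carrier (free_module R (carrier N))" for p
    using free_eval_closed[OF N that] zero by auto
  then have "carrier (syzygy R N) = carrier (free_module R (carrier N))"
    by (auto simp: carrier_syzygy)
  then show ?thesis
    by (auto simp: extends_from_syzygy_def module_Hom_def syzygy_ops)
qed

text \<open>
  Suppose that \<open>\<phi>\<close> represents an extension of \<open>N\<close> by \<open>C\<close>.  For every set \<open>\<epsilon>\<close> of branches, its pullback
  along \<open>h \<epsilon>\<close> splits since \<open>Ext(L, C)\<close> vanishes, and the splitting restricts to a map from \<open>D\<close> to \<open>C\<close>
  because \<open>h \<epsilon>\<close> vanishes on \<open>D\<close>.  There are more sets of branches than such maps, so two different sets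
  have splittings which agree on \<open>D\<close>.  On the submodule \<open>M b\<close> of a branch \<open>b\<close> that belongs to only one
  of the two sets, the difference of the splittings vanishes on the kernel of \<open>h {b}\<close>, and hence
  descends to a splitting over the image \<open>N\<close> of \<open>M b\<close>.
\<close>

lemma extends_from_syzygy_by_counting:
  assumes L: "left_module R L" and N: "left_module R N" and C: "left_module R C"
    and ext: "extends_from_syzygy R L C"
    and h: "\<And>\<epsilon>. \<epsilon> \<subseteq> B \<Longrightarrow> h \<epsilon> \<in> module_Hom R L N"
    and D: "D \<subseteq> carrier L" and hD: "\<And>\<epsilon> d. \<lbrakk>\<epsilon> \<subseteq> B; d \<in> D\<rbrakk> \<Longrightarrow> h \<epsilon> d = \<zero>\<^bsub>N\<^esub>"
    and card: "|Pow (D \<times> carrier C)| \<le>o |B|"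
    and M: "\<And>b. b \<in> B \<Longrightarrow> M b \<subseteq> carrier L"
    and M_zero: "\<And>b. b \<in> B \<Longrightarrow> \<zero>\<^bsub>L\<^esub> \<in> M b"
    and M_add: "\<And>b x y. \<lbrakk>b \<in> B; x \<in> M b; y \<in> M b\<rbrakk> \<Longrightarrow> x \<oplus>\<^bsub>L\<^esub> y \<in> M b"
    and M_smult: "\<And>b r x. \<lbrakk>b \<in> B; r \<in> carrier R; x \<in> M b\<rbrakk> \<Longrightarrow> r \<odot>\<^bsub>L\<^esub> x \<in> M b"
    and onto: "\<And>b n. \<lbrakk>b \<in> B; n \<in> carrier N\<rbrakk> \<Longrightarrow> \<exists>l\<in>M b. h {b} l = n"
    and ker: "\<And>b l. \<lbrakk>b \<in> B; l \<in> M b; h {b} l = \<zero>\<^bsub>N\<^esub>\<rbrakk> \<Longrightarrow> l \<in> D"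
    and select: "\<And>\<epsilon> b l. \<lbrakk>\<epsilon> \<subseteq> B; b \<in> B; l \<in> M b\<rbrakk>
        \<Longrightarrow> h \<epsilon> l = (if b \<in> \<epsilon> then h {b} l else \<zero>\<^bsub>N\<^esub>)"
  shows "extends_from_syzygy R N C"
  unfolding extends_from_syzygy_def
proof
  fix \<phi> assume \<phi>: "\<phi> \<in> module_Hom R (syzygy R N) C"
  define F where "F = free_module R (carrier N)"
  define e where "e = canonical_epi R N"
  have F: "left_module R F" unfolding F_def by (rule left_module_free[OF left_module_ring[OF L]])
  interpret L: abelian_group L using L by (rule left_module_abelian_group)
  interpret C: abelian_group C using C by (rule left_module_abelian_group)
  interpret N: abelian_group N using N by (rule left_module_abelian_group)
  interpret F: abelian_group F using F by (rule left_module_abelian_group)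
  have e: "e \<in> module_Hom R F N" unfolding e_def F_def by (rule free_eval_Hom[OF N])
  have e_onto: "e ` carrier F = carrier N" unfolding e_def F_def by (rule canonical_epi_onto[OF N])
  have e0: "e \<zero>\<^bsub>F\<^esub> = \<zero>\<^bsub>N\<^esub>" by (rule module_Hom_zero[OF e F N])
  have syz: "k \<in> carrier (syzygy R N) \<longleftrightarrow> k \<in> carrier F \<and> e k = \<zero>\<^bsub>N\<^esub>" for k
    by (auto simp: carrier_syzygy F_def e_def)
  note syz_ops = syzygy_ops[of R N, folded F_def]
  define P where "P = (\<lambda>\<epsilon>. pullback_module L F (h \<epsilon>) e)"
  note P_simps = pullback_module_simps[where L = L and M = F and k = e]
  have "\<exists>\<Phi>. \<Phi> \<in> module_Hom R (P \<epsilon>) C \<and> (\<forall>k\<in>carrier (syzygy R N). \<Phi> (\<zero>\<^bsub>L\<^esub>, k) = \<phi> k)"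
    if \<epsilon>: "\<epsilon> \<subseteq> B" for \<epsilon>
  proof -
    have P: "left_module R (P \<epsilon>)" unfolding P_def by (rule left_module_pullback[OF L F N h[OF \<epsilon>] e])
    let ?\<pi> = "\<lambda>x\<in>carrier (P \<epsilon>). fst x"
    have \<pi>: "?\<pi> \<in> module_Hom R (P \<epsilon>) L" unfolding P_def by (rule pullback_fst[OF L F N h[OF \<epsilon>] e])
    have onto: "?\<pi> ` carrier (P \<epsilon>) = carrier L"
    proof (intro equalityI subsetI)
      fix l assume l: "l \<in> carrier L"
      then have "h \<epsilon> l \<in> e ` carrier F" using module_Hom_closed[OF h[OF \<epsilon>]] e_onto by simp
      then obtain p where "p \<in> carrier F" "h \<epsilon> l = e p" by auto
      with l show "l \<in> ?\<pi> ` carrier (P \<epsilon>)"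
        by (intro image_eqI[of _ _ "(l, p)"]) (auto simp: P_def P_simps)
    qed (auto simp: P_def P_simps)
    have K: "x \<in> carrier (hom_kernel ?\<pi> (P \<epsilon>) L) \<longleftrightarrow> fst x = \<zero>\<^bsub>L\<^esub> \<and> snd x \<in> carrier (syzygy R N)" for x
      using module_Hom_zero[OF h[OF \<epsilon>] L N] by (auto simp: hom_kernel_def P_def P_simps syz)
    have "(\<lambda>x\<in>carrier (hom_kernel ?\<pi> (P \<epsilon>) L). \<phi> (snd x)) \<in> module_Hom R (hom_kernel ?\<pi> (P \<epsilon>) L) C"
      by (rule module_HomI[OF _ _ _ left_module_kernel[OF \<pi> P L]])
        (auto simp: K module_Hom_closed[OF \<phi>] module_Hom_add[OF \<phi>, unfolded syz_ops]
          module_Hom_smult[OF \<phi>, unfolded syz_ops], auto simp: hom_kernel_def P_def P_simps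
          module_Hom_add[OF \<phi>, unfolded syz_ops] module_Hom_smult[OF \<phi>, unfolded syz_ops])
    from extend_from_kernel[OF L P C ext \<pi> onto this] show ?thesis
      by (auto simp: K)
  qed
  then obtain \<Phi> where \<Phi>: "\<And>\<epsilon>. \<epsilon> \<subseteq> B \<Longrightarrow> \<Phi> \<epsilon> \<in> module_Hom R (P \<epsilon>) C"
      "\<And>\<epsilon> k. \<lbrakk>\<epsilon> \<subseteq> B; k \<in> carrier (syzygy R N)\<rbrakk> \<Longrightarrow> \<Phi> \<epsilon> (\<zero>\<^bsub>L\<^esub>, k) = \<phi> k"
    by metis
  \<comment> \<open>restrictions to \<open>D\<close> of the splittings, as sets of pairs\<close>
  define res where "res = (\<lambda>\<epsilon>. (\<lambda>d. (d, \<Phi> \<epsilon> (d, \<zero>\<^bsub>F\<^esub>))) ` D)"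
  have "\<not> inj_on res (Pow B)"
  proof
    assume "inj_on res (Pow B)"
    moreover have "res \<epsilon> \<in> Pow (D \<times> carrier C)" if "\<epsilon> \<in> Pow B" for \<epsilon>
      using that D hD e0 by (auto simp: res_def P_def P_simps intro!: module_Hom_closed[OF \<Phi>(1)])
    ultimately have "|Pow B| \<le>o |Pow (D \<times> carrier C)|" by (rule card_of_ordLeqI)
    from ordLeq_transitive[OF this card] have "|Pow B| \<le>o |B|" .
    then show False using card_of_Pow not_ordLess_ordLeq by blast
  qed
  then obtain \<epsilon> \<epsilon>' where \<epsilon>: "\<epsilon> \<subseteq> B" "\<epsilon>' \<subseteq> B" "res \<epsilon> = res \<epsilon>'" "\<epsilon> \<noteq> \<epsilon>'"
    unfolding inj_on_def by blast
  then consider b where "b \<in> \<epsilon>" "b \<notin> \<epsilon>'" | b where "b \<in> \<epsilon>'" "b \<notin> \<epsilon>"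
    by blast
  then obtain \<delta> \<delta>' b where \<delta>: "\<delta> \<subseteq> B" "\<delta>' \<subseteq> B" "b \<in> \<delta>" "b \<notin> \<delta>'" and "res \<delta> = res \<delta>'"
    using \<epsilon> by cases (use that in \<open>metis+\<close>)
  then have res: "\<Phi> \<delta> (d, \<zero>\<^bsub>F\<^esub>) = \<Phi> \<delta>' (d, \<zero>\<^bsub>F\<^esub>)" if "d \<in> D" for d
    using that by (auto simp: res_def)
  have b: "b \<in> B" using \<delta> by auto
  have h\<delta>: "h \<delta> l = h {b} l" "h \<delta>' l = \<zero>\<^bsub>N\<^esub>" if "l \<in> M b" for l
    using select[OF \<delta>(1) b that] select[OF \<delta>(2) b that] \<delta>(3,4) by simp_all
  define Lb where "Lb = L\<lparr>carrier := M b\<rparr>"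
  have Lb: "left_module R Lb"
    unfolding Lb_def by (rule left_module_submodule[OF L M[OF b] M_zero[OF b] M_add[OF b] M_smult[OF b]])
  have Lb_simps: "carrier Lb = M b" "x \<oplus>\<^bsub>Lb\<^esub> y = x \<oplus>\<^bsub>L\<^esub> y" "r \<odot>\<^bsub>Lb\<^esub> x = r \<odot>\<^bsub>L\<^esub> x" "\<zero>\<^bsub>Lb\<^esub> = \<zero>\<^bsub>L\<^esub>" for x y r
    by (simp_all add: Lb_def)
  have hb: "restrict (h {b}) (M b) \<in> module_Hom R Lb N"
    using h[of "{b}"] b M[OF b] M_add[OF b] M_smult[OF b]
    by (auto simp: module_Hom_def Lb_simps subset_iff)
  \<comment> \<open>for \<open>(l, p)\<close> in \<open>Q\<close>, the pair itself belongs to \<open>P \<delta>\<close>, and \<open>(l, 0)\<close> belongs to \<open>P \<delta>'\<close>\<close>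
  define Q where "Q = pullback_module Lb F (restrict (h {b}) (M b)) e"
  have Q: "left_module R Q" unfolding Q_def by (rule left_module_pullback[OF Lb F N hb e])
  have Q_car: "x \<in> carrier Q \<longleftrightarrow> fst x \<in> M b \<and> snd x \<in> carrier F \<and> h {b} (fst x) = e (snd x)" for x
    by (auto simp: Q_def pullback_module_simps Lb_simps)
  have Q_ops: "x \<oplus>\<^bsub>Q\<^esub> y = (fst x \<oplus>\<^bsub>L\<^esub> fst y, snd x \<oplus>\<^bsub>F\<^esub> snd y)" "r \<odot>\<^bsub>Q\<^esub> x = (r \<odot>\<^bsub>L\<^esub> fst x, r \<odot>\<^bsub>F\<^esub> snd x)" for x y r
    by (simp_all add: Q_def pullback_module_simps Lb_simps)
  have Q_P: "x \<in> carrier (P \<delta>)" "(fst x, \<zero>\<^bsub>F\<^esub>) \<in> carrier (P \<delta>')" if "x \<in> carrier Q" for x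
    using that M[OF b] e0 by (auto simp: Q_car P_def P_simps h\<delta>)
  have P_ops: "x \<oplus>\<^bsub>P \<epsilon>\<^esub> y = (fst x \<oplus>\<^bsub>L\<^esub> fst y, snd x \<oplus>\<^bsub>F\<^esub> snd y)" "r \<odot>\<^bsub>P \<epsilon>\<^esub> x = (r \<odot>\<^bsub>L\<^esub> fst x, r \<odot>\<^bsub>F\<^esub> snd x)" for x y r \<epsilon>
    by (simp_all add: P_def P_simps)
  have u: "(\<lambda>x\<in>carrier Q. \<Phi> \<delta> x) \<in> module_Hom R Q C"
    by (rule module_HomI[OF _ _ _ Q])
      (simp_all add: Q_P module_Hom_closed[OF \<Phi>(1)[OF \<delta>(1)]] module_Hom_add[OF \<Phi>(1)[OF \<delta>(1)], symmetric]
        module_Hom_smult[OF \<Phi>(1)[OF \<delta>(1)], symmetric] Q_ops P_ops)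
  have v: "(\<lambda>x\<in>carrier Q. \<Phi> \<delta>' (fst x, \<zero>\<^bsub>F\<^esub>)) \<in> module_Hom R Q C"
    by (rule module_HomI[OF _ _ _ Q])
      (simp_all add: Q_P module_Hom_closed[OF \<Phi>(1)[OF \<delta>(2)]] module_Hom_add[OF \<Phi>(1)[OF \<delta>(2)], symmetric]
        module_Hom_smult[OF \<Phi>(1)[OF \<delta>(2)], symmetric] Q_ops P_ops left_module_smult_zero_right[OF F])
  let ?\<Theta> = "\<lambda>x\<in>carrier Q. (\<lambda>x\<in>carrier Q. \<Phi> \<delta> x) x \<ominus>\<^bsub>C\<^esub> (\<lambda>x\<in>carrier Q. \<Phi> \<delta>' (fst x, \<zero>\<^bsub>F\<^esub>)) x"
  have \<Theta>: "?\<Theta> \<in> module_Hom R Q C" by (rule module_Hom_diff[OF u v Q C])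
  let ?\<pi> = "\<lambda>x\<in>carrier Q. snd x"
  have \<pi>: "?\<pi> \<in> module_Hom R Q F" unfolding Q_def by (rule pullback_snd[OF Lb F N hb e])
  have onto_F: "?\<pi> ` carrier Q = carrier F"
  proof (intro equalityI subsetI)
    fix p assume p: "p \<in> carrier F"
    obtain l where "l \<in> M b" "h {b} l = e p" using onto[OF b module_Hom_closed[OF e p]] by auto
    with p show "p \<in> ?\<pi> ` carrier Q" by (intro image_eqI[of _ _ "(l, p)"]) (auto simp: Q_car)
  qed (auto simp: Q_car)
  have "?\<Theta> x = \<zero>\<^bsub>C\<^esub>" if x: "x \<in> carrier Q" and "?\<pi> x = \<zero>\<^bsub>F\<^esub>" for x
  proof -
    have x_eq: "x = (fst x, \<zero>\<^bsub>F\<^esub>)" using that by (simp add: prod_eq_iff)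
    then have "h {b} (fst x) = \<zero>\<^bsub>N\<^esub>" using x e0 by (metis Q_car snd_conv)
    then have "fst x \<in> D" using x ker[OF b] by (simp add: Q_car)
    then have "\<Phi> \<delta> x = \<Phi> \<delta>' (fst x, \<zero>\<^bsub>F\<^esub>)" using res x_eq by metis
    then show ?thesis
      using x module_Hom_closed[OF \<Phi>(1)[OF \<delta>(2)] Q_P(2)[OF x]] by (simp add: C.r_neg a_minus_def)
  qed
  then obtain \<Psi> where \<Psi>: "\<Psi> \<in> module_Hom R F C" "\<And>x. x \<in> carrier Q \<Longrightarrow> \<Psi> (?\<pi> x) = ?\<Theta> x"
    using factor_through_epimorphism[OF Q F C \<pi> onto_F \<Theta>] by blast
  have "\<Psi> k = \<phi> k" if k: "k \<in> carrier (syzygy R N)" for k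
  proof -
    have z: "\<zero>\<^bsub>F\<^esub> \<in> carrier (syzygy R N)" using e0 by (simp add: syz)
    have "(\<zero>\<^bsub>L\<^esub>, k) \<in> carrier Q"
      using k b module_Hom_zero[OF h L N, of "{b}"] by (simp add: Q_car syz M_zero)
    then have "\<Psi> k = \<phi> k \<ominus>\<^bsub>C\<^esub> \<phi> \<zero>\<^bsub>F\<^esub>"
      using \<Psi>(2)[of "(\<zero>\<^bsub>L\<^esub>, k)"] \<Phi>(2)[OF \<delta>(1) k] \<Phi>(2)[OF \<delta>(2) z] by simp
    then show ?thesis
      using module_Hom_zero[OF \<phi> left_module_syzygy[OF N] C] module_Hom_closed[OF \<phi> k]
      by (simp add: syz_ops C.minus_zero_right)
  qed
  with \<Psi>(1) show "\<exists>h\<in>module_Hom R (free_module R (carrier N)) C. \<forall>p\<in>carrier (syzygy R N). h p = \<phi> p"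
    unfolding F_def by blast
qed

section \<open>Tensor products and local factorization\<close>

text \<open>
  Left modules, right modules and products of right modules share this property, and it guarantees
  that the tensor relators are formal sums of pairs of elements of the two modules.
\<close>

definition operations_closed :: "('r, 'e) ring_scheme \<Rightarrow> ('r, 'a) module \<Rightarrow> bool"
  where "operations_closed R A \<longleftrightarrow>
    (\<forall>x\<in>carrier A. \<forall>y\<in>carrier A. x \<oplus>\<^bsub>A\<^esub> y \<in> carrier A) \<and>
    (\<forall>r\<in>carrier R. \<forall>x\<in>carrier A. r \<odot>\<^bsub>A\<^esub> x \<in> carrier A)"

lemma operations_closed_left_module: "left_module R M \<Longrightarrow> operations_closed R M"
  using left_module_abelian_group[THEN abelian_group.axioms(1), THEN abelian_monoid.a_closed, of R M]
  by (auto simp: operations_closed_def left_module.smult_closed)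

lemma operations_closed_right_module: "right_module R M \<Longrightarrow> operations_closed R M"
  by (auto simp: operations_closed_def right_module.smult_closed right_module_def abelian_group_def
    abelian_monoid.a_closed)

lemma operations_closed_product:
  "(\<And>i. i \<in> I \<Longrightarrow> operations_closed R (Y i)) \<Longrightarrow> operations_closed R (product_module I Y)"
  by (auto simp: operations_closed_def product_module_def PiE_iff)

context
  fixes R :: "('r, 'e) ring_scheme" and Y :: "('r, 'a) module" and M :: "('r, 'b) module"
  assumes Y: "operations_closed R Y" and M: "operations_closed R M"
begin

lemma tensor_relators_in_pairs_group: "tensor_relators R Y M \<subseteq> carrier (pairs_group Y M)"
proof -
  have *: "a - b - c \<in> carrier (free_Abelian_group S)"
    if "a \<in> carrier (free_Abelian_group S)" "b \<in> carrier (free_Abelian_group S)"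
       "c \<in> carrier (free_Abelian_group S)" for a b c :: "('a \<times> 'b) \<Rightarrow>\<^sub>0 int" and S
    using that keys_diff[of "a - b" c] keys_diff[of a b] by auto blast
  have **: "a - b \<in> carrier (free_Abelian_group S)"
    if "a \<in> carrier (free_Abelian_group S)" "b \<in> carrier (free_Abelian_group S)"
     for a b :: "('a \<times> 'b) \<Rightarrow>\<^sub>0 int" and S
    using that keys_diff[of a b] by auto
  show ?thesis
    using Y M unfolding tensor_relators_def pairs_group_def operations_closed_def
    by (auto simp del: carrier_free_Abelian_group_iff intro!: * **)
qed

lemma subgroup_tensor_relations: "subgroup (tensor_relations R Y M) (pairs_group Y M)"
  unfolding tensor_relations_def
  by (rule group.generate_is_subgroup[OF _ tensor_relators_in_pairs_group]) (simp add: pairs_group_def)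

lemma tensor_relations_sub: "c \<in> tensor_relations R Y M \<Longrightarrow> c \<in> carrier (pairs_group Y M)"
  using subgroup.subset[OF subgroup_tensor_relations] by auto

lemma tensor_relations_zero: "0 \<in> tensor_relations R Y M"
  using subgroup.one_closed[OF subgroup_tensor_relations] by (simp add: pairs_group_def)

lemma tensor_relations_add:
  "\<lbrakk>c \<in> tensor_relations R Y M; d \<in> tensor_relations R Y M\<rbrakk> \<Longrightarrow> c + d \<in> tensor_relations R Y M"
  using subgroup.m_closed[OF subgroup_tensor_relations, of c d] by (simp add: pairs_group_def)

lemma tensor_relations_uminus:
  "c \<in> tensor_relations R Y M \<Longrightarrow> - c \<in> tensor_relations R Y M"
  using subgroup.m_inv_closed[OF subgroup_tensor_relations, of c] tensor_relations_sub[of c]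
  by (simp add: pairs_group_def)

lemma tensor_relations_diff:
  "\<lbrakk>c \<in> tensor_relations R Y M; d \<in> tensor_relations R Y M\<rbrakk> \<Longrightarrow> c - d \<in> tensor_relations R Y M"
  using tensor_relations_add[of c "- d"] tensor_relations_uminus[of d] by simp

lemma tensor_relations_coset:
  "tensor_relations R Y M #>\<^bsub>pairs_group Y M\<^esub> c = (\<lambda>r. r + c) ` tensor_relations R Y M"
  by (auto simp: r_coset_def pairs_group_def)

lemma tensor_relations_coset_eq_iff:
  "tensor_relations R Y M #>\<^bsub>pairs_group Y M\<^esub> c = tensor_relations R Y M #>\<^bsub>pairs_group Y M\<^esub> d
    \<longleftrightarrow> c - d \<in> tensor_relations R Y M" (is "?L = ?L' \<longleftrightarrow> _")
proof
  assume "?L = ?L'"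
  then have "c \<in> (\<lambda>r. r + d) ` tensor_relations R Y M"
    using tensor_relations_zero unfolding tensor_relations_coset by force
  then show "c - d \<in> tensor_relations R Y M" by auto
next
  assume *: "c - d \<in> tensor_relations R Y M"
  have "r + c \<in> ?L'" if "r \<in> tensor_relations R Y M" for r
    unfolding tensor_relations_coset
    by (rule image_eqI[of _ _ "r + (c - d)"]) (use * that in \<open>auto intro: tensor_relations_add\<close>)
  moreover have "r + d \<in> ?L" if "r \<in> tensor_relations R Y M" for r
    unfolding tensor_relations_coset
    by (rule image_eqI[of _ _ "r - (c - d)"]) (use * that in \<open>auto intro: tensor_relations_diff\<close>)
  ultimately show "?L = ?L'" by (auto simp: tensor_relations_coset)
qed

lemma tensor_relations_induct:
  assumes c: "c \<in> tensor_relations R Y M"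
    and zero: "P 0" and rel: "\<And>h. h \<in> tensor_relators R Y M \<Longrightarrow> P h"
    and uminus: "\<And>h. P h \<Longrightarrow> P (- h)" and add: "\<And>h k. P h \<Longrightarrow> P k \<Longrightarrow> P (h + k)"
  shows "P c"
  using c unfolding tensor_relations_def
proof (induct rule: generate.induct)
  case (inv h)
  then have "inv\<^bsub>pairs_group Y M\<^esub> h = - h"
    using tensor_relators_in_pairs_group by (auto simp: pairs_group_def)
  then show ?case using inv rel uminus by simp
qed (use zero rel add in \<open>auto simp: pairs_group_def\<close>)

lemma tensor_relators_in_relations: "h \<in> tensor_relators R Y M \<Longrightarrow> h \<in> tensor_relations R Y M"
  unfolding tensor_relations_def by (rule generate.incl)

lemma frag_extend_in_tensor_relations:
  assumes "\<And>x. x \<in> Poly_Mapping.keys c \<Longrightarrow> h x \<in> tensor_relations R Y M"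
  shows "frag_extend h c \<in> tensor_relations R Y M"
proof -
  have "Poly_Mapping.keys c \<subseteq> {x. h x \<in> tensor_relations R Y M}" using assms by auto
  then show ?thesis
    by (induct rule: frag_induction)
      (auto simp: frag_extend_diff intro: tensor_relations_zero tensor_relations_diff)
qed

lemma carrier_tensor:
  "carrier (tensor R Y M) =
    (\<lambda>c. tensor_relations R Y M #>\<^bsub>pairs_group Y M\<^esub> c) ` carrier (pairs_group Y M)"
  by (auto simp: tensor_def FactGroup_def RCOSETS_def)

end

lemma frag_extend_of_compose:
  "frag_extend f (frag_extend (\<lambda>x. frag_of (g x)) c) = frag_extend (\<lambda>x. f (g x)) c"
  using frag_extend_compose[of f g c] by (simp add: comp_def)

lemma frag_extend_fun_diff:
  "frag_extend (\<lambda>x. g x - h x) c = frag_extend g c - frag_extend h c"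
  using subset_UNIV by (induct c rule: frag_induction) (auto simp: frag_extend_diff)

lemma frag_extend_of_in_pairs_group:
  assumes "c \<in> carrier (pairs_group Y M)"
    and "\<And>y m. \<lbrakk>y \<in> carrier Y; m \<in> carrier M\<rbrakk> \<Longrightarrow> g (y, m) \<in> carrier Y' \<times> carrier M'"
  shows "frag_extend (\<lambda>x. frag_of (g x)) c \<in> carrier (pairs_group Y' M')"
  using assms keys_frag_extend[of "\<lambda>x. frag_of (g x)" c] by (fastforce simp: pairs_group_def)

lemma tensor_relatorsE [consumes 1, case_names left right balance]:
  assumes "h \<in> tensor_relators R Y M"
  obtains y y' m where "h = frag_of (y \<oplus>\<^bsub>Y\<^esub> y', m) - frag_of (y, m) - frag_of (y', m)"
      "y \<in> carrier Y" "y' \<in> carrier Y" "m \<in> carrier M"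
    | y m m' where "h = frag_of (y, m \<oplus>\<^bsub>M\<^esub> m') - frag_of (y, m) - frag_of (y, m')"
      "y \<in> carrier Y" "m \<in> carrier M" "m' \<in> carrier M"
    | r y m where "h = frag_of (r \<odot>\<^bsub>Y\<^esub> y, m) - frag_of (y, r \<odot>\<^bsub>M\<^esub> m)"
      "r \<in> carrier R" "y \<in> carrier Y" "m \<in> carrier M"
  using assms unfolding tensor_relators_def by blast

lemma tensor_relatorsI:
  "\<lbrakk>y \<in> carrier Y; y' \<in> carrier Y; m \<in> carrier M\<rbrakk>
    \<Longrightarrow> frag_of (y \<oplus>\<^bsub>Y\<^esub> y', m) - frag_of (y, m) - frag_of (y', m) \<in> tensor_relators R Y M"
  "\<lbrakk>y \<in> carrier Y; m \<in> carrier M; m' \<in> carrier M\<rbrakk>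
    \<Longrightarrow> frag_of (y, m \<oplus>\<^bsub>M\<^esub> m') - frag_of (y, m) - frag_of (y, m') \<in> tensor_relators R Y M"
  "\<lbrakk>r \<in> carrier R; y \<in> carrier Y; m \<in> carrier M\<rbrakk>
    \<Longrightarrow> frag_of (r \<odot>\<^bsub>Y\<^esub> y, m) - frag_of (y, r \<odot>\<^bsub>M\<^esub> m) \<in> tensor_relators R Y M"
  unfolding tensor_relators_def by blast+

text \<open>
  The property of a map under which the induced map on formal sums preserves the tensor relations.
  Besides homomorphisms it covers the projections of a product module, which are not extensional.
\<close>

definition operations_preserving ::
    "('r, 'e) ring_scheme \<Rightarrow> ('r, 'a) module \<Rightarrow> ('r, 'b) module \<Rightarrow> ('a \<Rightarrow> 'b) \<Rightarrow> bool"
  where "operations_preserving R A B f \<longleftrightarrow> f \<in> carrier A \<rightarrow> carrier B \<and>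
     (\<forall>x\<in>carrier A. \<forall>y\<in>carrier A. f (x \<oplus>\<^bsub>A\<^esub> y) = f x \<oplus>\<^bsub>B\<^esub> f y) \<and>
     (\<forall>r\<in>carrier R. \<forall>x\<in>carrier A. f (r \<odot>\<^bsub>A\<^esub> x) = r \<odot>\<^bsub>B\<^esub> f x)"

lemma operations_preserving_Hom: "f \<in> module_Hom R A B \<Longrightarrow> operations_preserving R A B f"
  by (auto simp: module_Hom_def operations_preserving_def)

lemma operations_preserving_proj:
  "i \<in> I \<Longrightarrow> operations_preserving R (product_module I Y) (Y i) (\<lambda>y. y i)"
  by (auto simp: operations_preserving_def product_module_def)

abbreviation (input) map_left :: "('a \<Rightarrow> 'b) \<Rightarrow> ('a \<times> 'c \<Rightarrow>\<^sub>0 int) \<Rightarrow> ('b \<times> 'c \<Rightarrow>\<^sub>0 int)"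
  where "map_left f c \<equiv> frag_extend (\<lambda>(y, m). frag_of (f y, m)) c"

abbreviation (input) map_right :: "('b \<Rightarrow> 'c) \<Rightarrow> ('a \<times> 'b \<Rightarrow>\<^sub>0 int) \<Rightarrow> ('a \<times> 'c \<Rightarrow>\<^sub>0 int)"
  where "map_right u c \<equiv> frag_extend (\<lambda>(y, m). frag_of (y, u m)) c"

lemma map_left_tensor_relations:
  assumes Y: "operations_closed R Y" and Y': "operations_closed R Y'" and M: "operations_closed R M"
    and f: "operations_preserving R Y Y' f" and c: "c \<in> tensor_relations R Y M"
  shows "map_left f c \<in> tensor_relations R Y' M"
  using c
proof (induct rule: tensor_relations_induct[OF Y M, consumes 1, case_names zero rel uminus add])
  case (rel h)
  have "map_left f h \<in> tensor_relators R Y' M"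
    using rel by (cases rule: tensor_relatorsE)
      (use f in \<open>simp_all add: frag_extend_diff operations_preserving_def Pi_iff tensor_relatorsI\<close>)
  then show ?case by (rule tensor_relators_in_relations[OF Y' M])
qed (auto simp: frag_extend_add frag_extend_minus tensor_relations_zero[OF Y' M]
    tensor_relations_add[OF Y' M] tensor_relations_uminus[OF Y' M])

lemma map_right_tensor_relations:
  assumes Y: "operations_closed R Y" and M: "operations_closed R M" and M': "operations_closed R M'"
    and f: "operations_preserving R M M' f" and c: "c \<in> tensor_relations R Y M"
  shows "map_right f c \<in> tensor_relations R Y M'"
  using c
proof (induct rule: tensor_relations_induct[OF Y M, consumes 1, case_names zero rel uminus add])
  case (rel h)
  have "map_right f h \<in> tensor_relators R Y M'"
    using rel by (cases rule: tensor_relatorsE)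
      (use f in \<open>simp_all add: frag_extend_diff operations_preserving_def Pi_iff tensor_relatorsI\<close>)
  then show ?case by (rule tensor_relators_in_relations[OF Y M'])
qed (auto simp: frag_extend_add frag_extend_minus tensor_relations_zero[OF Y M']
    tensor_relations_add[OF Y M'] tensor_relations_uminus[OF Y M'])

text \<open>
  Flatness and the Mittag-Leffler property both say that a family of homomorphisms \<open>f j\<close> from \<open>A\<close> to
  \<open>B j\<close> remains jointly injective after tensoring with \<open>M\<close>.  Here this is expressed on formal sums.
\<close>

definition jointly_injective_tensor ::
    "('r, 'e) ring_scheme \<Rightarrow> ('r, 'a) module \<Rightarrow> 'j set \<Rightarrow> ('j \<Rightarrow> ('r, 'b) module) \<Rightarrow> ('j \<Rightarrow> 'a \<Rightarrow> 'b) \<Rightarrow>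
     ('r, 'm) module \<Rightarrow> bool"
  where "jointly_injective_tensor R A J B f M \<longleftrightarrow>
    (\<forall>c\<in>carrier (pairs_group A M).
       (\<forall>j\<in>J. map_left (f j) c \<in> tensor_relations R (B j) M) \<longrightarrow> c \<in> tensor_relations R A M)"

lemma tensor_map_coset:
  assumes A: "operations_closed R A" and B: "operations_closed R B" and M: "operations_closed R M"
    and f: "operations_preserving R A B f"
  shows "tensor_map R A B M f (tensor_relations R A M #>\<^bsub>pairs_group A M\<^esub> c) =
    tensor_relations R B M #>\<^bsub>pairs_group B M\<^esub> map_left f c"
proof -
  have "tensor_relations R B M #>\<^bsub>pairs_group B M\<^esub> map_left f (r + c) =
      tensor_relations R B M #>\<^bsub>pairs_group B M\<^esub> map_left f c"
    if "r \<in> tensor_relations R A M" for r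
    unfolding tensor_relations_coset_eq_iff[OF B M]
    using map_left_tensor_relations[OF A B M f that] by (simp add: frag_extend_add)
  then have "(\<lambda>c. tensor_relations R B M #>\<^bsub>pairs_group B M\<^esub> map_left f c) `
      (tensor_relations R A M #>\<^bsub>pairs_group A M\<^esub> c) =
    {tensor_relations R B M #>\<^bsub>pairs_group B M\<^esub> map_left f c}"
    unfolding tensor_relations_coset[OF A M] image_image
    using tensor_relations_zero[OF A M]
    by force
  then show ?thesis by (simp add: tensor_map_def)
qed

lemma jointly_injective_tensor_iff:
  assumes A: "operations_closed R A" and B: "\<And>j. j \<in> J \<Longrightarrow> operations_closed R (B j)"
    and M: "operations_closed R M"
    and f: "\<And>j. j \<in> J \<Longrightarrow> operations_preserving R A (B j) (f j)"
  shows "jointly_injective_tensor R A J B f M \<longleftrightarrow>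
    inj_on (\<lambda>t. \<lambda>j\<in>J. tensor_map R A (B j) M (f j) t) (carrier (tensor R A M))"
    (is "_ \<longleftrightarrow> inj_on ?T _")
proof
  assume *: "jointly_injective_tensor R A J B f M"
  show "inj_on ?T (carrier (tensor R A M))"
    unfolding carrier_tensor[OF A M]
  proof (rule inj_onI, elim imageE, simp only:)
    fix c d assume c: "c \<in> carrier (pairs_group A M)" and d: "d \<in> carrier (pairs_group A M)"
      and eq: "?T (tensor_relations R A M #>\<^bsub>pairs_group A M\<^esub> c) =
        ?T (tensor_relations R A M #>\<^bsub>pairs_group A M\<^esub> d)"
    have "c - d \<in> carrier (pairs_group A M)"
      using c d keys_diff[of c d] by (auto simp: pairs_group_def)
    moreover have "map_left (f j) (c - d) \<in> tensor_relations R (B j) M" if j: "j \<in> J" for j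
      using fun_cong[OF eq, of j] j
      by (simp add: tensor_map_coset[OF A B[OF j] M f[OF j]]
          tensor_relations_coset_eq_iff[OF B[OF j] M] frag_extend_diff)
    ultimately show "tensor_relations R A M #>\<^bsub>pairs_group A M\<^esub> c =
        tensor_relations R A M #>\<^bsub>pairs_group A M\<^esub> d"
      using * by (simp add: jointly_injective_tensor_def tensor_relations_coset_eq_iff[OF A M])
  qed
next
  assume inj: "inj_on ?T (carrier (tensor R A M))"
  show "jointly_injective_tensor R A J B f M"
    unfolding jointly_injective_tensor_def
  proof (intro ballI impI)
    fix c assume c: "c \<in> carrier (pairs_group A M)"
      and rel: "\<forall>j\<in>J. map_left (f j) c \<in> tensor_relations R (B j) M"
    have z: "0 \<in> carrier (pairs_group A M)" by (simp add: pairs_group_def)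
    have "?T (tensor_relations R A M #>\<^bsub>pairs_group A M\<^esub> c) =
        ?T (tensor_relations R A M #>\<^bsub>pairs_group A M\<^esub> 0)"
      by (rule restrict_ext)
        (use rel in \<open>simp add: tensor_map_coset[OF A B M f] tensor_relations_coset_eq_iff[OF B M]\<close>)
    then have "tensor_relations R A M #>\<^bsub>pairs_group A M\<^esub> c = tensor_relations R A M #>\<^bsub>pairs_group A M\<^esub> 0"
      by (rule inj_onD[OF inj]) (use c z in \<open>auto simp: carrier_tensor[OF A M]\<close>)
    then show "c \<in> tensor_relations R A M"
      by (simp add: tensor_relations_coset_eq_iff[OF A M])
  qed
qed

text \<open>The endomorphisms of \<open>M\<close> that are finite sums of maps which factor through members of \<open>\<X>\<close>.\<close>

inductive_set factoring ::
    "('r, 'e) ring_scheme \<Rightarrow> ('r, 'x) module set \<Rightarrow> ('r, 'm) module \<Rightarrow> ('m \<Rightarrow> 'm) set"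
  for R :: "('r, 'e) ring_scheme" and \<X> :: "('r, 'x) module set" and M :: "('r, 'm) module"
  where
    zero: "(\<lambda>z\<in>carrier M. \<zero>\<^bsub>M\<^esub>) \<in> factoring R \<X> M"
  | add: "\<lbrakk>e \<in> factoring R \<X> M; X \<in> \<X>; u \<in> module_Hom R M X; v \<in> module_Hom R X M\<rbrakk>
      \<Longrightarrow> (\<lambda>z\<in>carrier M. v (u z) \<oplus>\<^bsub>M\<^esub> e z) \<in> factoring R \<X> M"

definition locally_factors ::
    "('r, 'e) ring_scheme \<Rightarrow> ('r, 'x) module set \<Rightarrow> ('r, 'm) module \<Rightarrow> bool"
  where "locally_factors R \<X> M \<longleftrightarrow>
    (\<forall>Z. finite Z \<longrightarrow> Z \<subseteq> carrier M \<longrightarrow> (\<exists>e\<in>factoring R \<X> M. \<forall>z\<in>Z. e z = z))"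

lemma factoring_closed:
  assumes "e \<in> factoring R \<X> M" "left_module R M" "z \<in> carrier M"
  shows "e z \<in> carrier M"
proof -
  interpret M: abelian_group M using assms(2) by (rule left_module_abelian_group)
  show ?thesis using assms(1,3) by induct (auto simp: module_Hom_closed)
qed

text \<open>
  A formal sum involves only finitely many elements of \<open>M\<close>.  They are fixed by an endomorphism which
  is a sum of maps through members of \<open>\<X>\<close>, and such maps carry the vanishing of tensors over from
  \<open>\<X>\<close> to \<open>M\<close>.
\<close>

lemma jointly_injective_tensor_local:
  assumes A: "operations_closed R A" and B: "\<And>j. j \<in> J \<Longrightarrow> operations_closed R (B j)"
    and M: "left_module R M"
    and f: "\<And>j. j \<in> J \<Longrightarrow> operations_preserving R A (B j) (f j)"
    and \<X>: "\<And>X. X \<in> \<X> \<Longrightarrow> left_module R X"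
    and inj: "\<And>X. X \<in> \<X> \<Longrightarrow> jointly_injective_tensor R A J B f X"
    and local: "locally_factors R \<X> M"
  shows "jointly_injective_tensor R A J B f M"
  unfolding jointly_injective_tensor_def
proof (intro ballI impI)
  fix c assume c: "c \<in> carrier (pairs_group A M)"
    and rel: "\<forall>j\<in>J. map_left (f j) c \<in> tensor_relations R (B j) M"
  interpret M: abelian_group M using M by (rule left_module_abelian_group)
  note Mc = operations_closed_left_module[OF M]
  have keys: "y \<in> carrier A" "m \<in> carrier M" if "(y, m) \<in> Poly_Mapping.keys c" for y m
    using that c by (auto simp: pairs_group_def)
  have "finite (snd ` Poly_Mapping.keys c)" "snd ` Poly_Mapping.keys c \<subseteq> carrier M"
    using keys by auto
  then obtain e where e: "e \<in> factoring R \<X> M" and fix_e: "\<forall>z\<in>snd ` Poly_Mapping.keys c. e z = z"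
    using local unfolding locally_factors_def by meson
  have "map_right e c \<in> tensor_relations R A M"
    using e
  proof induct
    case zero
    have "frag_of (y, \<zero>\<^bsub>M\<^esub>) \<in> tensor_relations R A M" if y: "y \<in> carrier A" for y
    proof -
      have "frag_of (y, \<zero>\<^bsub>M\<^esub> \<oplus>\<^bsub>M\<^esub> \<zero>\<^bsub>M\<^esub>) - frag_of (y, \<zero>\<^bsub>M\<^esub>) - frag_of (y, \<zero>\<^bsub>M\<^esub>) \<in> tensor_relators R A M"
        using y by (intro tensor_relatorsI) auto
      then have "- frag_of (y, \<zero>\<^bsub>M\<^esub>) \<in> tensor_relations R A M"
        using tensor_relators_in_relations[OF A Mc] by fastforce
      then show ?thesis using tensor_relations_uminus[OF A Mc] by fastforce
    qed
    then show ?case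
      by (intro frag_extend_in_tensor_relations[OF A Mc]) (use keys in force)
  next
    case (add e X u v)
    note X = \<X>[OF add(3)] and u = add(4) and v = add(5)
    note Xc = operations_closed_left_module[OF X]
    have "map_right u c \<in> tensor_relations R A X"
    proof -
      have "map_right u c \<in> carrier (pairs_group A X)"
        using frag_extend_of_in_pairs_group[OF c, of "\<lambda>(y, m). (y, u m)" A X] module_Hom_closed[OF u]
        by (simp add: case_prod_unfold)
      moreover have "map_left (f j) (map_right u c) \<in> tensor_relations R (B j) X" if j: "j \<in> J" for j
      proof -
        have "map_left (f j) (map_right u c) = map_right u (map_left (f j) c)"
          using frag_extend_of_compose[of "\<lambda>(y, m). frag_of (f j y, m)" "\<lambda>(y, m). (y, u m)" c]
            frag_extend_of_compose[of "\<lambda>(y, m). frag_of (y, u m)" "\<lambda>(y, m). (f j y, m)" c]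
          by (simp add: case_prod_unfold)
        then show ?thesis
          using map_right_tensor_relations[OF B[OF j] Mc Xc operations_preserving_Hom[OF u]] rel j by simp
      qed
      ultimately show ?thesis
        using inj[OF add(3)] unfolding jointly_injective_tensor_def by blast
    qed
    then have "map_right v (map_right u c) \<in> tensor_relations R A M"
      by (rule map_right_tensor_relations[OF A Xc Mc operations_preserving_Hom[OF v]])
    then have vu: "map_right (\<lambda>z. v (u z)) c \<in> tensor_relations R A M"
      using frag_extend_of_compose[of "\<lambda>(y, m). frag_of (y, v m)" "\<lambda>(y, m). (y, u m)" c]
      by (simp add: case_prod_unfold)
    \<comment> \<open>additivity of the tensor product in the second argument\<close>
    let ?w = "\<lambda>z\<in>carrier M. v (u z) \<oplus>\<^bsub>M\<^esub> e z"
    have "frag_extend (\<lambda>(y, m). frag_of (y, ?w m) - frag_of (y, v (u m)) - frag_of (y, e m)) c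
        \<in> tensor_relations R A M"
      by (rule frag_extend_in_tensor_relations[OF A Mc])
        (use keys factoring_closed[OF add(1) M] module_Hom_closed[OF u] module_Hom_closed[OF v]
          in \<open>force intro!: tensor_relatorsI tensor_relators_in_relations[OF A Mc]\<close>)
    also have "frag_extend (\<lambda>(y, m). frag_of (y, ?w m) - frag_of (y, v (u m)) - frag_of (y, e m)) c =
        map_right ?w c - map_right (\<lambda>z. v (u z)) c - map_right e c"
      by (simp add: frag_extend_fun_diff[symmetric] case_prod_unfold)
    finally have "map_right ?w c - map_right (\<lambda>z. v (u z)) c - map_right e c \<in> tensor_relations R A M" .
    from tensor_relations_add[OF A Mc tensor_relations_add[OF A Mc this add(2)] vu]
    show ?case by simp
  qed
  also have "map_right e c = frag_extend frag_of c"
    by (rule frag_extend_eq) (use fix_e in force)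
  also have "\<dots> = c" by (rule frag_expansion[symmetric])
  finally show "c \<in> tensor_relations R A M" .
qed

lemma mittag_leffler_iff:
  assumes M: "left_module R M" and \<Y>: "\<Y> \<subseteq> right_modules R"
  shows "mittag_leffler R \<Y> M \<longleftrightarrow>
    (\<forall>(I :: 'u set) Y. small I \<and> (\<forall>i\<in>I. Y i \<in> \<Y>) \<longrightarrow>
      jointly_injective_tensor R (product_module I Y) I Y (\<lambda>i y. y i) (M :: ('r, 'u) module))"
proof -
  have "inj_on (product_tensor_map R I Y M) (carrier (tensor R (product_module I Y) M)) \<longleftrightarrow>
      jointly_injective_tensor R (product_module I Y) I Y (\<lambda>i y. y i) M"
    if Y: "\<forall>i\<in>I. Y i \<in> \<Y>" for I :: "'u set" and Y
  proof -
    have Yc: "operations_closed R (Y i)" if "i \<in> I" for i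
      using that Y \<Y> by (auto simp: right_modules_def intro!: operations_closed_right_module)
    have "jointly_injective_tensor R (product_module I Y) I Y (\<lambda>i y. y i) M \<longleftrightarrow>
        inj_on (\<lambda>t. \<lambda>i\<in>I. tensor_map R (product_module I Y) (Y i) M (\<lambda>y. y i) t)
          (carrier (tensor R (product_module I Y) M))"
      by (rule jointly_injective_tensor_iff)
        (auto intro: operations_closed_product Yc operations_closed_left_module[OF M]
          operations_preserving_proj)
    then show ?thesis
      by (simp add: product_tensor_map_def[abs_def])
  qed
  then show ?thesis unfolding mittag_leffler_def by blast
qed

lemma flat_iff:
  assumes M: "left_module R M"
  shows "flat R M \<longleftrightarrow>
    (\<forall>(A :: ('r, 'u) module) \<in> right_modules R. \<forall>(B :: ('r, 'u) module) \<in> right_modules R.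
      \<forall>f \<in> module_Hom R A B. inj_on f (carrier A) \<longrightarrow>
        jointly_injective_tensor R A {()} (\<lambda>_. B) (\<lambda>_. f) (M :: ('r, 'u) module))"
proof -
  have "inj_on (tensor_map R A B M f) (carrier (tensor R A M)) \<longleftrightarrow>
      jointly_injective_tensor R A {()} (\<lambda>_. B) (\<lambda>_. f) M"
    if "A \<in> right_modules R" "B \<in> right_modules R" "f \<in> module_Hom R A B"
    for A B :: "('r, 'u) module" and f
  proof -
    have "inj_on (\<lambda>t. \<lambda>j\<in>{()}. tensor_map R A B M f t) S \<longleftrightarrow> inj_on (tensor_map R A B M f) S" for S
      by (auto simp: inj_on_def fun_eq_iff)
    then show ?thesis
      using that
      by (subst jointly_injective_tensor_iff)
        (auto simp: right_modules_def operations_closed_right_module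
          operations_closed_left_module[OF M] operations_preserving_Hom)
  qed
  then show ?thesis unfolding flat_def by simp
qed

lemma mittag_leffler_modules_local:
  fixes R :: "('r, 'e) ring_scheme" and M :: "('r, 'u) module"
  assumes \<Y>: "\<Y> \<subseteq> right_modules R" and M: "M \<in> left_modules R"
    and local: "locally_factors R \<X> M" and \<X>: "\<X> \<subseteq> mittag_leffler_modules R \<Y>"
  shows "M \<in> mittag_leffler_modules R \<Y>"
proof -
  have M': "left_module R M" using M by (simp add: left_modules_def)
  have X: "left_module R X" "mittag_leffler R \<Y> X" if "X \<in> \<X>" for X
    using that \<X> by (auto simp: mittag_leffler_modules_def left_modules_def)
  have "mittag_leffler R \<Y> M"
    unfolding mittag_leffler_iff[OF M' \<Y>]
  proof (intro allI impI)
    fix I :: "'u set" and Y assume Y: "small I \<and> (\<forall>i\<in>I. Y i \<in> \<Y>)"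
    have Yc: "operations_closed R (Y i)" if "i \<in> I" for i
      using that Y \<Y> by (auto simp: right_modules_def intro!: operations_closed_right_module)
    have inj: "jointly_injective_tensor R (product_module I Y) I Y (\<lambda>i y. y i) X" if "X \<in> \<X>" for X
      using X[OF that] Y mittag_leffler_iff[OF X(1)[OF that] \<Y>] by blast
    show "jointly_injective_tensor R (product_module I Y) I Y (\<lambda>i y. y i) M"
      by (rule jointly_injective_tensor_local[OF operations_closed_product[OF Yc] Yc M'
            operations_preserving_proj X(1) inj local])
  qed
  with M show ?thesis by (simp add: mittag_leffler_modules_def)
qed

lemma flat_local:
  fixes R :: "('r, 'e) ring_scheme" and M :: "('r, 'u) module" and \<X> :: "('r, 'u) module set"
  assumes M: "left_module R M" and local: "locally_factors R \<X> M"
    and \<X>: "\<And>X. X \<in> \<X> \<Longrightarrow> left_module R X \<and> flat R X"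
  shows "flat R M"
  unfolding flat_iff[OF M]
proof (intro ballI impI)
  fix A B :: "('r, 'u) module" and f
  assume *: "A \<in> right_modules R" "B \<in> right_modules R" "f \<in> module_Hom R A B" "inj_on f (carrier A)"
  have inj: "jointly_injective_tensor R A {()} (\<lambda>_. B) (\<lambda>_. f) X" if "X \<in> \<X>" for X
    using \<X>[OF that] * flat_iff by blast
  show "jointly_injective_tensor R A {()} (\<lambda>_. B) (\<lambda>_. f) M"
    by (rule jointly_injective_tensor_local[OF _ _ M _ _ inj local])
      (use * \<X> in \<open>auto simp: right_modules_def operations_closed_right_module
        operations_preserving_Hom\<close>)
qed

lemma locally_factors_mono:
  assumes "locally_factors R \<X> M" "\<X> \<subseteq> \<X>'"
  shows "locally_factors R \<X>' M"
proof -
  have "e \<in> factoring R \<X>' M" if "e \<in> factoring R \<X> M" for e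
    using that
  proof induct
    case (add e X u v)
    then show ?case using assms(2) by (intro factoring.add) auto
  qed (rule factoring.zero)
  with assms(1) show ?thesis unfolding locally_factors_def by meson
qed

lemma locally_factors_iso:
  assumes X: "\<And>X. X \<in> \<X> \<Longrightarrow> left_module R X"
    and M: "left_module R M" and M': "left_module R M'"
    and enc: "enc \<in> module_Hom R M M'" and dec: "dec \<in> module_Hom R M' M"
    and enc_dec: "\<And>x. x \<in> carrier M' \<Longrightarrow> enc (dec x) = x"
    and local: "locally_factors R \<X> M"
  shows "locally_factors R \<X> M'"
proof -
  interpret M: abelian_group M using M by (rule left_module_abelian_group)
  have conj: "(\<lambda>x\<in>carrier M'. enc (e (dec x))) \<in> factoring R \<X> M'" if "e \<in> factoring R \<X> M" for e
    using that
  proof induct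
    case zero
    have "(\<lambda>x\<in>carrier M'. enc ((\<lambda>z\<in>carrier M. \<zero>\<^bsub>M\<^esub>) (dec x))) = (\<lambda>x\<in>carrier M'. \<zero>\<^bsub>M'\<^esub>)"
      by (rule restrict_ext) (simp add: module_Hom_closed[OF dec] module_Hom_zero[OF enc M M'])
    then show ?case using factoring.zero by metis
  next
    case (add e X u v)
    note u = add(4) and v = add(5)
    have "(\<lambda>x\<in>carrier M'. compose (carrier X) enc v (compose (carrier M') u dec x) \<oplus>\<^bsub>M'\<^esub>
        (\<lambda>x\<in>carrier M'. enc (e (dec x))) x) \<in> factoring R \<X> M'"
      by (intro factoring.add[OF add(2,3)] module_Hom_compose[OF dec u M'] module_Hom_compose[OF v enc X[OF add(3)]])
    also have "(\<lambda>x\<in>carrier M'. compose (carrier X) enc v (compose (carrier M') u dec x) \<oplus>\<^bsub>M'\<^esub>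
        (\<lambda>x\<in>carrier M'. enc (e (dec x))) x) =
      (\<lambda>x\<in>carrier M'. enc ((\<lambda>z\<in>carrier M. v (u z) \<oplus>\<^bsub>M\<^esub> e z) (dec x)))"
      by (rule restrict_ext)
        (simp add: compose_def module_Hom_add[OF enc] module_Hom_closed[OF u] module_Hom_closed[OF v]
          module_Hom_closed[OF dec] factoring_closed[OF add(1) M])
    finally show ?case .
  qed
  show ?thesis
    unfolding locally_factors_def
  proof (intro allI impI)
    fix Z assume Z: "finite Z" "Z \<subseteq> carrier M'"
    then have "finite (dec ` Z)" "dec ` Z \<subseteq> carrier M" by (auto simp: module_Hom_closed[OF dec] subset_iff)
    then obtain e where e: "e \<in> factoring R \<X> M" "\<forall>z\<in>dec ` Z. e z = z"
      using local unfolding locally_factors_def by meson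
    show "\<exists>e\<in>factoring R \<X> M'. \<forall>z\<in>Z. e z = z"
      by (rule bexI[OF _ conj[OF e(1)]]) (use e(2) Z enc_dec in auto)
  qed
qed

lemma factoring_add:
  assumes "e \<in> factoring R \<X> M" and M: "left_module R M" and \<X>: "\<And>X. X \<in> \<X> \<Longrightarrow> left_module R X"
    and xy: "x \<in> carrier M" "y \<in> carrier M"
  shows "e (x \<oplus>\<^bsub>M\<^esub> y) = e x \<oplus>\<^bsub>M\<^esub> e y"
proof -
  interpret M: abelian_group M using M by (rule left_module_abelian_group)
  show ?thesis using assms(1)
  proof induct
    case zero
    then show ?case using xy by simp
  next
    case (add e X u v)
    then show ?case
      using xy factoring_closed[OF add(1) M]
      by (simp add: module_Hom_add[OF add(4)] module_Hom_add[OF add(5)] module_Hom_closed[OF add(4)]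
        module_Hom_closed[OF add(5)] M.a_ac)
  qed
qed

lemma factoring_finsum:
  assumes M: "left_module R M" and "finite K"
    and X: "\<And>k. k \<in> K \<Longrightarrow> X k \<in> \<X>"
    and u: "\<And>k. k \<in> K \<Longrightarrow> u k \<in> module_Hom R M (X k)"
    and v: "\<And>k. k \<in> K \<Longrightarrow> v k \<in> module_Hom R (X k) M"
  shows "(\<lambda>z\<in>carrier M. \<Oplus>\<^bsub>M\<^esub>k\<in>K. v k (u k z)) \<in> factoring R \<X> M"
proof -
  interpret M: abelian_group M using M by (rule left_module_abelian_group)
  show ?thesis using assms(2-)
  proof (induct K)
    case empty
    show ?case unfolding M.finsum_empty by (rule factoring.zero)
  next
    case (insert k K)
    have "(\<lambda>z\<in>carrier M. \<Oplus>\<^bsub>M\<^esub>k\<in>K. v k (u k z)) \<in> factoring R \<X> M"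
      by (rule insert(3)) (use insert in auto)
    then have "(\<lambda>z\<in>carrier M. v k (u k z) \<oplus>\<^bsub>M\<^esub> (\<lambda>z\<in>carrier M. \<Oplus>\<^bsub>M\<^esub>k\<in>K. v k (u k z)) z) \<in> factoring R \<X> M"
      by (rule factoring.add) (use insert in auto)
    also have "(\<lambda>z\<in>carrier M. v k (u k z) \<oplus>\<^bsub>M\<^esub> (\<lambda>z\<in>carrier M. \<Oplus>\<^bsub>M\<^esub>k\<in>K. v k (u k z)) z) =
        (\<lambda>z\<in>carrier M. \<Oplus>\<^bsub>M\<^esub>k\<in>insert k K. v k (u k z))"
      by (rule restrict_ext)
        (use insert in \<open>simp add: M.finsum_insert Pi_iff module_Hom_closed[OF insert(5)] module_Hom_closed[OF insert(6)]\<close>)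
    finally show ?case .
  qed
qed


section \<open>Small sets\<close>

lemma card_of_Pow_mono:
  assumes "|A| \<le>o |B|"
  shows "|Pow A| \<le>o |Pow B|"
proof -
  obtain f where f: "inj_on f A" "f ` A \<subseteq> B" using assms unfolding card_of_ordLeq[symmetric] by auto
  have "inj_on ((`) f) (Pow A)" by (rule inj_on_image_Pow[OF f(1)])
  then show ?thesis by (rule card_of_ordLeqI) (use f(2) in auto)
qed

lemma card_of_Times_ordLeq:
  "\<lbrakk>infinite C; |A| \<le>o |C|; |B| \<le>o |C|\<rbrakk> \<Longrightarrow> |A \<times> B| \<le>o |C|"
  by (rule card_of_Times_ordLeq_infinite_Field) (auto simp: Field_card_of card_of_Card_order)

lemma card_of_PiE_ordLeq: "|\<Pi>\<^sub>E i\<in>I. X i| \<le>o |Pow (I \<times> (\<Union>i\<in>I. X i))|"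
proof (rule card_of_ordLeqI)
  show "inj_on (\<lambda>l. (\<lambda>i. (i, l i)) ` I) (\<Pi>\<^sub>E i\<in>I. X i)"
  proof (rule inj_onI)
    fix l l' assume l: "l \<in> (\<Pi>\<^sub>E i\<in>I. X i)" "l' \<in> (\<Pi>\<^sub>E i\<in>I. X i)"
      and eq: "(\<lambda>i. (i, l i)) ` I = (\<lambda>i. (i, l' i)) ` I"
    have "l i = l' i" if "i \<in> I" for i
    proof -
      have "(i, l i) \<in> (\<lambda>i. (i, l' i)) ` I" using that unfolding eq[symmetric] by blast
      then show ?thesis by auto
    qed
    then show "l = l'" by (rule PiE_ext[OF l])
  qed
qed (auto dest: PiE_mem)

lemma card_less_imp_embedding:
  assumes "|S| <o |UNIV :: 'u set|"
  obtains enc :: "'a \<Rightarrow> 'u" where "inj_on enc S" "small (enc ` S)"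
proof -
  obtain enc :: "'a \<Rightarrow> 'u" where "inj_on enc S"
    using ordLess_imp_ordLeq[OF assms] unfolding card_of_ordLeq[symmetric] by auto
  moreover have "small (enc ` S)"
    unfolding small_def by (rule ordLeq_ordLess_trans[OF card_of_image assms])
  ultimately show ?thesis by (rule that)
qed

context
  assumes universe: "set_universe TYPE('u)"
begin

lemma infinite_universe: "infinite (UNIV :: 'u set)"
proof -
  have "natLeq \<le>o |UNIV :: 'u set|"
    using universe by (simp add: set_universe_def ordLess_imp_ordLeq)
  then show ?thesis using infinite_iff_natLeq_ordLeq[of "UNIV :: 'u set"] by simp
qed

lemma small_Un: "\<lbrakk>small (A :: 'u set); small B\<rbrakk> \<Longrightarrow> small (A \<union> B)"
  unfolding small_def by (rule card_of_Un_ordLess_infinite[OF infinite_universe])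

lemma small_UN: "\<lbrakk>small (I :: 'u set); \<And>i. i \<in> I \<Longrightarrow> small (A i)\<rbrakk> \<Longrightarrow> small (\<Union>i\<in>I. A i :: 'u set)"
  using universe unfolding set_universe_def by blast

lemma small_subset: "\<lbrakk>small (B :: 'u set); A \<subseteq> B\<rbrakk> \<Longrightarrow> small A"
  unfolding small_def using card_of_mono1 ordLeq_ordLess_trans by blast

lemma universe_Pow:
  assumes "|S| <o |UNIV :: 'u set|"
  shows "|Pow S| <o |UNIV :: 'u set|"
proof -
  obtain enc :: "'a \<Rightarrow> 'u" where enc: "inj_on enc S" "small (enc ` S)"
    by (rule card_less_imp_embedding[OF assms])
  have "|S| \<le>o |enc ` S|" by (rule card_of_ordLeqI[OF enc(1)]) auto
  then have "|Pow S| \<le>o |Pow (enc ` S)|" by (rule card_of_Pow_mono)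
  moreover have "|Pow (enc ` S)| <o |UNIV :: 'u set|"
    using universe enc(2) unfolding set_universe_def by blast
  ultimately show ?thesis by (rule ordLeq_ordLess_trans)
qed

lemma small_infinite_exists: "\<exists>E :: 'u set. small E \<and> infinite E"
proof -
  have "|UNIV :: nat set| <o |UNIV :: 'u set|"
    using universe card_of_nat ordIso_ordLess_trans unfolding set_universe_def by blast
  then obtain enc :: "nat \<Rightarrow> 'u" where "inj enc" "small (range enc)"
    by (rule card_less_imp_embedding)
  then show ?thesis using range_inj_infinite by blast
qed

text \<open>
  If \<open>r\<close> well-orders \<open>W\<close> without a last element, the union of the levels has the size of a strong limit
  cardinal of cofinality at most that of \<open>W\<close>, like the limit of an increasing family of beth numbers.
\<close>

lemma level_sets_exist:
  fixes W Base :: "'u set"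
  assumes wf: "wf r" and W: "small W" and r: "r \<subseteq> W \<times> W" and Base: "small Base"
  shows "\<exists>A :: 'u \<Rightarrow> 'u set. \<forall>i. small (A i) \<and> Base \<subseteq> A i \<and>
    (\<forall>j. (j, i) \<in> r \<longrightarrow> A j \<subseteq> A i \<and> |Pow (A j)| \<le>o |A i| )"
proof -
  define P where "P = (\<lambda>(A :: 'u \<Rightarrow> 'u set) i S. small S \<and> Base \<subseteq> S \<and>
    (\<forall>j. (j, i) \<in> r \<longrightarrow> A j \<subseteq> S \<and> |Pow (A j)| \<le>o |S| ))"
  have "\<exists>A. \<forall>i. P A i (A i)"
  proof (rule dependent_wf_choice[OF wf])
    fix A B :: "'u \<Rightarrow> 'u set" and i S assume "\<And>j. (j, i) \<in> r \<Longrightarrow> A j = B j"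
    then show "P A i S = P B i S" unfolding P_def by auto
  next
    fix i and A :: "'u \<Rightarrow> 'u set" assume IH: "\<And>j. (j, i) \<in> r \<Longrightarrow> P A j (A j)"
    \<comment> \<open>adding an encoding of its power set to \<open>V\<close> makes it large enough\<close>
    define V where "V = Base \<union> (\<Union>j\<in>{j. (j, i) \<in> r}. A j)"
    have "small {j. (j, i) \<in> r}" by (rule small_subset[OF W]) (use r in auto)
    then have V: "small V"
      unfolding V_def using IH by (intro small_Un Base small_UN) (auto simp: P_def)
    have "|Pow V| <o |UNIV :: 'u set|"
      using V by (intro universe_Pow) (simp add: small_def)
    then obtain enc :: "'u set \<Rightarrow> 'u" where enc: "inj_on enc (Pow V)" "small (enc ` Pow V)"
      by (rule card_less_imp_embedding)
    have "|Pow (A j)| \<le>o |V \<union> enc ` Pow V|" if "(j, i) \<in> r" for j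
    proof (rule card_of_ordLeqI)
      show "inj_on enc (Pow (A j))"
        by (rule inj_on_subset[OF enc(1)]) (use that in \<open>auto simp: V_def\<close>)
      have "A j \<subseteq> V" using that by (auto simp: V_def)
      then show "enc a \<in> V \<union> enc ` Pow V" if "a \<in> Pow (A j)" for a using that by blast
    qed
    moreover have "A j \<subseteq> V" if "(j, i) \<in> r" for j using that by (auto simp: V_def)
    moreover have "Base \<subseteq> V" by (simp add: V_def)
    ultimately have "P A i (V \<union> enc ` Pow V)"
      unfolding P_def using small_Un[OF V enc(2)] by blast
    then show "\<exists>S. P A i S" by blast
  qed
  then show ?thesis unfolding P_def .
qed

end

lemma linear_order_onD:
  assumes "linear_order_on I leq"
  shows "i \<in> I \<Longrightarrow> (i, i) \<in> leq" "\<lbrakk>(i, j) \<in> leq; (j, k) \<in> leq\<rbrakk> \<Longrightarrow> (i, k) \<in> leq"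
    "\<lbrakk>(i, j) \<in> leq; (j, i) \<in> leq\<rbrakk> \<Longrightarrow> i = j"
    "\<lbrakk>i \<in> I; j \<in> I\<rbrakk> \<Longrightarrow> (i, j) \<in> leq \<or> (j, i) \<in> leq"
proof -
  show refl: "(i, i) \<in> leq" if "i \<in> I" for i
    using assms that by (auto simp: order_on_defs refl_on_def)
  show "(i, k) \<in> leq" if "(i, j) \<in> leq" "(j, k) \<in> leq"
    using assms that by (auto simp: order_on_defs elim: transE)
  show "i = j" if "(i, j) \<in> leq" "(j, i) \<in> leq"
    using assms that by (auto simp: order_on_defs dest: antisymD)
  show "(i, j) \<in> leq \<or> (j, i) \<in> leq" if "i \<in> I" "j \<in> I"
    using assms that refl by (cases "i = j") (auto simp: order_on_defs total_on_def)
qed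

lemma linear_order_on_upper:
  assumes "linear_order_on I leq" "i \<in> I" "j \<in> I"
  shows "\<exists>k\<in>I. (i, k) \<in> leq \<and> (j, k) \<in> leq"
  using linear_order_onD[OF assms(1)] assms(2,3) by metis

text \<open>
  The witness consists of the elements that exceed, in the given order, all their predecessors in
  some well-order of \<open>I\<close>.  On this set the two orders agree.  It is cofinal because it
  contains, for each \<open>i\<close>, the element that comes first in the well-order among those above \<open>i\<close>.
\<close>

lemma cofinal_well_ordered_subset:
  assumes "linear_order_on I leq"
  shows "\<exists>W\<subseteq>I. (\<forall>i\<in>I. \<exists>j\<in>W. (i, j) \<in> leq) \<and>
    (\<forall>S. S \<subseteq> W \<longrightarrow> S \<noteq> {} \<longrightarrow> (\<exists>m\<in>S. \<forall>s\<in>S. (m, s) \<in> leq))"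
proof -
  note refl = linear_order_onD(1)[OF assms] and trans = linear_order_onD(2)[OF assms]
    and total = linear_order_onD(4)[OF assms]
  obtain r where r: "well_order_on I r" using well_order_on by blast
  have r_lin: "linear_order_on I r" using r by (simp add: well_order_on_def)
  note r_antisym = linear_order_onD(3)[OF r_lin] and r_total = linear_order_onD(4)[OF r_lin]
  have r_least: "\<exists>m\<in>S. \<forall>s\<in>S. (m, s) \<in> r" if S: "S \<subseteq> I" "S \<noteq> {}" for S
  proof -
    have "wf (r - Id)" using r by (simp add: well_order_on_def)
    then obtain m where m: "m \<in> S" "\<And>s. (s, m) \<in> r - Id \<Longrightarrow> s \<notin> S"
      using S(2) wfE_min'[of "r - Id" S] by blast
    have "(m, s) \<in> r" if "s \<in> S" for s
      using m(2)[of s] r_total[of m s] that m(1) S(1) by auto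
    then show ?thesis using m(1) by blast
  qed
  define W where "W = {i \<in> I. \<forall>j\<in>I. (j, i) \<in> r \<longrightarrow> (j, i) \<in> leq}"
  show ?thesis
  proof (intro exI[of _ W] conjI ballI allI impI)
    show "W \<subseteq> I" by (auto simp: W_def)
  next
    fix i assume i: "i \<in> I"
    obtain m where m: "m \<in> {j \<in> I. (i, j) \<in> leq}" "\<forall>s\<in>{j \<in> I. (i, j) \<in> leq}. (m, s) \<in> r"
      using r_least[of "{j \<in> I. (i, j) \<in> leq}"] i refl by blast
    have "(k, m) \<in> leq" if k: "k \<in> I" "(k, m) \<in> r" for k
    proof (cases "(i, k) \<in> leq")
      case True
      then have "k = m" using m k r_antisym by blast
      then show ?thesis using refl k by simp
    next
      case False
      then show ?thesis using total[OF i k(1)] m trans by blast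
    qed
    then have "m \<in> W" using m by (simp add: W_def)
    then show "\<exists>j\<in>W. (i, j) \<in> leq" using m by auto
  next
    fix S assume S: "S \<subseteq> W" "S \<noteq> {}"
    then obtain m where m: "m \<in> S" "\<forall>s\<in>S. (m, s) \<in> r" using r_least[of S] by (auto simp: W_def)
    moreover have "m \<in> I" using m S by (auto simp: W_def)
    ultimately have "\<forall>s\<in>S. (m, s) \<in> leq" using S unfolding W_def by blast
    then show "\<exists>m\<in>S. \<forall>s\<in>S. (m, s) \<in> leq" using m by blast
  qed
qed


section \<open>The tree module of a direct system\<close>

text \<open>
  A direct system over a well-ordered index set, its limit \<open>N\<close>, and the level sets of the tree.  The
  limit is described by its two elementary properties \<open>g_onto\<close> and \<open>g_ker\<close>.  The system may be
  discontinuous: at a limit index \<open>j\<close>, the module \<open>X j\<close> can differ from the limit of the earlier terms.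
\<close>

locale tree_system =
  fixes R :: "('r, 'e) ring_scheme"
    and W :: "'i set" and le :: "'i \<Rightarrow> 'i \<Rightarrow> bool" (infix "\<sqsubseteq>" 50)
    and X :: "'i \<Rightarrow> ('r, 'x) module" and f :: "'i \<Rightarrow> 'i \<Rightarrow> 'x \<Rightarrow> 'x"
    and N :: "('r, 'n) module" and g :: "'i \<Rightarrow> 'x \<Rightarrow> 'n"
    and A :: "'i \<Rightarrow> 'k set"
  assumes refl: "i \<in> W \<Longrightarrow> i \<sqsubseteq> i"
    and trans: "\<lbrakk>i \<in> W; j \<in> W; k \<in> W; i \<sqsubseteq> j; j \<sqsubseteq> k\<rbrakk> \<Longrightarrow> i \<sqsubseteq> k"
    and antisym: "\<lbrakk>i \<in> W; j \<in> W; i \<sqsubseteq> j; j \<sqsubseteq> i\<rbrakk> \<Longrightarrow> i = j"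
    and least: "\<lbrakk>S \<subseteq> W; S \<noteq> {}\<rbrakk> \<Longrightarrow> \<exists>m\<in>S. \<forall>s\<in>S. m \<sqsubseteq> s"
    and nonempty: "W \<noteq> {}"
    and X: "i \<in> W \<Longrightarrow> left_module R (X i)"
    and f: "\<lbrakk>i \<in> W; j \<in> W; i \<sqsubseteq> j\<rbrakk> \<Longrightarrow> f i j \<in> module_Hom R (X i) (X j)"
    and f_id: "\<lbrakk>i \<in> W; x \<in> carrier (X i)\<rbrakk> \<Longrightarrow> f i i x = x"
    and f_comp: "\<lbrakk>i \<in> W; j \<in> W; k \<in> W; i \<sqsubseteq> j; j \<sqsubseteq> k; x \<in> carrier (X i)\<rbrakk>
        \<Longrightarrow> f j k (f i j x) = f i k x"
    and N: "left_module R N"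
    and g: "i \<in> W \<Longrightarrow> g i \<in> module_Hom R (X i) N"
    and g_comp: "\<lbrakk>i \<in> W; j \<in> W; i \<sqsubseteq> j; x \<in> carrier (X i)\<rbrakk> \<Longrightarrow> g j (f i j x) = g i x"
    and g_onto: "n \<in> carrier N \<Longrightarrow> \<exists>i\<in>W. \<exists>x\<in>carrier (X i). g i x = n"
    and g_ker: "\<lbrakk>i \<in> W; x \<in> carrier (X i); g i x = \<zero>\<^bsub>N\<^esub>\<rbrakk> \<Longrightarrow> \<exists>j\<in>W. i \<sqsubseteq> j \<and> f i j x = \<zero>\<^bsub>X j\<^esub>"
    and A_mono: "\<lbrakk>i \<in> W; j \<in> W; i \<sqsubseteq> j\<rbrakk> \<Longrightarrow> A i \<subseteq> A j"
begin

lemma total: "\<lbrakk>i \<in> W; j \<in> W\<rbrakk> \<Longrightarrow> i \<sqsubseteq> j \<or> j \<sqsubseteq> i"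
  using least[of "{i, j}"] by auto

lemma upper_bound:
  assumes "i \<in> W" "j \<in> W"
  obtains k where "k \<in> W" "i \<sqsubseteq> k" "j \<sqsubseteq> k"
  using total[OF assms] refl assms by blast

lemma X_group: "i \<in> W \<Longrightarrow> abelian_group (X i)"
  by (rule left_module_abelian_group[OF X])

lemma X_monoid: "i \<in> W \<Longrightarrow> abelian_monoid (X i)"
  by (rule abelian_group.axioms(1)[OF X_group])

lemma X_smult: "\<lbrakk>i \<in> W; r \<in> carrier R; x \<in> carrier (X i)\<rbrakk> \<Longrightarrow> r \<odot>\<^bsub>X i\<^esub> x \<in> carrier (X i)"
  by (rule left_module.smult_closed[OF X])

lemmas X_facts = abelian_monoid.zero_closed[OF X_monoid] abelian_monoid.a_closed[OF X_monoid]
  abelian_monoid.l_zero[OF X_monoid] abelian_monoid.r_zero[OF X_monoid] X_smult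
  left_module_smult_zero_right[OF X] left_module.smult_add_right[OF X]

lemma f_facts:
  assumes "i \<in> W" "j \<in> W" "i \<sqsubseteq> j"
  shows "x \<in> carrier (X i) \<Longrightarrow> f i j x \<in> carrier (X j)"
    "\<lbrakk>x \<in> carrier (X i); y \<in> carrier (X i)\<rbrakk> \<Longrightarrow> f i j (x \<oplus>\<^bsub>X i\<^esub> y) = f i j x \<oplus>\<^bsub>X j\<^esub> f i j y"
    "\<lbrakk>r \<in> carrier R; x \<in> carrier (X i)\<rbrakk> \<Longrightarrow> f i j (r \<odot>\<^bsub>X i\<^esub> x) = r \<odot>\<^bsub>X j\<^esub> f i j x"
    "f i j \<zero>\<^bsub>X i\<^esub> = \<zero>\<^bsub>X j\<^esub>"
  using f[OF assms] module_Hom_zero[OF f[OF assms] X[OF assms(1)] X[OF assms(2)]]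
  by (auto simp: module_Hom_closed module_Hom_add module_Hom_smult)

lemma g_zero: "i \<in> W \<Longrightarrow> g i \<zero>\<^bsub>X i\<^esub> = \<zero>\<^bsub>N\<^esub>"
  by (rule module_Hom_zero[OF g X N])

lemma ring_R: "ring R"
  by (rule left_module_ring[OF N])

text \<open>
  Branches are the subsets of the union of all levels, and the node of a branch \<open>b\<close> at level \<open>i\<close> is its
  intersection with \<open>A i\<close>.
\<close>

definition branches :: "'k set set" where "branches = Pow (\<Union>i\<in>W. A i)"

definition agree :: "'i \<Rightarrow> 'k set \<Rightarrow> 'k set \<Rightarrow> bool"
  where "agree i b b' \<longleftrightarrow> b \<inter> A i = b' \<inter> A i"

lemma agree_mono: "\<lbrakk>i \<in> W; j \<in> W; i \<sqsubseteq> j; agree j b b'\<rbrakk> \<Longrightarrow> agree i b b'"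
  using A_mono[of i j] unfolding agree_def by blast

lemma agree_refl [simp]: "agree i b b"
  by (simp add: agree_def)

lemma branches_split:
  assumes "b \<in> branches" "b' \<in> branches" "b \<noteq> b'"
  shows "\<exists>d\<in>W. \<forall>j\<in>W. agree j b b' \<longleftrightarrow> \<not> d \<sqsubseteq> j"
proof -
  let ?S = "{i \<in> W. \<not> agree i b b'}"
  have "?S \<noteq> {}"
  proof
    assume "?S = {}"
    then have "b \<inter> A i = b' \<inter> A i" if "i \<in> W" for i using that by (auto simp: agree_def)
    then have "b = b'" using assms(1,2) unfolding branches_def by blast
    with assms(3) show False by simp
  qed
  then obtain d where d: "d \<in> ?S" "\<forall>s\<in>?S. d \<sqsubseteq> s" using least[of ?S] by auto
  have "agree j b b' \<longleftrightarrow> \<not> d \<sqsubseteq> j" if "j \<in> W" for j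
    using that d agree_mono[of d j b b'] by auto
  with d show ?thesis by blast
qed

text \<open>
  A node is represented here by every branch that passes through it.  This spares the tree module a
  quotient; its elements take the same value at all representatives of a node (\<open>threads_agree\<close>).
\<close>

definition nodes :: "('k set \<times> 'i) set" where "nodes = branches \<times> W"

definition ambient :: "('r, 'k set \<times> 'i \<Rightarrow> 'x) module"
  where "ambient = product_module nodes (\<lambda>(b, i). X i)"

text \<open>The element \<open>x\<close> of \<open>X i\<close>, placed at the node of \<open>b\<close> at level \<open>i\<close> and transported up along \<open>b\<close>.\<close>

definition thread :: "'k set \<Rightarrow> 'i \<Rightarrow> 'x \<Rightarrow> 'k set \<times> 'i \<Rightarrow> 'x"
  where "thread b i x = (\<lambda>(b', j)\<in>nodes. if i \<sqsubseteq> j \<and> agree j b b' then f i j x else \<zero>\<^bsub>X j\<^esub>)"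

text \<open>
  The parameters serve to confine an element to the finitely many branches and levels that it
  involves; the tree module itself is the case of all branches and all levels.
\<close>

inductive_set threads :: "'k set set \<Rightarrow> 'i set \<Rightarrow> ('k set \<times> 'i \<Rightarrow> 'x) set"
  for F :: "'k set set" and G :: "'i set"
  where
    zero: "\<zero>\<^bsub>ambient\<^esub> \<in> threads F G"
  | add: "\<lbrakk>l \<in> threads F G; b \<in> F; i \<in> G; x \<in> carrier (X i)\<rbrakk>
      \<Longrightarrow> thread b i x \<oplus>\<^bsub>ambient\<^esub> l \<in> threads F G"

definition tree_module :: "('r, 'k set \<times> 'i \<Rightarrow> 'x) module"
  where "tree_module = ambient\<lparr>carrier := threads branches W\<rparr>"

lemma left_module_ambient: "left_module R ambient"
  unfolding ambient_def by (rule left_module_product[OF ring_R]) (auto simp: nodes_def X)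

sublocale amb: abelian_group ambient
  by (rule left_module_abelian_group[OF left_module_ambient])

lemma ambient_carrier:
  "l \<in> carrier ambient \<longleftrightarrow> l \<in> extensional nodes \<and> (\<forall>b\<in>branches. \<forall>j\<in>W. l (b, j) \<in> carrier (X j))"
  by (auto simp: ambient_def product_module_def nodes_def PiE_iff)

lemma ambient_ops:
  assumes "b \<in> branches" "j \<in> W"
  shows "(l \<oplus>\<^bsub>ambient\<^esub> l') (b, j) = l (b, j) \<oplus>\<^bsub>X j\<^esub> l' (b, j)"
    "(r \<odot>\<^bsub>ambient\<^esub> l) (b, j) = r \<odot>\<^bsub>X j\<^esub> l (b, j)"
    "\<zero>\<^bsub>ambient\<^esub> (b, j) = \<zero>\<^bsub>X j\<^esub>"
  using assms by (auto simp: ambient_def product_module_def nodes_def)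

lemma ambient_eqI:
  assumes "l \<in> carrier ambient" "l' \<in> carrier ambient"
    and "\<And>b j. \<lbrakk>b \<in> branches; j \<in> W\<rbrakk> \<Longrightarrow> l (b, j) = l' (b, j)"
  shows "l = l'"
  by (rule extensionalityI[of _ nodes]) (use assms in \<open>auto simp: ambient_carrier nodes_def\<close>)

lemma thread_apply:
  "\<lbrakk>b' \<in> branches; j \<in> W\<rbrakk> \<Longrightarrow> thread b i x (b', j) = (if i \<sqsubseteq> j \<and> agree j b b' then f i j x else \<zero>\<^bsub>X j\<^esub>)"
  by (simp add: thread_def nodes_def)

lemma thread_closed: "\<lbrakk>i \<in> W; x \<in> carrier (X i)\<rbrakk> \<Longrightarrow> thread b i x \<in> carrier ambient"
  unfolding ambient_carrier
  by (auto simp: thread_apply f_facts X_facts) (simp add: thread_def)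

lemma thread_smult:
  "\<lbrakk>i \<in> W; x \<in> carrier (X i); r \<in> carrier R\<rbrakk>
    \<Longrightarrow> thread b i (r \<odot>\<^bsub>X i\<^esub> x) = r \<odot>\<^bsub>ambient\<^esub> thread b i x"
  by (rule ambient_eqI)
    (auto simp: thread_closed left_module.smult_closed[OF left_module_ambient] thread_apply ambient_ops
      f_facts X_facts)

lemma threads_mono: "\<lbrakk>l \<in> threads F G; F \<subseteq> F'; G \<subseteq> G'\<rbrakk> \<Longrightarrow> l \<in> threads F' G'"
  by (induct rule: threads.induct) (auto intro: threads.intros)

lemma threads_closed: "\<lbrakk>l \<in> threads F G; G \<subseteq> W\<rbrakk> \<Longrightarrow> l \<in> carrier ambient"
  by (induct rule: threads.induct) (auto intro: thread_closed)

lemma threads_add: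
  assumes "l \<in> threads F G" "l' \<in> threads F G" "G \<subseteq> W"
  shows "l \<oplus>\<^bsub>ambient\<^esub> l' \<in> threads F G"
  using assms
proof induct
  case zero
  then show ?case by (simp add: threads_closed)
next
  case (add l b i x)
  have "(thread b i x \<oplus>\<^bsub>ambient\<^esub> l) \<oplus>\<^bsub>ambient\<^esub> l' = thread b i x \<oplus>\<^bsub>ambient\<^esub> (l \<oplus>\<^bsub>ambient\<^esub> l')"
    by (rule amb.a_assoc) (use add in \<open>auto intro: thread_closed threads_closed\<close>)
  then show ?case using add by (simp add: threads.add)
qed

lemma threads_smult:
  assumes "l \<in> threads F G" "r \<in> carrier R" "G \<subseteq> W"
  shows "r \<odot>\<^bsub>ambient\<^esub> l \<in> threads F G"
  using assms
proof induct
  case zero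
  then show ?case
    by (simp add: left_module_smult_zero_right[OF left_module_ambient] threads.zero)
next
  case (add l b i x)
  then have "i \<in> W" by auto
  have "r \<odot>\<^bsub>ambient\<^esub> (thread b i x \<oplus>\<^bsub>ambient\<^esub> l) = thread b i (r \<odot>\<^bsub>X i\<^esub> x) \<oplus>\<^bsub>ambient\<^esub> r \<odot>\<^bsub>ambient\<^esub> l"
    using add \<open>i \<in> W\<close>
    by (simp add: left_module.smult_add_right[OF left_module_ambient] thread_closed threads_closed thread_smult)
  then show ?case using add \<open>i \<in> W\<close> by (simp add: threads.add X_facts)
qed

lemma thread_in_threads:
  assumes "b \<in> F" "i \<in> G" "x \<in> carrier (X i)" "i \<in> W"
  shows "thread b i x \<in> threads F G"
  using threads.add[OF threads.zero[of F G] assms(1-3)] thread_closed[OF assms(4,3)] by simp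

lemma tree_module_simps:
  "carrier tree_module = threads branches W" "l \<oplus>\<^bsub>tree_module\<^esub> l' = l \<oplus>\<^bsub>ambient\<^esub> l'"
  "r \<odot>\<^bsub>tree_module\<^esub> l = r \<odot>\<^bsub>ambient\<^esub> l" "\<zero>\<^bsub>tree_module\<^esub> = \<zero>\<^bsub>ambient\<^esub>"
  by (simp_all add: tree_module_def)

lemma left_module_tree: "left_module R tree_module"
  unfolding tree_module_def
  by (rule left_module_submodule[OF left_module_ambient])
    (auto intro: threads_closed threads.zero threads_add threads_smult)

lemma tree_module_val: "\<lbrakk>l \<in> threads branches W; b \<in> branches; j \<in> W\<rbrakk> \<Longrightarrow> l (b, j) \<in> carrier (X j)"
  using threads_closed[of l branches W] by (auto simp: ambient_carrier)


subsection \<open>Local factorization\<close>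

text \<open>
  A thread that stops below the first level of \<open>G\<close> beyond \<open>i\<close>.  It is the difference of the threads that
  start at these two levels, or a whole thread if \<open>G\<close> has no such level.
\<close>

definition segment :: "'i set \<Rightarrow> 'k set \<Rightarrow> 'i \<Rightarrow> 'x \<Rightarrow> 'k set \<times> 'i \<Rightarrow> 'x"
  where "segment G b i x = (\<lambda>(b', j)\<in>nodes.
    if i \<sqsubseteq> j \<and> (\<forall>k\<in>G. k \<sqsubseteq> j \<longrightarrow> k \<sqsubseteq> i) \<and> agree j b b' then f i j x else \<zero>\<^bsub>X j\<^esub>)"

lemma segment_apply:
  "\<lbrakk>b' \<in> branches; j \<in> W\<rbrakk> \<Longrightarrow> segment G b i x (b', j) =
    (if i \<sqsubseteq> j \<and> (\<forall>k\<in>G. k \<sqsubseteq> j \<longrightarrow> k \<sqsubseteq> i) \<and> agree j b b' then f i j x else \<zero>\<^bsub>X j\<^esub>)"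
  by (simp add: segment_def nodes_def)

lemma segment_closed: "\<lbrakk>i \<in> W; x \<in> carrier (X i)\<rbrakk> \<Longrightarrow> segment G b i x \<in> carrier ambient"
  unfolding ambient_carrier
  by (auto simp: segment_apply f_facts X_facts) (simp add: segment_def)

lemma segment_in_tree:
  assumes "G \<subseteq> W" "i \<in> W" "x \<in> carrier (X i)" "b \<in> branches"
  shows "segment G b i x \<in> threads branches W"
proof (cases "\<forall>k\<in>G. k \<sqsubseteq> i")
  case True
  then have "segment G b i x = thread b i x"
    using assms by (intro ambient_eqI) (auto simp: segment_closed thread_closed segment_apply thread_apply)
  then show ?thesis using assms by (simp add: thread_in_threads)
next
  case False
  then obtain k where k: "k \<in> G" "\<not> k \<sqsubseteq> i" and k_least: "\<forall>k'\<in>G. \<not> k' \<sqsubseteq> i \<longrightarrow> k \<sqsubseteq> k'"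
    using least[of "{k \<in> G. \<not> k \<sqsubseteq> i}"] assms(1) by auto
  have kW: "k \<in> W" using k assms by auto
  have ik: "i \<sqsubseteq> k" using total[OF assms(2) kW] k by auto
  interpret Xk: abelian_group "X k" by (rule X_group[OF kW])
  have fx: "f i k x \<in> carrier (X k)" using assms ik kW by (simp add: f_facts)
  have cond: "(\<forall>k'\<in>G. k' \<sqsubseteq> j \<longrightarrow> k' \<sqsubseteq> i) \<longleftrightarrow> \<not> k \<sqsubseteq> j" if "j \<in> W" for j
    using that k k_least trans[OF kW _ that] assms(1) by (metis subsetD)
  have "segment G b i x = thread b i x \<oplus>\<^bsub>ambient\<^esub> thread b k (\<ominus>\<^bsub>X k\<^esub> f i k x)"
  proof (rule ambient_eqI)
    fix b' j assume b': "b' \<in> branches" and j: "j \<in> W"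
    interpret Xj: abelian_group "X j" by (rule X_group[OF j])
    have seg: "segment G b i x (b', j) = (if i \<sqsubseteq> j \<and> \<not> k \<sqsubseteq> j \<and> agree j b b' then f i j x else \<zero>\<^bsub>X j\<^esub>)"
      by (simp only: segment_apply[OF b' j] cond[OF j])
    show "segment G b i x (b', j) = (thread b i x \<oplus>\<^bsub>ambient\<^esub> thread b k (\<ominus>\<^bsub>X k\<^esub> f i k x)) (b', j)"
    proof (cases "k \<sqsubseteq> j")
      case True
      have "i \<sqsubseteq> j" by (rule trans[OF assms(2) kW j ik True])
      moreover have "f k j (\<ominus>\<^bsub>X k\<^esub> f i k x) = \<ominus>\<^bsub>X j\<^esub> f i j x"
        using module_Hom_neg[OF f[OF kW j True] X[OF kW] X[OF j] fx] f_comp[OF assms(2) kW j ik True assms(3)]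
        by simp
      ultimately show ?thesis
        using True b' j assms(2,3)
        by (simp add: seg thread_apply ambient_ops f_facts Xj.r_neg)
    next
      case False
      then show ?thesis
        using b' j assms(2,3)
        by (simp add: seg thread_apply ambient_ops f_facts)
    qed
  qed (use assms kW fx in \<open>auto simp: segment_closed thread_closed\<close>)
  then show ?thesis
    using assms kW fx by (simp add: threads_add thread_in_threads)
qed

lemma segment_Hom:
  assumes "G \<subseteq> W" "i \<in> W" "b \<in> branches"
  shows "restrict (segment G b i) (carrier (X i)) \<in> module_Hom R (X i) tree_module"
proof (rule module_HomI)
  fix x y assume xy: "x \<in> carrier (X i)" "y \<in> carrier (X i)"
  show "segment G b i (x \<oplus>\<^bsub>X i\<^esub> y) = segment G b i x \<oplus>\<^bsub>tree_module\<^esub> segment G b i y"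
    unfolding tree_module_simps
    by (rule ambient_eqI)
      (use xy assms in \<open>auto simp: segment_closed segment_apply ambient_ops f_facts X_facts\<close>)
next
  fix r x assume rx: "r \<in> carrier R" "x \<in> carrier (X i)"
  show "segment G b i (r \<odot>\<^bsub>X i\<^esub> x) = r \<odot>\<^bsub>tree_module\<^esub> segment G b i x"
    unfolding tree_module_simps
    by (rule ambient_eqI)
      (use rx assms in \<open>auto simp: segment_closed segment_apply ambient_ops f_facts X_facts
         left_module.smult_closed[OF left_module_ambient]\<close>)
qed (use assms in \<open>auto simp: tree_module_simps segment_in_tree X\<close>)

lemma coordinate_Hom:
  assumes "b \<in> branches" "i \<in> W"
  shows "(\<lambda>l\<in>carrier tree_module. l (b, i)) \<in> module_Hom R tree_module (X i)"
  by (rule module_HomI)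
    (use assms left_module_tree in \<open>auto simp: tree_module_simps tree_module_val ambient_ops\<close>)

text \<open>
  By \<open>split\<close>, branches from \<open>F\<close> part only at levels of \<open>G\<close>.  When the threads along these branches are
  cut at the levels of \<open>G\<close>, each element built from them is the sum of the segments that start with its
  values at the finitely many nodes on these levels.  Taking a value and starting a segment with it
  is a map through some \<open>X i\<close>.
\<close>

lemma threads_fixed_by_factoring:
  assumes F: "finite F" "F \<subseteq> branches" and G: "finite G" "G \<subseteq> W"
    and split: "\<And>b b' i j. \<lbrakk>b \<in> F; b' \<in> F; i \<in> G; j \<in> W; i \<sqsubseteq> j; \<forall>k\<in>G. k \<sqsubseteq> j \<longrightarrow> k \<sqsubseteq> i; agree i b b'\<rbrakk>
      \<Longrightarrow> agree j b b'"
  shows "\<exists>e\<in>factoring R (X ` W) tree_module. \<forall>z\<in>threads F G. e z = z"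
proof -
  \<comment> \<open>the nodes, and for each node a branch of \<open>F\<close> through it\<close>
  define K where "K = (\<lambda>(b, i). (b \<inter> A i, i)) ` (F \<times> G)"
  define \<rho> where "\<rho> = (\<lambda>\<nu>. SOME b. b \<in> F \<and> b \<inter> A (snd \<nu>) = fst \<nu>)"
  have finK: "finite K" using F G by (simp add: K_def)
  have \<rho>: "\<rho> \<nu> \<in> F" "\<rho> \<nu> \<inter> A (snd \<nu>) = fst \<nu>" "snd \<nu> \<in> G" if "\<nu> \<in> K" for \<nu>
  proof -
    from that obtain b i where "b \<in> F" "i \<in> G" "\<nu> = (b \<inter> A i, i)" by (auto simp: K_def)
    then have "\<exists>b. b \<in> F \<and> b \<inter> A (snd \<nu>) = fst \<nu>" and G: "snd \<nu> \<in> G" by auto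
    from someI_ex[OF this(1)] G show "\<rho> \<nu> \<in> F" "\<rho> \<nu> \<inter> A (snd \<nu>) = fst \<nu>" "snd \<nu> \<in> G"
      by (simp_all add: \<rho>_def)
  qed
  have \<rho>': "\<rho> \<nu> \<in> branches" "snd \<nu> \<in> W" if "\<nu> \<in> K" for \<nu>
    using \<rho>[OF that] F G by auto
  define u where "u = (\<lambda>\<nu>. \<lambda>l\<in>carrier tree_module. l (\<rho> \<nu>, snd \<nu>))"
  define v where "v = (\<lambda>\<nu>. restrict (segment G (\<rho> \<nu>) (snd \<nu>)) (carrier (X (snd \<nu>))))"
  have u: "u \<nu> \<in> module_Hom R tree_module (X (snd \<nu>))" if "\<nu> \<in> K" for \<nu>
    unfolding u_def by (rule coordinate_Hom[OF \<rho>'[OF that]])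
  have v: "v \<nu> \<in> module_Hom R (X (snd \<nu>)) tree_module" if "\<nu> \<in> K" for \<nu>
    unfolding v_def by (rule segment_Hom[OF G(2) \<rho>'(2)[OF that] \<rho>'(1)[OF that]])
  define e where "e = (\<lambda>z\<in>carrier tree_module. \<Oplus>\<^bsub>tree_module\<^esub>\<nu>\<in>K. v \<nu> (u \<nu> z))"
  interpret T: abelian_group tree_module by (rule left_module_abelian_group[OF left_module_tree])
  have e: "e \<in> factoring R (X ` W) tree_module"
    unfolding e_def by (rule factoring_finsum[OF left_module_tree finK _ u v]) (use \<rho>' in auto)
  have vu: "v \<nu> (u \<nu> z) \<in> carrier tree_module" if "\<nu> \<in> K" "z \<in> carrier tree_module" for \<nu> z
    by (rule module_Hom_closed[OF v[OF that(1)] module_Hom_closed[OF u[OF that(1)] that(2)]])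
  have e_thread: "e (thread b i x) = thread b i x"
    if b: "b \<in> F" and i: "i \<in> G" and x: "x \<in> carrier (X i)" for b i x
  proof -
    have iW: "i \<in> W" and bB: "b \<in> branches" using i b F G by auto
    have z: "thread b i x \<in> carrier tree_module"
      using thread_in_threads[OF bB iW x iW] by (simp add: tree_module_simps)
    show ?thesis
    proof (rule ambient_eqI)
      fix b' j assume b': "b' \<in> branches" and j: "j \<in> W"
      interpret Xj: abelian_group "X j" by (rule X_group[OF j])
      \<comment> \<open>the contribution of the node \<open>\<nu>\<close> to the coordinate at \<open>(b', j)\<close>\<close>
      define t where "t = (\<lambda>\<nu>. v \<nu> (u \<nu> (thread b i x)) (b', j))"
      have t_closed: "t \<nu> \<in> carrier (X j)" if "\<nu> \<in> K" for \<nu>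
        using tree_module_val[OF _ b' j] vu[OF that z] by (simp add: t_def tree_module_simps)
      have "e (thread b i x) (b', j) =
          (\<lambda>l\<in>carrier tree_module. l (b', j)) (\<Oplus>\<^bsub>tree_module\<^esub>\<nu>\<in>K. v \<nu> (u \<nu> (thread b i x)))"
        using z vu by (simp add: e_def Pi_iff)
      also have "\<dots> = (\<Oplus>\<^bsub>X j\<^esub>\<nu>\<in>K. (\<lambda>l\<in>carrier tree_module. l (b', j)) (v \<nu> (u \<nu> (thread b i x))))"
        by (rule module_Hom_finsum[OF coordinate_Hom[OF b' j] left_module_tree X[OF j] finK vu[OF _ z]])
      also have "\<dots> = (\<Oplus>\<^bsub>X j\<^esub>\<nu>\<in>K. t \<nu>)"
        by (rule Xj.finsum_cong') (use vu z t_closed in \<open>auto simp: t_def\<close>)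
      finally have e_val: "e (thread b i x) (b', j) = (\<Oplus>\<^bsub>X j\<^esub>\<nu>\<in>K. t \<nu>)" .
      have t: "t \<nu> = (if snd \<nu> \<sqsubseteq> j \<and> (\<forall>k\<in>G. k \<sqsubseteq> j \<longrightarrow> k \<sqsubseteq> snd \<nu>) \<and> agree j (\<rho> \<nu>) b' \<and>
            i \<sqsubseteq> snd \<nu> \<and> agree (snd \<nu>) b (\<rho> \<nu>) then f i j x else \<zero>\<^bsub>X j\<^esub>)" if \<nu>: "\<nu> \<in> K" for \<nu>
      proof -
        have "u \<nu> (thread b i x) =
            (if i \<sqsubseteq> snd \<nu> \<and> agree (snd \<nu>) b (\<rho> \<nu>) then f i (snd \<nu>) x else \<zero>\<^bsub>X (snd \<nu>)\<^esub>)"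
          using z \<rho>'[OF \<nu>] by (simp add: u_def thread_apply)
        then show ?thesis
          using \<rho>'[OF \<nu>] b' j x iW
          by (auto simp: t_def v_def segment_apply f_facts f_comp X_facts)
      qed
      show "e (thread b i x) (b', j) = thread b i x (b', j)"
      proof (cases "i \<sqsubseteq> j")
        case False
        then have "t \<nu> = \<zero>\<^bsub>X j\<^esub>" if "\<nu> \<in> K" for \<nu>
          using t[OF that] trans[OF iW \<rho>'(2)[OF that] j] by auto
        then have "(\<Oplus>\<^bsub>X j\<^esub>\<nu>\<in>K. t \<nu>) = (\<Oplus>\<^bsub>X j\<^esub>\<nu>\<in>K. \<zero>\<^bsub>X j\<^esub>)"
          by (intro Xj.finsum_cong') auto
        then show ?thesis using e_val False b' j by (simp add: thread_apply)
      next
        case True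
        \<comment> \<open>the only segment that reaches this coordinate starts at the last level \<open>m\<close> of \<open>G\<close> below \<open>j\<close>\<close>
        have "\<exists>m\<in>S. \<forall>k\<in>S. k \<sqsubseteq> m" if "finite S" "S \<noteq> {}" "S \<subseteq> W" for S
          using that
        proof (induct S rule: finite_ne_induct)
          case (singleton x)
          then show ?case by (simp add: refl)
        next
          case (insert x S)
          then obtain m where m: "m \<in> S" "\<forall>k\<in>S. k \<sqsubseteq> m" by auto
          show ?case
          proof (cases "x \<sqsubseteq> m")
            case True
            then show ?thesis using m by auto
          next
            case False
            have mW: "m \<in> W" and xW: "x \<in> W" using m insert by auto
            then have mx: "m \<sqsubseteq> x" using total[OF mW xW] False by auto
            have "k \<sqsubseteq> x" if "k \<in> S" for k
              using trans[of k m x] that m mW xW mx insert by auto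
            then show ?thesis using refl[OF xW] by auto
          qed
        qed
        from this[of "{k \<in> G. k \<sqsubseteq> j}"] obtain m where m: "m \<in> G" "m \<sqsubseteq> j"
          and m_max: "\<forall>k\<in>G. k \<sqsubseteq> j \<longrightarrow> k \<sqsubseteq> m"
          using G i True by auto
        have mW: "m \<in> W" using m G by auto
        define \<mu> where "\<mu> = (b \<inter> A m, m)"
        have \<mu>: "\<mu> \<in> K" using b m by (auto simp: \<mu>_def K_def)
        have ag: "agree m b (\<rho> \<mu>)" using \<rho>(2)[OF \<mu>] by (simp add: \<mu>_def agree_def)
        have "agree j b (\<rho> \<mu>)" by (rule split[OF b \<rho>(1)[OF \<mu>] m(1) j m(2) m_max ag])
        then have t\<mu>: "t \<mu> = thread b i x (b', j)"
          using t[OF \<mu>] ag m m_max i True b' j by (auto simp: \<mu>_def thread_apply agree_def)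
        have "t \<nu> = (if \<mu> = \<nu> then t \<nu> else \<zero>\<^bsub>X j\<^esub>)" if \<nu>: "\<nu> \<in> K" for \<nu>
        proof (rule ccontr)
          assume "\<not> ?thesis"
          then have ne: "\<mu> \<noteq> \<nu>" and "t \<nu> \<noteq> \<zero>\<^bsub>X j\<^esub>" by (auto split: if_splits)
          then have *: "snd \<nu> \<sqsubseteq> j" "\<forall>k\<in>G. k \<sqsubseteq> j \<longrightarrow> k \<sqsubseteq> snd \<nu>" "agree (snd \<nu>) b (\<rho> \<nu>)"
            using t[OF \<nu>] by (auto split: if_splits)
          have "snd \<nu> = m"
            using * m m_max \<rho>(3)[OF \<nu>] \<rho>'(2)[OF \<nu>] mW by (intro antisym) auto
          moreover have "fst \<nu> = b \<inter> A m"
            using *(3) \<rho>(2)[OF \<nu>] \<open>snd \<nu> = m\<close> by (simp add: agree_def)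
          ultimately show False using ne by (cases \<nu>) (simp add: \<mu>_def)
        qed
        then have "(\<Oplus>\<^bsub>X j\<^esub>\<nu>\<in>K. t \<nu>) = (\<Oplus>\<^bsub>X j\<^esub>\<nu>\<in>K. if \<mu> = \<nu> then t \<nu> else \<zero>\<^bsub>X j\<^esub>)"
          by (intro Xj.finsum_cong') (auto simp: t_closed)
        also have "\<dots> = t \<mu>"
          by (rule Xj.finsum_singleton[OF \<mu> finK]) (auto simp: t_closed)
        finally show ?thesis using e_val t\<mu> by simp
      qed
    qed (use iW x factoring_closed[OF e left_module_tree z] in
        \<open>auto simp: thread_closed tree_module_simps threads_closed\<close>)
  qed
  have e_add: "e (l \<oplus>\<^bsub>tree_module\<^esub> l') = e l \<oplus>\<^bsub>tree_module\<^esub> e l'"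
    if "l \<in> carrier tree_module" "l' \<in> carrier tree_module" for l l'
    by (rule factoring_add[OF e left_module_tree _ that]) (auto simp: X)
  have "e z = z" if "z \<in> threads F G" for z
    using that
  proof induct
    case zero
    have "e \<zero>\<^bsub>tree_module\<^esub> \<oplus>\<^bsub>tree_module\<^esub> e \<zero>\<^bsub>tree_module\<^esub> = e \<zero>\<^bsub>tree_module\<^esub>"
      using e_add[of "\<zero>\<^bsub>tree_module\<^esub>" "\<zero>\<^bsub>tree_module\<^esub>"] by simp
    then have "e \<zero>\<^bsub>tree_module\<^esub> = \<zero>\<^bsub>tree_module\<^esub>"
      using factoring_closed[OF e left_module_tree T.zero_closed] by simp
    then show ?case by (simp add: tree_module_simps)
  next
    case (add l b i x)
    have "i \<in> W" "b \<in> branches" using add F G by auto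
    then have "thread b i x \<in> carrier tree_module"
      using thread_in_threads[of b branches i W x] add by (simp add: tree_module_simps)
    moreover have "l \<in> carrier tree_module"
      using threads_mono[OF add(1) F(2) G(2)] by (simp add: tree_module_simps)
    ultimately show ?case
      using e_add[of "thread b i x" l] add
      by (auto simp: e_thread tree_module_simps)
  qed
  with e show ?thesis by blast
qed

lemma threads_finite:
  assumes "l \<in> threads branches W"
  shows "\<exists>F G. finite F \<and> F \<subseteq> branches \<and> finite G \<and> G \<subseteq> W \<and> l \<in> threads F G"
  using assms
proof induct
  case zero
  show ?case by (intro exI[of _ "{}"]) (auto intro: threads.zero)
next
  case (add l b i x)
  then obtain F G where "finite F" "F \<subseteq> branches" "finite G" "G \<subseteq> W" "l \<in> threads F G" by auto
  then show ?case
    using add threads_mono[of l F G "insert b F" "insert i G"]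
    by (intro exI[of _ "insert b F"] exI[of _ "insert i G"]) (auto intro: threads.add)
qed

lemma tree_module_locally_factors: "locally_factors R (X ` W) tree_module"
  unfolding locally_factors_def tree_module_simps
proof (intro allI impI)
  fix Z assume "finite Z" "Z \<subseteq> threads branches W"
  then have "\<exists>F G. finite F \<and> F \<subseteq> branches \<and> finite G \<and> G \<subseteq> W \<and> Z \<subseteq> threads F G"
  proof induct
    case empty
    show ?case by (intro exI[of _ "{}"]) auto
  next
    case (insert z Z)
    then obtain F G F' G' where FG: "finite F" "F \<subseteq> branches" "finite G" "G \<subseteq> W" "Z \<subseteq> threads F G"
      and FG': "finite F'" "F' \<subseteq> branches" "finite G'" "G' \<subseteq> W" "z \<in> threads F' G'"
      using threads_finite[of z] by auto
    then have "insert z Z \<subseteq> threads (F \<union> F') (G \<union> G')"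
      using threads_mono[of _ F G "F \<union> F'" "G \<union> G'"] threads_mono[of z F' G' "F \<union> F'" "G \<union> G'"] by auto
    with FG FG' show ?case by (intro exI[of _ "F \<union> F'"] exI[of _ "G \<union> G'"]) auto
  qed
  then obtain F G where FG: "finite F" "F \<subseteq> branches" "finite G" "G \<subseteq> W" "Z \<subseteq> threads F G" by auto
  \<comment> \<open>the level at which two branches part\<close>
  define d where "d = (\<lambda>(b, b'). SOME d. d \<in> W \<and> (\<forall>j\<in>W. agree j b b' \<longleftrightarrow> \<not> d \<sqsubseteq> j))"
  have d: "d (b, b') \<in> W" "\<And>j. j \<in> W \<Longrightarrow> agree j b b' \<longleftrightarrow> \<not> d (b, b') \<sqsubseteq> j"
    if "b \<in> F" "b' \<in> F" "b \<noteq> b'" for b b'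
    using someI_ex[of "\<lambda>d. d \<in> W \<and> (\<forall>j\<in>W. agree j b b' \<longleftrightarrow> \<not> d \<sqsubseteq> j)"]
      branches_split[of b b'] that FG(2) by (auto simp: d_def)
  define G' where "G' = G \<union> d ` {(b, b'). b \<in> F \<and> b' \<in> F \<and> b \<noteq> b'}"
  have G': "finite G'" "G' \<subseteq> W"
  proof -
    have "finite {(b, b'). b \<in> F \<and> b' \<in> F \<and> b \<noteq> b'}"
      by (rule finite_subset[of _ "F \<times> F"]) (use FG in auto)
    then show "finite G'" using FG by (simp add: G'_def)
    show "G' \<subseteq> W" using FG(4) d(1) unfolding G'_def by blast
  qed
  have "\<exists>e\<in>factoring R (X ` W) tree_module. \<forall>z\<in>threads F G'. e z = z"
  proof (rule threads_fixed_by_factoring[OF FG(1,2) G'])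
    fix b b' i j
    assume *: "b \<in> F" "b' \<in> F" "i \<in> G'" "j \<in> W" "i \<sqsubseteq> j" "\<forall>k\<in>G'. k \<sqsubseteq> j \<longrightarrow> k \<sqsubseteq> i" "agree i b b'"
    show "agree j b b'"
    proof (cases "b = b'")
      case False
      have "d (b, b') \<in> G'" using * False by (auto simp: G'_def)
      then show ?thesis using d[OF *(1,2) False] * G'(2) by blast
    qed simp
  qed
  moreover have "Z \<subseteq> threads F G'"
    using FG(5) threads_mono[of _ F G F G'] by (auto simp: G'_def)
  ultimately show "\<exists>e\<in>factoring R (X ` W) tree_module. \<forall>z\<in>Z. e z = z" by blast
qed


subsection \<open>Maps to the limit\<close>

text \<open>
  Along any branch, the values of an element of the tree module have eventually the same image in
  \<open>N\<close>: an initial value is transported by the maps of the system, or it is zero once the branch has left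
  the thread.
\<close>

definition limit_value :: "'k set \<Rightarrow> ('k set \<times> 'i \<Rightarrow> 'x) \<Rightarrow> 'n \<Rightarrow> bool"
  where "limit_value b l n \<longleftrightarrow> (\<exists>i\<in>W. \<forall>j\<in>W. i \<sqsubseteq> j \<longrightarrow> g j (l (b, j)) = n)"

sublocale N: abelian_group N
  by (rule left_module_abelian_group[OF N])

lemma limit_value_common:
  assumes "limit_value b l n" "limit_value b l' n'"
  obtains i where "i \<in> W" "\<And>j. \<lbrakk>j \<in> W; i \<sqsubseteq> j\<rbrakk> \<Longrightarrow> g j (l (b, j)) = n \<and> g j (l' (b, j)) = n'"
proof -
  obtain i i' where i: "i \<in> W" "\<forall>j\<in>W. i \<sqsubseteq> j \<longrightarrow> g j (l (b, j)) = n"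
    and i': "i' \<in> W" "\<forall>j\<in>W. i' \<sqsubseteq> j \<longrightarrow> g j (l' (b, j)) = n'"
    using assms unfolding limit_value_def by auto
  obtain k where k: "k \<in> W" "i \<sqsubseteq> k" "i' \<sqsubseteq> k" using upper_bound[OF i(1) i'(1)] .
  show ?thesis
    by (rule that[OF k(1)]) (use i i' k trans in blast)
qed

lemma limit_value_unique: "\<lbrakk>limit_value b l n; limit_value b l n'\<rbrakk> \<Longrightarrow> n = n'"
  by (erule (1) limit_value_common) (use refl in blast)

lemma limit_value_add:
  assumes "limit_value b l n" "limit_value b l' n'" "b \<in> branches"
    and l: "l \<in> threads branches W" "l' \<in> threads branches W"
  shows "limit_value b (l \<oplus>\<^bsub>ambient\<^esub> l') (n \<oplus>\<^bsub>N\<^esub> n')"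
  using assms(1,2)
proof (rule limit_value_common)
  fix i assume i: "i \<in> W" "\<And>j. \<lbrakk>j \<in> W; i \<sqsubseteq> j\<rbrakk> \<Longrightarrow> g j (l (b, j)) = n \<and> g j (l' (b, j)) = n'"
  show ?thesis
    unfolding limit_value_def
    by (rule bexI[OF _ i(1)])
      (use i assms(3) l in \<open>auto simp: ambient_ops module_Hom_add[OF g] tree_module_val\<close>)
qed

lemma limit_value_smult:
  assumes "limit_value b l n" "b \<in> branches" "r \<in> carrier R" and l: "l \<in> threads branches W"
  shows "limit_value b (r \<odot>\<^bsub>ambient\<^esub> l) (r \<odot>\<^bsub>N\<^esub> n)"
proof -
  obtain i where "i \<in> W" "\<forall>j\<in>W. i \<sqsubseteq> j \<longrightarrow> g j (l (b, j)) = n"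
    using assms(1) unfolding limit_value_def by auto
  then show ?thesis
    unfolding limit_value_def using assms(2-)
    by (intro bexI[of _ i]) (auto simp: ambient_ops module_Hom_smult[OF g] tree_module_val)
qed

lemma limit_value_cong:
  assumes "limit_value b l n" "i \<in> W" "\<And>j. \<lbrakk>j \<in> W; i \<sqsubseteq> j\<rbrakk> \<Longrightarrow> l' (b, j) = l (b, j)"
  shows "limit_value b l' n"
proof -
  obtain i' where i': "i' \<in> W" "\<forall>j\<in>W. i' \<sqsubseteq> j \<longrightarrow> g j (l (b, j)) = n"
    using assms unfolding limit_value_def by auto
  obtain k where k: "k \<in> W" "i \<sqsubseteq> k" "i' \<sqsubseteq> k" using upper_bound[OF assms(2) i'(1)] .
  show ?thesis
    unfolding limit_value_def
  proof (rule bexI[OF _ k(1)], intro ballI impI)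
    fix j assume j: "j \<in> W" "k \<sqsubseteq> j"
    have "i \<sqsubseteq> j" "i' \<sqsubseteq> j" using trans k j assms(2) i'(1) by blast+
    then show "g j (l' (b, j)) = n" using assms(3) i' j by auto
  qed
qed

lemma limit_value_thread:
  assumes "i \<in> W" "x \<in> carrier (X i)" "b \<in> branches" "b' \<in> branches"
  shows "limit_value b' (thread b i x) (if b = b' then g i x else \<zero>\<^bsub>N\<^esub>)"
proof (cases "b = b'")
  case True
  then show ?thesis
    using assms unfolding limit_value_def
    by (intro bexI[of _ i]) (auto simp: thread_apply g_comp)
next
  case False
  then obtain d where d: "d \<in> W" "\<forall>j\<in>W. agree j b b' \<longleftrightarrow> \<not> d \<sqsubseteq> j"
    using branches_split[OF assms(3,4)] by auto
  then show ?thesis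
    using False assms unfolding limit_value_def
    by (intro bexI[of _ d]) (auto simp: thread_apply g_zero)
qed

lemma limit_value_zero: "b \<in> branches \<Longrightarrow> limit_value b \<zero>\<^bsub>ambient\<^esub> \<zero>\<^bsub>N\<^esub>"
  unfolding limit_value_def using nonempty by (auto simp: ambient_ops g_zero)

lemma limit_value_exists:
  assumes "l \<in> threads branches W" "b \<in> branches"
  shows "\<exists>n\<in>carrier N. limit_value b l n"
  using assms(1)
proof induct
  case zero
  show ?case using limit_value_zero[OF assms(2)] by blast
next
  case (add l c i x)
  then obtain n where n: "n \<in> carrier N" "limit_value b l n" by auto
  have "limit_value b (thread c i x \<oplus>\<^bsub>ambient\<^esub> l) ((if c = b then g i x else \<zero>\<^bsub>N\<^esub>) \<oplus>\<^bsub>N\<^esub> n)"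
    using add n assms(2)
    by (intro limit_value_add limit_value_thread) (auto intro: thread_in_threads)
  moreover have "(if c = b then g i x else \<zero>\<^bsub>N\<^esub>) \<oplus>\<^bsub>N\<^esub> n \<in> carrier N"
    using n add module_Hom_closed[OF g] by auto
  ultimately show ?case by blast
qed

definition value_at :: "'k set \<Rightarrow> ('k set \<times> 'i \<Rightarrow> 'x) \<Rightarrow> 'n"
  where "value_at b l = (THE n. limit_value b l n)"

lemma value_at_eq: "limit_value b l n \<Longrightarrow> value_at b l = n"
  unfolding value_at_def using limit_value_unique by blast

lemma value_at:
  assumes "l \<in> threads branches W" "b \<in> branches"
  shows "limit_value b l (value_at b l)" "value_at b l \<in> carrier N"
  using limit_value_exists[OF assms] value_at_eq by auto

lemma value_at_add:
  "\<lbrakk>l \<in> threads branches W; l' \<in> threads branches W; b \<in> branches\<rbrakk>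
    \<Longrightarrow> value_at b (l \<oplus>\<^bsub>ambient\<^esub> l') = value_at b l \<oplus>\<^bsub>N\<^esub> value_at b l'"
  by (intro value_at_eq limit_value_add value_at)

lemma value_at_smult:
  "\<lbrakk>l \<in> threads branches W; r \<in> carrier R; b \<in> branches\<rbrakk>
    \<Longrightarrow> value_at b (r \<odot>\<^bsub>ambient\<^esub> l) = r \<odot>\<^bsub>N\<^esub> value_at b l"
  by (intro value_at_eq limit_value_smult value_at)

lemma finite_support:
  assumes "l \<in> threads branches W"
  shows "finite {b \<in> branches. value_at b l \<noteq> \<zero>\<^bsub>N\<^esub>}"
  using assms
proof induct
  case zero
  have "{b \<in> branches. value_at b \<zero>\<^bsub>ambient\<^esub> \<noteq> \<zero>\<^bsub>N\<^esub>} = {}"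
    using value_at_eq[OF limit_value_zero] by auto
  then show ?case by (metis finite.emptyI)
next
  case (add l c i x)
  have "value_at b (thread c i x \<oplus>\<^bsub>ambient\<^esub> l) = \<zero>\<^bsub>N\<^esub>"
    if "b \<in> branches" "b \<noteq> c" "value_at b l = \<zero>\<^bsub>N\<^esub>" for b
    using that add value_at_eq[OF limit_value_thread[of i x c b]]
    by (simp add: value_at_add thread_in_threads)
  then have "{b \<in> branches. value_at b (thread c i x \<oplus>\<^bsub>ambient\<^esub> l) \<noteq> \<zero>\<^bsub>N\<^esub>}
      \<subseteq> insert c {b \<in> branches. value_at b l \<noteq> \<zero>\<^bsub>N\<^esub>}" by auto
  then show ?case by (rule finite_subset) (simp add: add(2))
qed

text \<open>
  Only finitely many branches contribute for each \<open>l\<close>, so that every set of branches yields a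
  homomorphism.  The sum runs over the support because \<open>finsum\<close> is zero on infinite index sets.
\<close>

definition sum_over :: "'k set set \<Rightarrow> ('k set \<times> 'i \<Rightarrow> 'x) \<Rightarrow> 'n"
  where "sum_over \<epsilon> =
    (\<lambda>l\<in>carrier tree_module. \<Oplus>\<^bsub>N\<^esub>b\<in>{b \<in> \<epsilon>. value_at b l \<noteq> \<zero>\<^bsub>N\<^esub>}. value_at b l)"

lemma sum_over_superset:
  assumes "\<epsilon> \<subseteq> branches" "l \<in> threads branches W" "finite F" "F \<subseteq> \<epsilon>"
    and "{b \<in> \<epsilon>. value_at b l \<noteq> \<zero>\<^bsub>N\<^esub>} \<subseteq> F"
  shows "sum_over \<epsilon> l = (\<Oplus>\<^bsub>N\<^esub>b\<in>F. value_at b l)"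
proof -
  have "(\<Oplus>\<^bsub>N\<^esub>b\<in>{b \<in> \<epsilon>. value_at b l \<noteq> \<zero>\<^bsub>N\<^esub>}. value_at b l) = (\<Oplus>\<^bsub>N\<^esub>b\<in>F. value_at b l)"
    by (rule N.add.finprod_mono_neutral_cong_left) (use assms in \<open>auto intro: value_at(2)\<close>)
  then show ?thesis using assms(2) by (simp add: sum_over_def tree_module_simps)
qed

lemma sum_over_Hom:
  assumes \<epsilon>: "\<epsilon> \<subseteq> branches"
  shows "sum_over \<epsilon> \<in> module_Hom R tree_module N"
proof -
  have fin: "finite {b \<in> \<epsilon>. value_at b l \<noteq> \<zero>\<^bsub>N\<^esub>}" if "l \<in> threads branches W" for l
    by (rule finite_subset[OF _ finite_support[OF that]]) (use \<epsilon> in auto)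
  have "restrict (sum_over \<epsilon>) (carrier tree_module) \<in> module_Hom R tree_module N"
  proof (rule module_HomI)
    fix l assume "l \<in> carrier tree_module"
    then show "sum_over \<epsilon> l \<in> carrier N"
      using \<epsilon> by (auto simp: sum_over_def tree_module_simps intro!: N.finsum_closed value_at(2))
  next
    fix l l' assume l: "l \<in> carrier tree_module" "l' \<in> carrier tree_module"
    then have l': "l \<in> threads branches W" "l' \<in> threads branches W" by (simp_all add: tree_module_simps)
    let ?F = "{b \<in> \<epsilon>. value_at b l \<noteq> \<zero>\<^bsub>N\<^esub>} \<union> {b \<in> \<epsilon>. value_at b l' \<noteq> \<zero>\<^bsub>N\<^esub>}"
    have F: "finite ?F" "?F \<subseteq> \<epsilon>" using fin l' by auto
    have "sum_over \<epsilon> (l \<oplus>\<^bsub>ambient\<^esub> l') = (\<Oplus>\<^bsub>N\<^esub>b\<in>?F. value_at b (l \<oplus>\<^bsub>ambient\<^esub> l'))"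
      by (rule sum_over_superset[OF \<epsilon> _ F])
        (use l' \<epsilon> in \<open>auto simp: threads_add value_at_add subset_iff\<close>)
    also have "\<dots> = (\<Oplus>\<^bsub>N\<^esub>b\<in>?F. value_at b l \<oplus>\<^bsub>N\<^esub> value_at b l')"
      by (rule N.finsum_cong') (use l' \<epsilon> in \<open>auto simp: value_at_add value_at(2) subset_iff\<close>)
    also have "\<dots> = (\<Oplus>\<^bsub>N\<^esub>b\<in>?F. value_at b l) \<oplus>\<^bsub>N\<^esub> (\<Oplus>\<^bsub>N\<^esub>b\<in>?F. value_at b l')"
      by (rule N.finsum_addf) (use l' \<epsilon> in \<open>auto simp: value_at(2) subset_iff\<close>)
    also have "\<dots> = sum_over \<epsilon> l \<oplus>\<^bsub>N\<^esub> sum_over \<epsilon> l'"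
      using sum_over_superset[OF \<epsilon> l'(1) F] sum_over_superset[OF \<epsilon> l'(2) F] by auto
    finally show "sum_over \<epsilon> (l \<oplus>\<^bsub>tree_module\<^esub> l') = sum_over \<epsilon> l \<oplus>\<^bsub>N\<^esub> sum_over \<epsilon> l'"
      by (simp add: tree_module_simps)
  next
    fix r l assume r: "r \<in> carrier R" and l: "l \<in> carrier tree_module"
    then have l': "l \<in> threads branches W" by (simp add: tree_module_simps)
    let ?F = "{b \<in> \<epsilon>. value_at b l \<noteq> \<zero>\<^bsub>N\<^esub>}"
    have F: "finite ?F" "?F \<subseteq> \<epsilon>" using fin l' by auto
    have "sum_over \<epsilon> (r \<odot>\<^bsub>ambient\<^esub> l) = (\<Oplus>\<^bsub>N\<^esub>b\<in>?F. value_at b (r \<odot>\<^bsub>ambient\<^esub> l))"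
      by (rule sum_over_superset[OF \<epsilon> _ F])
        (use l' r \<epsilon> in \<open>auto simp: threads_smult value_at_smult left_module_smult_zero_right[OF N] subset_iff\<close>)
    also have "\<dots> = (\<Oplus>\<^bsub>N\<^esub>b\<in>?F. r \<odot>\<^bsub>N\<^esub> value_at b l)"
      by (rule N.finsum_cong')
        (use l' r \<epsilon> in \<open>auto simp: value_at_smult value_at(2) left_module.smult_closed[OF N] subset_iff\<close>)
    also have "\<dots> = r \<odot>\<^bsub>N\<^esub> (\<Oplus>\<^bsub>N\<^esub>b\<in>?F. value_at b l)"
      by (rule left_module_smult_finsum[OF N r F(1), symmetric])
        (use l' \<epsilon> in \<open>auto simp: value_at(2) subset_iff\<close>)
    also have "\<dots> = r \<odot>\<^bsub>N\<^esub> sum_over \<epsilon> l"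
      using sum_over_superset[OF \<epsilon> l' F] by auto
    finally show "sum_over \<epsilon> (r \<odot>\<^bsub>tree_module\<^esub> l) = r \<odot>\<^bsub>N\<^esub> sum_over \<epsilon> l"
      by (simp add: tree_module_simps)
  qed (rule left_module_tree)
  then show ?thesis by (simp add: sum_over_def)
qed

text \<open>
  Each of these elements is determined by its values below a single level, so there are few of them
  compared with the number of branches.
\<close>

definition bounded_part :: "('k set \<times> 'i \<Rightarrow> 'x) set"
  where "bounded_part = {l \<in> threads branches W.
    \<exists>i\<in>W. \<forall>j\<in>W. i \<sqsubseteq> j \<longrightarrow> (\<forall>b\<in>branches. l (b, j) = \<zero>\<^bsub>X j\<^esub>)}"

text \<open>
  From some level on, an element of this part is a single thread along \<open>b\<close>.  It is bounded if its limit
  along \<open>b\<close> is zero, as its value then becomes zero at a higher level.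
\<close>

definition branch_part :: "'k set \<Rightarrow> ('k set \<times> 'i \<Rightarrow> 'x) set"
  where "branch_part b = {l \<in> threads branches W.
    \<exists>i\<in>W. \<exists>x\<in>carrier (X i). \<forall>j\<in>W. i \<sqsubseteq> j \<longrightarrow> (\<forall>b'\<in>branches. l (b', j) = thread b i x (b', j))}"

lemma sum_over_bounded:
  assumes "\<epsilon> \<subseteq> branches" "l \<in> bounded_part"
  shows "sum_over \<epsilon> l = \<zero>\<^bsub>N\<^esub>"
proof -
  have "value_at b l = \<zero>\<^bsub>N\<^esub>" if "b \<in> \<epsilon>" for b
  proof (rule value_at_eq)
    obtain i where i: "i \<in> W" "\<forall>j\<in>W. i \<sqsubseteq> j \<longrightarrow> (\<forall>b\<in>branches. l (b, j) = \<zero>\<^bsub>X j\<^esub>)"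
      using assms(2) by (auto simp: bounded_part_def)
    then show "limit_value b l \<zero>\<^bsub>N\<^esub>"
      unfolding limit_value_def using that assms(1) by (intro bexI[of _ i]) (auto simp: g_zero subset_iff)
  qed
  then have "{b \<in> \<epsilon>. value_at b l \<noteq> \<zero>\<^bsub>N\<^esub>} \<subseteq> {}" by auto
  moreover have "l \<in> threads branches W" using assms(2) by (simp add: bounded_part_def)
  ultimately show ?thesis
    using sum_over_superset[OF assms(1), of l "{}"] by simp
qed

lemma branch_partE:
  assumes "l \<in> branch_part b" "k \<in> W" "b \<in> branches"
  obtains i x where "i \<in> W" "k \<sqsubseteq> i" "x \<in> carrier (X i)"
    "\<And>j b'. \<lbrakk>j \<in> W; i \<sqsubseteq> j; b' \<in> branches\<rbrakk> \<Longrightarrow> l (b', j) = thread b i x (b', j)"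
proof -
  obtain i x where i: "i \<in> W" "x \<in> carrier (X i)"
    and eq: "\<forall>j\<in>W. i \<sqsubseteq> j \<longrightarrow> (\<forall>b'\<in>branches. l (b', j) = thread b i x (b', j))"
    using assms(1) by (auto simp: branch_part_def)
  obtain m where m: "m \<in> W" "i \<sqsubseteq> m" "k \<sqsubseteq> m" using upper_bound[OF i(1) assms(2)] .
  show ?thesis
  proof (rule that[OF m(1,3) f_facts(1)[OF i(1) m(1,2) i(2)]])
    fix j b' assume j: "j \<in> W" "m \<sqsubseteq> j" and b': "b' \<in> branches"
    have "i \<sqsubseteq> j" using trans i m j by blast
    then show "l (b', j) = thread b m (f i m x) (b', j)"
      using eq i m j b' by (simp add: thread_apply f_comp)
  qed
qed

lemma branch_part_add:
  assumes l: "l \<in> branch_part b" "l' \<in> branch_part b" and b: "b \<in> branches"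
  shows "l \<oplus>\<^bsub>ambient\<^esub> l' \<in> branch_part b"
proof -
  obtain k where k: "k \<in> W" using nonempty by auto
  obtain i x where i: "i \<in> W" "x \<in> carrier (X i)"
    "\<And>j b'. \<lbrakk>j \<in> W; i \<sqsubseteq> j; b' \<in> branches\<rbrakk> \<Longrightarrow> l (b', j) = thread b i x (b', j)"
    using branch_partE[OF l(1) k b] by metis
  obtain i' x' where i': "i' \<in> W" "i \<sqsubseteq> i'" "x' \<in> carrier (X i')"
    "\<And>j b'. \<lbrakk>j \<in> W; i' \<sqsubseteq> j; b' \<in> branches\<rbrakk> \<Longrightarrow> l' (b', j) = thread b i' x' (b', j)"
    using branch_partE[OF l(2) i(1) b] by metis
  let ?y = "f i i' x \<oplus>\<^bsub>X i'\<^esub> x'"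
  have fx: "f i i' x \<in> carrier (X i')" using i i' by (simp add: f_facts)
  have y: "?y \<in> carrier (X i')" using i' fx by (simp add: X_facts)
  have "(l \<oplus>\<^bsub>ambient\<^esub> l') (b', j) = thread b i' ?y (b', j)"
    if j: "j \<in> W" "i' \<sqsubseteq> j" and b': "b' \<in> branches" for j b'
  proof -
    have "i \<sqsubseteq> j" using trans i i' j by blast
    then show ?thesis
      using i i' j b' fx by (simp add: ambient_ops thread_apply f_facts f_comp X_facts)
  qed
  then show ?thesis
    using l i'(1) y unfolding branch_part_def by (auto intro: threads_add)
qed

lemma branch_part_smult:
  assumes l: "l \<in> branch_part b" and r: "r \<in> carrier R" and b: "b \<in> branches"
  shows "r \<odot>\<^bsub>ambient\<^esub> l \<in> branch_part b"
proof -
  obtain i x where i: "i \<in> W" "x \<in> carrier (X i)"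
    "\<And>j b'. \<lbrakk>j \<in> W; i \<sqsubseteq> j; b' \<in> branches\<rbrakk> \<Longrightarrow> l (b', j) = thread b i x (b', j)"
    using l by (auto simp: branch_part_def)
  have "(r \<odot>\<^bsub>ambient\<^esub> l) (b', j) = thread b i (r \<odot>\<^bsub>X i\<^esub> x) (b', j)"
    if "j \<in> W" "i \<sqsubseteq> j" "b' \<in> branches" for j b'
    using that i r by (simp add: ambient_ops thread_apply f_facts X_facts)
  moreover have "r \<odot>\<^bsub>X i\<^esub> x \<in> carrier (X i)" using i r by (simp add: X_facts)
  ultimately show ?thesis
    using l r i(1) unfolding branch_part_def by (auto intro: threads_smult)
qed

lemma thread_in_branch_part:
  "\<lbrakk>i \<in> W; x \<in> carrier (X i); b \<in> branches\<rbrakk> \<Longrightarrow> thread b i x \<in> branch_part b"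
  unfolding branch_part_def by (auto intro: thread_in_threads)

lemma zero_in_branch_part:
  assumes "b \<in> branches"
  shows "\<zero>\<^bsub>ambient\<^esub> \<in> branch_part b"
proof -
  obtain i where i: "i \<in> W" using nonempty by auto
  have "\<zero>\<^bsub>ambient\<^esub> (b', j) = thread b i \<zero>\<^bsub>X i\<^esub> (b', j)" if "j \<in> W" "i \<sqsubseteq> j" "b' \<in> branches" for j b'
    using that i by (simp add: ambient_ops thread_apply f_facts)
  then show ?thesis
    using i X_facts(1)[OF i] unfolding branch_part_def by (auto intro: threads.zero)
qed

lemma value_at_branch_part:
  assumes "l \<in> threads branches W" "b \<in> branches" "b' \<in> branches" "i \<in> W" "x \<in> carrier (X i)"
    and "\<And>j b'. \<lbrakk>j \<in> W; i \<sqsubseteq> j; b' \<in> branches\<rbrakk> \<Longrightarrow> l (b', j) = thread b i x (b', j)"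
  shows "value_at b' l = (if b = b' then g i x else \<zero>\<^bsub>N\<^esub>)"
  by (rule value_at_eq, rule limit_value_cong[OF limit_value_thread[OF assms(4,5,2,3)] assms(4)])
    (use assms in auto)

lemma sum_over_branch_part:
  assumes \<epsilon>: "\<epsilon> \<subseteq> branches" and b: "b \<in> branches" and l: "l \<in> branch_part b"
  shows "sum_over \<epsilon> l = (if b \<in> \<epsilon> then value_at b l else \<zero>\<^bsub>N\<^esub>)"
proof -
  obtain i x where i: "i \<in> W" "x \<in> carrier (X i)"
    "\<And>j b'. \<lbrakk>j \<in> W; i \<sqsubseteq> j; b' \<in> branches\<rbrakk> \<Longrightarrow> l (b', j) = thread b i x (b', j)"
    using l by (auto simp: branch_part_def)
  have lT: "l \<in> threads branches W" using l by (simp add: branch_part_def)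
  have "value_at b' l = \<zero>\<^bsub>N\<^esub>" if "b' \<in> branches" "b' \<noteq> b" for b'
    using value_at_branch_part[OF lT b that(1) i] that(2) by simp
  then have "{b' \<in> \<epsilon>. value_at b' l \<noteq> \<zero>\<^bsub>N\<^esub>} \<subseteq> \<epsilon> \<inter> {b}"
    using \<epsilon> by auto
  then have "sum_over \<epsilon> l = (\<Oplus>\<^bsub>N\<^esub>b'\<in>\<epsilon> \<inter> {b}. value_at b' l)"
    by (intro sum_over_superset[OF \<epsilon> lT]) auto
  then show ?thesis
    using value_at(2)[OF lT b] by (cases "b \<in> \<epsilon>") auto
qed

text \<open>
  The counting argument applies with the bounded part as \<open>D\<close>, on which all the homomorphisms vanish.
\<close>

theorem extends_from_syzygy_limit:
  assumes C: "left_module R C" and ext: "extends_from_syzygy R tree_module C"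
    and card: "|Pow (bounded_part \<times> carrier C)| \<le>o |branches|"
  shows "extends_from_syzygy R N C"
proof (rule extends_from_syzygy_by_counting[OF left_module_tree N C ext, where B = branches
      and h = sum_over and D = bounded_part and M = branch_part])
  fix b n assume b: "b \<in> branches" and n: "n \<in> carrier N"
  obtain i x where ix: "i \<in> W" "x \<in> carrier (X i)" "g i x = n" using g_onto[OF n] by auto
  have "sum_over {b} (thread b i x) = n"
    using sum_over_branch_part[of "{b}" b, OF _ b thread_in_branch_part[OF ix(1,2) b]] b ix
      value_at_eq[OF limit_value_thread[OF ix(1,2) b b]] by simp
  then show "\<exists>l\<in>branch_part b. sum_over {b} l = n"
    using thread_in_branch_part[OF ix(1,2) b] by blast
next
  fix b l assume b: "b \<in> branches" and l: "l \<in> branch_part b" and zero: "sum_over {b} l = \<zero>\<^bsub>N\<^esub>"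
  obtain i x where i: "i \<in> W" "x \<in> carrier (X i)"
    "\<And>j b'. \<lbrakk>j \<in> W; i \<sqsubseteq> j; b' \<in> branches\<rbrakk> \<Longrightarrow> l (b', j) = thread b i x (b', j)"
    using l by (auto simp: branch_part_def)
  have lT: "l \<in> threads branches W" using l by (simp add: branch_part_def)
  have "g i x = \<zero>\<^bsub>N\<^esub>"
    using zero sum_over_branch_part[of "{b}", OF _ b l] b value_at_branch_part[OF lT b b i] by simp
  then obtain k where k: "k \<in> W" "i \<sqsubseteq> k" "f i k x = \<zero>\<^bsub>X k\<^esub>" using g_ker[OF i(1,2)] by auto
  have "l (b', j) = \<zero>\<^bsub>X j\<^esub>" if j: "j \<in> W" "k \<sqsubseteq> j" and b': "b' \<in> branches" for j b'
  proof -
    have ij: "i \<sqsubseteq> j" using trans i k j by blast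
    have "f i j x = f k j (f i k x)" using f_comp[OF i(1) k(1) j(1) k(2) j(2) i(2)] by simp
    also have "\<dots> = \<zero>\<^bsub>X j\<^esub>" using k j by (simp add: f_facts)
    finally show ?thesis using i(3)[OF j(1) ij b'] j b' by (simp add: thread_apply)
  qed
  then show "l \<in> bounded_part"
    using lT k(1) by (auto simp: bounded_part_def)
next
  fix \<epsilon> b l assume \<epsilon>: "\<epsilon> \<subseteq> branches" and b: "b \<in> branches" and l: "l \<in> branch_part b"
  show "sum_over \<epsilon> l = (if b \<in> \<epsilon> then sum_over {b} l else \<zero>\<^bsub>N\<^esub>)"
    using sum_over_branch_part[OF \<epsilon> b l] sum_over_branch_part[of "{b}", OF _ b l] b by simp
qed (auto simp: card sum_over_Hom sum_over_bounded tree_module_simps zero_in_branch_part branch_part_add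
    branch_part_smult, auto simp: bounded_part_def branch_part_def)


subsection \<open>Cardinalities\<close>

lemma threads_agree:
  assumes "l \<in> threads branches W" "b \<in> branches" "b' \<in> branches" "j \<in> W" "agree j b b'"
  shows "l (b, j) = l (b', j)"
  using assms(1)
proof induct
  case (add l c i x)
  then show ?case using assms(2-) by (simp add: ambient_ops thread_apply agree_def)
qed (simp add: ambient_ops assms)

lemma tree_module_card_le:
  assumes inf: "infinite V" and W: "W \<subseteq> V" and XV: "\<And>i. i \<in> W \<Longrightarrow> carrier (X i) \<subseteq> V'"
    and V': "|V'| \<le>o |V|" and A: "\<And>i. i \<in> W \<Longrightarrow> A i \<subseteq> V''" and V'': "|V''| \<le>o |V|"
  shows "|carrier tree_module| \<le>o |Pow (Pow V)|"
proof -
  have VP: "|V| \<le>o |Pow V|" by (rule ordLess_imp_ordLeq[OF card_of_Pow])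
  have infP: "infinite (Pow V)" using inf by simp
  have "|nodes| \<le>o |Pow V|"
    unfolding nodes_def
  proof (rule card_of_Times_ordLeq[OF infP])
    have "|branches| \<le>o |Pow V''|"
      unfolding branches_def by (rule card_of_mono1) (use A in blast)
    then show "|branches| \<le>o |Pow V|" by (rule ordLeq_transitive[OF _ card_of_Pow_mono[OF V'']])
    show "|W| \<le>o |Pow V|" by (rule ordLeq_transitive[OF card_of_mono1[OF W] VP])
  qed
  moreover have "|\<Union>\<nu>\<in>nodes. carrier ((\<lambda>(b, i). X i) \<nu>)| \<le>o |Pow V|"
  proof -
    have "(\<Union>\<nu>\<in>nodes. carrier ((\<lambda>(b, i). X i) \<nu>)) \<subseteq> V'"
      using XV by (auto simp: nodes_def)
    from card_of_mono1[OF this] ordLeq_transitive[OF V' VP] show ?thesis by (rule ordLeq_transitive)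
  qed
  ultimately have *: "|nodes \<times> (\<Union>\<nu>\<in>nodes. carrier ((\<lambda>(b, i). X i) \<nu>))| \<le>o |Pow V|"
    by (rule card_of_Times_ordLeq[OF infP])
  have "|carrier tree_module| \<le>o |carrier ambient|"
    by (rule card_of_mono1) (auto simp: tree_module_simps threads_closed)
  also have "|carrier ambient| \<le>o |Pow (nodes \<times> (\<Union>\<nu>\<in>nodes. carrier ((\<lambda>(b, i). X i) \<nu>)))|"
    unfolding ambient_def product_module_def by (simp add: card_of_PiE_ordLeq)
  also have "|Pow (nodes \<times> (\<Union>\<nu>\<in>nodes. carrier ((\<lambda>(b, i). X i) \<nu>)))| \<le>o |Pow (Pow V)|"
    by (rule card_of_Pow_mono[OF *])
  finally show ?thesis .
qed

text \<open>
  An element that is bounded by the level \<open>i\<close> is determined by its values at the nodes of subsets of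
  \<open>A i\<close>.
\<close>

lemma bounded_part_card_le:
  assumes inf: "\<And>i. i \<in> W \<Longrightarrow> infinite (A i)"
    and WA: "\<And>i. i \<in> W \<Longrightarrow> |W| \<le>o |A i|"
    and XA: "\<And>i. i \<in> W \<Longrightarrow> |\<Union>j\<in>W. carrier (X j)| \<le>o |A i|"
    and PP: "\<And>i. i \<in> W \<Longrightarrow> |Pow (Pow (A i))| \<le>o |V|" and W: "|W| \<le>o |V|" and infV: "infinite V"
  shows "|bounded_part| \<le>o |V|"
proof -
  define D where "D = (\<lambda>i. {l \<in> threads branches W.
    \<forall>j\<in>W. i \<sqsubseteq> j \<longrightarrow> (\<forall>b\<in>branches. l (b, j) = \<zero>\<^bsub>X j\<^esub>)})"
  have "|D i| \<le>o |V|" if i: "i \<in> W" for i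
  proof -
    define S where "S = Pow (A i) \<times> W"
    have sub: "b \<in> branches" if "b \<subseteq> A i" for b using that i by (auto simp: branches_def)
    have "|D i| \<le>o |\<Pi>\<^sub>E \<nu>\<in>S. carrier (X (snd \<nu>))|"
    proof (rule card_of_ordLeqI)
      show "inj_on (\<lambda>l. restrict l S) (D i)"
      proof (rule inj_onI)
        fix l l' assume l: "l \<in> D i" "l' \<in> D i" and eq: "restrict l S = restrict l' S"
        have lT: "l \<in> threads branches W" "l' \<in> threads branches W" using l by (auto simp: D_def)
        show "l = l'"
        proof (rule ambient_eqI)
          fix b j assume b: "b \<in> branches" and j: "j \<in> W"
          show "l (b, j) = l' (b, j)"
          proof (cases "i \<sqsubseteq> j")
            case True
            then show ?thesis using l b j by (simp add: D_def)
          next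
            case False
            then have "j \<sqsubseteq> i" using total[OF i j] by auto
            then have ag: "agree j b (b \<inter> A i)" using A_mono[OF j i] by (auto simp: agree_def)
            have "l (b \<inter> A i, j) = l' (b \<inter> A i, j)"
              using fun_cong[OF eq, of "(b \<inter> A i, j)"] j by (simp add: S_def)
            then show ?thesis
              using threads_agree[OF lT(1) b sub j ag] threads_agree[OF lT(2) b sub j ag] by simp
          qed
        qed (use lT in \<open>auto simp: threads_closed\<close>)
      qed
    qed (auto simp: D_def S_def tree_module_val sub)
    moreover have "|\<Pi>\<^sub>E \<nu>\<in>S. carrier (X (snd \<nu>))| \<le>o |Pow (S \<times> (\<Union>\<nu>\<in>S. carrier (X (snd \<nu>))))|"
      by (rule card_of_PiE_ordLeq)
    moreover have "|Pow (S \<times> (\<Union>\<nu>\<in>S. carrier (X (snd \<nu>))))| \<le>o |Pow (Pow (A i))|"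
    proof (rule card_of_Pow_mono)
      have AP: "|A i| \<le>o |Pow (A i)|" by (rule ordLess_imp_ordLeq[OF card_of_Pow])
      have infP: "infinite (Pow (A i))" using inf[OF i] by simp
      have "|S| \<le>o |Pow (A i)|"
        unfolding S_def
        by (rule card_of_Times_ordLeq[OF infP ordIso_imp_ordLeq[OF card_of_refl] ordLeq_transitive[OF WA[OF i] AP]])
      moreover have "|\<Union>\<nu>\<in>S. carrier (X (snd \<nu>))| \<le>o |Pow (A i)|"
      proof -
        have "(\<Union>\<nu>\<in>S. carrier (X (snd \<nu>))) \<subseteq> (\<Union>j\<in>W. carrier (X j))" by (auto simp: S_def)
        from card_of_mono1[OF this] ordLeq_transitive[OF XA[OF i] AP] show ?thesis
          by (rule ordLeq_transitive)
      qed
      ultimately show "|S \<times> (\<Union>\<nu>\<in>S. carrier (X (snd \<nu>)))| \<le>o |Pow (A i)|"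
        by (rule card_of_Times_ordLeq[OF infP])
    qed
    ultimately show ?thesis using PP[OF i] by (blast intro: ordLeq_transitive)
  qed
  then have "|\<Union>i\<in>W. D i| \<le>o |V|" by (intro card_of_UNION_ordLeq_infinite[OF infV W]) blast
  moreover have "bounded_part \<subseteq> (\<Union>i\<in>W. D i)" by (auto simp: bounded_part_def D_def)
  ultimately show ?thesis using card_of_mono1 ordLeq_transitive by blast
qed

end


section \<open>Direct limits\<close>

lemma direct_limit_unique_endomorphism:
  assumes lim: "direct_limit R I leq X f N g" and u: "u \<in> module_Hom R N N"
    and ug: "\<And>i x. \<lbrakk>i \<in> I; x \<in> carrier (X i)\<rbrakk> \<Longrightarrow> u (g i x) = g i x" and n: "n \<in> carrier N"
  shows "u n = n"
proof -
  have cc: "cocone R I leq X f N g" using lim by (simp add: direct_limit_def)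
  then have N: "left_module R N" by (simp add: cocone_def left_modules_def)
  have g: "g i x \<in> carrier N" if "i \<in> I" "x \<in> carrier (X i)" for i x
    using cc that by (auto simp: cocone_def intro: module_Hom_closed)
  have "\<exists>!u. u \<in> module_Hom R N N \<and> (\<forall>i\<in>I. \<forall>x\<in>carrier (X i). u (g i x) = g i x)"
    using lim cc unfolding direct_limit_def by blast
  moreover have "\<forall>i\<in>I. \<forall>x\<in>carrier (X i). (\<lambda>x\<in>carrier N. x) (g i x) = g i x"
    using g by simp
  ultimately have "u = (\<lambda>x\<in>carrier N. x)" using identity_Hom[OF N] u ug by blast
  with n show ?thesis by simp
qed

text \<open>
  The images of the maps \<open>g i\<close> form a submodule, since the system is directed.  It is the tip of a
  cocone, and the induced map from \<open>N\<close> to it must be the identity.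
\<close>

lemma direct_limit_onto:
  assumes lim: "direct_limit R I leq X f N g" and sys: "direct_system R I leq X f"
    and lin: "linear_order_on I leq" and I: "I \<noteq> {}" and n: "n \<in> carrier N"
  shows "\<exists>i\<in>I. \<exists>x\<in>carrier (X i). g i x = n"
proof -
  have cc: "cocone R I leq X f N g" using lim by (simp add: direct_limit_def)
  then have N: "left_module R N" and smallN: "small (carrier N)"
    by (simp_all add: cocone_def left_modules_def)
  have g: "g i \<in> module_Hom R (X i) N" if "i \<in> I" for i
    using cc that by (simp add: cocone_def)
  have g_comp: "g j (f i j x) = g i x" if "i \<in> I" "j \<in> I" "(i, j) \<in> leq" "x \<in> carrier (X i)" for i j x
    using cc that by (simp add: cocone_def)
  have X: "left_module R (X i)" if "i \<in> I" for i
    using sys that by (simp add: direct_system_def left_modules_def)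
  have f: "f i j \<in> module_Hom R (X i) (X j)" if "i \<in> I" "j \<in> I" "(i, j) \<in> leq" for i j
    using sys that by (simp add: direct_system_def)
  have Xa: "x \<oplus>\<^bsub>X i\<^esub> y \<in> carrier (X i)" "\<zero>\<^bsub>X i\<^esub> \<in> carrier (X i)"
    if "i \<in> I" "x \<in> carrier (X i)" "y \<in> carrier (X i)" for i x y
    using that left_module_abelian_group[OF X] abelian_group.axioms(1)
    by (auto intro: abelian_monoid.a_closed abelian_monoid.zero_closed)
  define S where "S = (\<Union>i\<in>I. g i ` carrier (X i))"
  let ?N = "N\<lparr>carrier := S\<rparr>"
  have S_sub: "S \<subseteq> carrier N" using g by (auto simp: S_def intro: module_Hom_closed)
  have S_I: "g i x \<in> S" if "i \<in> I" "x \<in> carrier (X i)" for i x using that by (auto simp: S_def)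
  have N': "left_module R ?N"
  proof (rule left_module_submodule[OF N S_sub])
    obtain i where i: "i \<in> I" using I by auto
    interpret Xi: abelian_group "X i" by (rule left_module_abelian_group[OF X[OF i]])
    show "\<zero>\<^bsub>N\<^esub> \<in> S"
      using S_I[OF i Xi.zero_closed] module_Hom_zero[OF g[OF i] X[OF i] N] by simp
  next
    fix x y assume "x \<in> S" "y \<in> S"
    then obtain i a j b where ij: "i \<in> I" "a \<in> carrier (X i)" "x = g i a" "j \<in> I" "b \<in> carrier (X j)" "y = g j b"
      by (auto simp: S_def)
    obtain k where k: "k \<in> I" "(i, k) \<in> leq" "(j, k) \<in> leq"
      using linear_order_on_upper[OF lin ij(1,4)] by auto
    have fk: "f i k a \<in> carrier (X k)" "f j k b \<in> carrier (X k)"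
      using ij k f by (auto intro: module_Hom_closed)
    have "x \<oplus>\<^bsub>N\<^esub> y = g k (f i k a \<oplus>\<^bsub>X k\<^esub> f j k b)"
      using ij k fk by (simp add: module_Hom_add[OF g[OF k(1)]] g_comp)
    then show "x \<oplus>\<^bsub>N\<^esub> y \<in> S" using S_I[OF k(1)] Xa[OF k(1) fk] by simp
  next
    fix r x assume r: "r \<in> carrier R" and "x \<in> S"
    then obtain i a where i: "i \<in> I" "a \<in> carrier (X i)" "x = g i a" by (auto simp: S_def)
    then have "r \<odot>\<^bsub>N\<^esub> x = g i (r \<odot>\<^bsub>X i\<^esub> a)" using r by (simp add: module_Hom_smult[OF g])
    then show "r \<odot>\<^bsub>N\<^esub> x \<in> S"
      using S_I[OF i(1)] left_module.smult_closed[OF X[OF i(1)] r i(2)] by simp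
  qed
  have "small S"
    using smallN card_of_mono1[OF S_sub] unfolding small_def by (blast intro: ordLeq_ordLess_trans)
  moreover have "g i \<in> module_Hom R (X i) ?N" if "i \<in> I" for i
    using g[OF that] S_I[OF that] by (auto simp: module_Hom_def)
  ultimately have "cocone R I leq X f ?N g"
    using N' g_comp by (auto simp: cocone_def left_modules_def)
  then obtain u where u: "u \<in> module_Hom R N ?N" and ug: "\<forall>i\<in>I. \<forall>x\<in>carrier (X i). u (g i x) = g i x"
    using lim unfolding direct_limit_def by blast
  have "u \<in> module_Hom R N N"
    using u S_sub by (auto simp: module_Hom_def)
  then have "u n = n"
    using direct_limit_unique_endomorphism[OF lim] ug n by blast
  moreover have "u n \<in> S" using module_Hom_closed[OF u n] by simp
  ultimately show ?thesis by (auto simp: S_def)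
qed

text \<open>
  An element that never becomes zero in the system is not zero in the product of the system modulo
  eventual equality, which is the tip of a cocone.
\<close>

lemma direct_limit_kernel:
  fixes X :: "'u \<Rightarrow> ('r, 'u) module"
  assumes universe: "set_universe TYPE('u)"
    and lim: "direct_limit R I leq X f N g" and sys: "direct_system R I leq X f"
    and lin: "linear_order_on I leq" and I: "small I"
    and i: "i \<in> I" and x: "x \<in> carrier (X i)" and zero: "g i x = \<zero>\<^bsub>N\<^esub>"
  shows "\<exists>j\<in>I. (i, j) \<in> leq \<and> f i j x = \<zero>\<^bsub>X j\<^esub>"
proof -
  note trans = linear_order_onD(2)[OF lin] and upper = linear_order_on_upper[OF lin]
  have N: "left_module R N"
    using lim by (simp add: direct_limit_def cocone_def left_modules_def)
  have X: "left_module R (X i)" "small (carrier (X i))" if "i \<in> I" for i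
    using sys that by (simp_all add: direct_system_def left_modules_def)
  have f: "f i j \<in> module_Hom R (X i) (X j)" if "i \<in> I" "j \<in> I" "(i, j) \<in> leq" for i j
    using sys that by (simp add: direct_system_def)
  have f_closed: "f i j x \<in> carrier (X j)"
    if "i \<in> I" "j \<in> I" "(i, j) \<in> leq" "x \<in> carrier (X i)" for i j x
    by (rule module_Hom_closed[OF f[OF that(1-3)] that(4)])
  have f_comp: "f j k (f i j x) = f i k x"
    if "i \<in> I" "j \<in> I" "k \<in> I" "(i, j) \<in> leq" "(j, k) \<in> leq" "x \<in> carrier (X i)" for i j k x
    using sys that unfolding direct_system_def by blast
  have Xz: "\<zero>\<^bsub>X i\<^esub> \<in> carrier (X i)" if "i \<in> I" for i
    by (rule abelian_monoid.zero_closed[OF abelian_group.axioms(1)[OF left_module_abelian_group[OF X(1)[OF that]]]])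
  define P where "P = product_module I X"
  have P: "left_module R P" unfolding P_def by (rule left_module_product[OF left_module_ring[OF N] X(1)])
  interpret P: abelian_group P by (rule left_module_abelian_group[OF P])
  have P_car: "carrier P = (\<Pi>\<^sub>E i\<in>I. carrier (X i))"
    and P_add: "(z \<oplus>\<^bsub>P\<^esub> z') k = z k \<oplus>\<^bsub>X k\<^esub> z' k"
    and P_smult: "(r \<odot>\<^bsub>P\<^esub> z) k = r \<odot>\<^bsub>X k\<^esub> z k" and P_zero: "\<zero>\<^bsub>P\<^esub> k = \<zero>\<^bsub>X k\<^esub>"
    if "k \<in> I" for z z' r k
    using that by (auto simp: P_def product_module_def)
  have P_car: "carrier P = (\<Pi>\<^sub>E i\<in>I. carrier (X i))" by (simp add: P_def product_module_def)
  define ev where "ev = (\<lambda>z z'. \<exists>i\<in>I. \<forall>j\<in>I. (i, j) \<in> leq \<longrightarrow> z j = (z' j :: 'u))"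
  have ev_refl: "ev z z" for z using i by (auto simp: ev_def)
  have ev_sym: "ev z z' \<Longrightarrow> ev z' z" for z z' unfolding ev_def by metis
  have ev_common: "\<exists>k\<in>I. \<forall>j\<in>I. (k, j) \<in> leq \<longrightarrow> z j = z' j \<and> w j = w' j" if "ev z z'" "ev w w'" for z z' w w'
  proof -
    from that obtain i i' where ii: "i \<in> I" "\<forall>j\<in>I. (i, j) \<in> leq \<longrightarrow> z j = z' j"
      "i' \<in> I" "\<forall>j\<in>I. (i', j) \<in> leq \<longrightarrow> w j = w' j" by (auto simp: ev_def)
    then obtain k where "k \<in> I" "(i, k) \<in> leq" "(i', k) \<in> leq" using upper by blast
    with ii show ?thesis by (intro bexI[of _ k]) (auto intro: trans)
  qed
  have ev_trans: "ev z w" if "ev z z'" "ev z' w" for z z' w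
    using ev_common[OF that] unfolding ev_def by fastforce
  obtain E :: "'u set" where E: "small E" "infinite E" using small_infinite_exists[OF universe] by auto
  define V where "V = E \<union> I \<union> (\<Union>i\<in>I. carrier (X i))"
  have V: "small V" unfolding V_def by (intro small_Un[OF universe] small_UN[OF universe] E I X(2))
  have infV: "infinite V" using E by (auto simp: V_def)
  have "|I \<times> (\<Union>i\<in>I. carrier (X i))| \<le>o |V|"
    by (rule card_of_Times_ordLeq[OF infV]) (auto simp: V_def intro!: card_of_mono1)
  then have "|carrier P| \<le>o |Pow V|"
    unfolding P_car by (rule ordLeq_transitive[OF card_of_PiE_ordLeq card_of_Pow_mono])
  then have "|carrier P| <o |UNIV :: 'u set|"
    by (rule ordLeq_ordLess_trans) (use V in \<open>auto simp: small_def intro: universe_Pow[OF universe]\<close>)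
  then obtain enc :: "('u \<Rightarrow> 'u) \<Rightarrow> 'u" where enc: "inj_on enc (carrier P)" "small (enc ` carrier P)"
    by (rule card_less_imp_embedding)
  \<comment> \<open>a class is encoded through a chosen representative\<close>
  define rep where "rep = (\<lambda>z. SOME z'. z' \<in> carrier P \<and> ev z z')"
  have rep: "rep z \<in> carrier P" "ev z (rep z)" if "z \<in> carrier P" for z
    using someI_ex[of "\<lambda>z'. z' \<in> carrier P \<and> ev z z'"] that ev_refl by (auto simp: rep_def)
  define q where "q = (\<lambda>z. enc (rep z))"
  have q_iff: "q z = q z' \<longleftrightarrow> ev z z'" if z: "z \<in> carrier P" "z' \<in> carrier P" for z z'
  proof
    assume "q z = q z'"
    then have "rep z = rep z'" using inj_onD[OF enc(1)] rep z by (simp add: q_def)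
    then show "ev z z'" using rep[OF z(1)] rep[OF z(2)] ev_sym ev_trans by metis
  next
    assume "ev z z'"
    then have "ev z w \<longleftrightarrow> ev z' w" for w using ev_sym ev_trans by blast
    then show "q z = q z'" by (simp add: q_def rep_def)
  qed
  define T where "T = image_module q P"
  have add_cong: "q (z \<oplus>\<^bsub>P\<^esub> w) = q (z' \<oplus>\<^bsub>P\<^esub> w')"
    if "z \<in> carrier P" "z' \<in> carrier P" "w \<in> carrier P" "w' \<in> carrier P" "q z = q z'" "q w = q w'" for z z' w w'
  proof -
    have "ev z z'" "ev w w'" using that q_iff by auto
    from ev_common[OF this] have "ev (z \<oplus>\<^bsub>P\<^esub> w) (z' \<oplus>\<^bsub>P\<^esub> w')"
      unfolding ev_def by (metis P_add)
    then show ?thesis using that by (simp add: q_iff)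
  qed
  have smult_cong: "q (r \<odot>\<^bsub>P\<^esub> z) = q (r \<odot>\<^bsub>P\<^esub> z')"
    if "r \<in> carrier R" "z \<in> carrier P" "z' \<in> carrier P" "q z = q z'" for r z z'
  proof -
    have "ev z z'" using that q_iff by auto
    then have "ev (r \<odot>\<^bsub>P\<^esub> z) (r \<odot>\<^bsub>P\<^esub> z')"
      unfolding ev_def by (metis P_smult)
    then show ?thesis using that left_module.smult_closed[OF P] by (simp add: q_iff)
  qed
  have T: "left_module R T" unfolding T_def 
    by (rule left_module_image_module[OF P]) (erule (5) add_cong, erule (3) smult_cong)
  have qT: "restrict q (carrier P) \<in> module_Hom R P T"
    unfolding T_def by (rule image_module_Hom[OF P]) (erule (5) add_cong, erule (3) smult_cong)
  have "carrier T \<subseteq> enc ` carrier P"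
    using rep by (auto simp: T_def image_module_def q_def)
  then have smallT: "small (carrier T)" by (rule small_subset[OF universe enc(2)])
  define e where "e = (\<lambda>i x. \<lambda>j\<in>I. if (i, j) \<in> leq then f i j x else \<zero>\<^bsub>X j\<^esub>)"
  have e_P: "e i x \<in> carrier P" if "i \<in> I" "x \<in> carrier (X i)" for i x
    using that f_closed Xz by (auto simp: e_def P_car)
  define h where "h = (\<lambda>i. \<lambda>x\<in>carrier (X i). q (e i x))"
  have h_Hom: "h i \<in> module_Hom R (X i) T" if iI: "i \<in> I" for i
    unfolding h_def
  proof (rule module_HomI)
    fix x y assume xy: "x \<in> carrier (X i)" "y \<in> carrier (X i)"
    have "e i (x \<oplus>\<^bsub>X i\<^esub> y) = e i x \<oplus>\<^bsub>P\<^esub> e i y"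
    proof (rule extensionalityI[of _ I])
      fix j assume j: "j \<in> I"
      interpret Xj: abelian_group "X j" by (rule left_module_abelian_group[OF X(1)[OF j]])
      show "e i (x \<oplus>\<^bsub>X i\<^esub> y) j = (e i x \<oplus>\<^bsub>P\<^esub> e i y) j"
        using module_Hom_add[OF f[OF iI j] xy] j by (simp add: P_add e_def)
    qed (use P.a_closed[OF e_P[OF iI xy(1)] e_P[OF iI xy(2)]] in \<open>auto simp: e_def P_car PiE_iff\<close>)
    then show "q (e i (x \<oplus>\<^bsub>X i\<^esub> y)) = q (e i x) \<oplus>\<^bsub>T\<^esub> q (e i y)"
      using module_Hom_add[OF qT, of "e i x" "e i y"] e_P[OF iI] xy by simp
  next
    fix r x assume rx: "r \<in> carrier R" "x \<in> carrier (X i)"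
    have c: "r \<odot>\<^bsub>P\<^esub> e i x \<in> carrier P" by (rule left_module.smult_closed[OF P rx(1) e_P[OF iI rx(2)]])
    have "e i (r \<odot>\<^bsub>X i\<^esub> x) = r \<odot>\<^bsub>P\<^esub> e i x"
    proof (rule extensionalityI[of _ I])
      fix j assume j: "j \<in> I"
      show "e i (r \<odot>\<^bsub>X i\<^esub> x) j = (r \<odot>\<^bsub>P\<^esub> e i x) j"
        using module_Hom_smult[OF f[OF iI j] rx] j left_module_smult_zero_right[OF X(1)[OF j] rx(1)]
        by (simp add: P_smult e_def)
    qed (use c in \<open>auto simp: e_def P_car PiE_iff\<close>)
    then show "q (e i (r \<odot>\<^bsub>X i\<^esub> x)) = r \<odot>\<^bsub>T\<^esub> q (e i x)"
      using module_Hom_smult[OF qT rx(1), of "e i x"] e_P[OF iI rx(2)] c by simp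
  qed (use X iI e_P in \<open>auto simp: T_def image_module_def\<close>)
  have "cocone R I leq X f T h"
    unfolding cocone_def
  proof (intro conjI ballI impI)
    show "T \<in> left_modules R" using T smallT by (simp add: left_modules_def)
  next
    fix i j x assume ij: "i \<in> I" "j \<in> I" "(i, j) \<in> leq" and x: "x \<in> carrier (X i)"
    have fx: "f i j x \<in> carrier (X j)" by (rule module_Hom_closed[OF f[OF ij] x])
    have "e j (f i j x) k = e i x k" if k: "k \<in> I" "(j, k) \<in> leq" for k
      using k f_comp[OF ij(1,2) k(1) ij(3) k(2) x] trans[OF ij(3) k(2)] by (simp add: e_def)
    then have "ev (e j (f i j x)) (e i x)" using ij(2) by (auto simp: ev_def)
    then show "h j (f i j x) = h i x"
      using x fx e_P ij by (simp add: h_def q_iff)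
  qed (use h_Hom in auto)
  then obtain u where u: "u \<in> module_Hom R N T" and uh: "\<forall>i\<in>I. \<forall>x\<in>carrier (X i). u (g i x) = h i x"
    using lim unfolding direct_limit_def by blast
  have "h i x = \<zero>\<^bsub>T\<^esub>"
    using uh i x zero module_Hom_zero[OF u N T] by metis
  then have "q (e i x) = q \<zero>\<^bsub>P\<^esub>"
    using x by (simp add: h_def T_def image_module_def)
  then have "ev (e i x) \<zero>\<^bsub>P\<^esub>" using e_P[OF i x] by (simp add: q_iff)
  then obtain k where k: "k \<in> I" "\<forall>j\<in>I. (k, j) \<in> leq \<longrightarrow> e i x j = \<zero>\<^bsub>P\<^esub> j" by (auto simp: ev_def)
  obtain j where j: "j \<in> I" "(i, j) \<in> leq" "(k, j) \<in> leq" using upper[OF i k(1)] by auto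
  then have "f i j x = \<zero>\<^bsub>X j\<^esub>" using k(2) by (auto simp: e_def P_zero)
  with j show ?thesis by blast
qed

lemma direct_limit_top:
  assumes lim: "direct_limit R I leq X f N g" and sys: "direct_system R I leq X f"
    and m: "m \<in> I" and top: "\<And>i. i \<in> I \<Longrightarrow> (i, m) \<in> leq"
  shows "\<exists>u\<in>module_Hom R N (X m). bij_betw u (carrier N) (carrier (X m))"
proof -
  have cc: "cocone R I leq X f N g" using lim by (simp add: direct_limit_def)
  have gm: "g m \<in> module_Hom R (X m) N" using cc m by (simp add: cocone_def)
  have "cocone R I leq X f (X m) (\<lambda>i. f i m)"
    using sys m top unfolding cocone_def direct_system_def by blast
  then obtain u where u: "u \<in> module_Hom R N (X m)"
    and uf: "\<forall>i\<in>I. \<forall>x\<in>carrier (X i). u (g i x) = f i m x"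
    using lim unfolding direct_limit_def by blast
  have N: "left_module R N" using cc by (simp add: cocone_def left_modules_def)
  have ug: "u (g m x) = x" if "x \<in> carrier (X m)" for x
    using uf m that sys by (simp add: direct_system_def)
  have "compose (carrier N) (g m) u n = n" if "n \<in> carrier N" for n
  proof (rule direct_limit_unique_endomorphism[OF lim module_Hom_compose[OF u gm N] _ that])
    fix i x assume ix: "i \<in> I" "x \<in> carrier (X i)"
    have "g i x \<in> carrier N" using cc ix by (auto simp: cocone_def intro: module_Hom_closed)
    then show "compose (carrier N) (g m) u (g i x) = g i x"
      using uf ix cc m top[OF ix(1)] by (simp add: compose_def cocone_def)
  qed
  then have gu: "g m (u n) = n" if "n \<in> carrier N" for n using that by (simp add: compose_def)
  have "bij_betw u (carrier N) (carrier (X m))"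
    by (rule bij_betw_byWitness[where f' = "g m"])
      (use ug gu module_Hom_closed[OF gm] module_Hom_closed[OF u] in auto)
  with u show ?thesis by blast
qed

text \<open>
  For the empty system every endomorphism of \<open>N\<close> is compatible with the cocone, even the zero map.
\<close>

lemma direct_limit_empty:
  assumes lim: "direct_limit R {} leq X f N g"
  shows "carrier N = {\<zero>\<^bsub>N\<^esub>}"
proof -
  have N: "left_module R N" using lim by (simp add: direct_limit_def cocone_def left_modules_def)
  interpret N: abelian_group N by (rule left_module_abelian_group[OF N])
  have "(\<lambda>x\<in>carrier N. \<zero>\<^bsub>N\<^esub>) \<in> module_Hom R N N"
    by (rule module_HomI) (auto simp: N left_module_smult_zero_right[OF N])
  then have "(\<lambda>x\<in>carrier N. \<zero>\<^bsub>N\<^esub>) n = n" if "n \<in> carrier N" for n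
    by (rule direct_limit_unique_endomorphism[OF lim _ _ that]) auto
  then show ?thesis by auto
qed

section \<open>Totally ordered limits and the Ext-orthogonal classes\<close>

text \<open>
  All level sets contain the elements of \<open>W\<close>, of \<open>C\<close> and of the modules \<open>X i\<close>, so that the union \<open>V\<close> of the
  levels bounds both the bounded part and \<open>C\<close>, while the branches are all subsets of \<open>V\<close>.  The tree
  module is small, and its copy on a small set belongs to \<open>\<X>\<close> as it factors locally.
\<close>

lemma extends_from_syzygy_direct_limit:
  fixes R :: "('r, 'e) ring_scheme" and X :: "'u \<Rightarrow> ('r, 'u) module" and C N :: "('r, 'u) module"
  assumes universe: "set_universe TYPE('u)"
    and closed: "\<And>M. \<lbrakk>M \<in> left_modules R; locally_factors R \<X> M\<rbrakk> \<Longrightarrow> M \<in> \<X>"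
    and C: "C \<in> left_modules R" and ext: "\<And>X. X \<in> \<X> \<Longrightarrow> extends_from_syzygy R X C"
    and smallI: "small I" and lin: "linear_order_on I leq" and sys: "direct_system R I leq X f"
    and XX: "\<And>i. i \<in> I \<Longrightarrow> X i \<in> \<X>" and lim: "direct_limit R I leq X f N g"
    and nonempty: "I \<noteq> {}" and no_top: "\<And>m. m \<in> I \<Longrightarrow> \<exists>i\<in>I. (i, m) \<notin> leq"
  shows "extends_from_syzygy R N C"
proof -
  note refl = linear_order_onD(1)[OF lin] and trans = linear_order_onD(2)[OF lin]
    and antisym = linear_order_onD(3)[OF lin] and total = linear_order_onD(4)[OF lin]
  obtain W where W: "W \<subseteq> I" and cofinal: "\<And>i. i \<in> I \<Longrightarrow> \<exists>j\<in>W. (i, j) \<in> leq"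
    and least: "\<And>S. \<lbrakk>S \<subseteq> W; S \<noteq> {}\<rbrakk> \<Longrightarrow> \<exists>m\<in>S. \<forall>s\<in>S. (m, s) \<in> leq"
    using cofinal_well_ordered_subset[OF lin] by auto
  have WI: "i \<in> I" if "i \<in> W" for i using that W by auto
  have next_W: "\<exists>j\<in>W. (i, j) \<in> leq \<and> i \<noteq> j" if i: "i \<in> W" for i
  proof -
    obtain k where k: "k \<in> I" "(k, i) \<notin> leq" using no_top[OF WI[OF i]] by auto
    then obtain j where j: "j \<in> W" "(k, j) \<in> leq" using cofinal by blast
    have "(i, k) \<in> leq" using total[OF WI[OF i] k(1)] k(2) by auto
    then show ?thesis using j k trans by blast
  qed
  have X: "left_module R (X i)" "small (carrier (X i))" if "i \<in> I" for i
    using sys that by (simp_all add: direct_system_def left_modules_def)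
  have C': "left_module R C" "small (carrier C)" using C by (simp_all add: left_modules_def)
  have cc: "cocone R I leq X f N g" using lim by (simp add: direct_limit_def)
  then have N: "left_module R N" by (simp add: cocone_def left_modules_def)
  obtain E :: "'u set" where E: "small E" "infinite E" using small_infinite_exists[OF universe] by auto
  define Base where "Base = E \<union> I \<union> (\<Union>i\<in>I. carrier (X i)) \<union> carrier C"
  have Base: "small Base"
    unfolding Base_def by (intro small_Un[OF universe] small_UN[OF universe] E smallI X(2) C'(2))
  have infBase: "infinite Base" using E by (auto simp: Base_def)
  have smallW: "small W" by (rule small_subset[OF universe smallI W])
  define r where "r = {(i, j). i \<in> W \<and> j \<in> W \<and> (i, j) \<in> leq \<and> i \<noteq> j}"
  have "wf r"
  proof (rule wfI_min)
    fix x S assume x: "x \<in> (S :: 'u set)"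
    show "\<exists>z\<in>S. \<forall>y. (y, z) \<in> r \<longrightarrow> y \<notin> S"
    proof (cases "S \<inter> W = {}")
      case True
      then show ?thesis using x by (auto simp: r_def)
    next
      case False
      then obtain m where "m \<in> S \<inter> W" "\<forall>s\<in>S \<inter> W. (m, s) \<in> leq" using least[of "S \<inter> W"] by auto
      then show ?thesis using antisym by (auto simp: r_def)
    qed
  qed
  moreover have "r \<subseteq> W \<times> W" by (auto simp: r_def)
  ultimately obtain A :: "'u \<Rightarrow> 'u set" where A: "\<And>i. small (A i)" "\<And>i. Base \<subseteq> A i"
      "\<And>i j. (j, i) \<in> r \<Longrightarrow> A j \<subseteq> A i" "\<And>i j. (j, i) \<in> r \<Longrightarrow> |Pow (A j)| \<le>o |A i|"
    using level_sets_exist[OF universe _ smallW _ Base, of r] by blast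
  define le where "le = (\<lambda>i j. (i, j) \<in> leq)"
  interpret tree_system R W le X f N g A
  proof (rule tree_system.intro; (unfold le_def)?)
    fix n assume "n \<in> carrier N"
    then obtain i x where ix: "i \<in> I" "x \<in> carrier (X i)" "g i x = n"
      using direct_limit_onto[OF lim sys lin nonempty] by blast
    obtain j where j: "j \<in> W" "(i, j) \<in> leq" using cofinal ix by blast
    have "f i j \<in> module_Hom R (X i) (X j)"
      using sys ix j WI by (simp add: direct_system_def)
    then have "f i j x \<in> carrier (X j)"
      using ix(2) by (rule module_Hom_closed)
    moreover have "g j (f i j x) = n" using cc ix j WI by (simp add: cocone_def)
    ultimately show "\<exists>i\<in>W. \<exists>x\<in>carrier (X i). g i x = n" using j by blast
  next
    fix i x assume ix: "i \<in> W" "x \<in> carrier (X i)" "g i x = \<zero>\<^bsub>N\<^esub>"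
    obtain k where k: "k \<in> I" "(i, k) \<in> leq" "f i k x = \<zero>\<^bsub>X k\<^esub>"
      using direct_limit_kernel[OF universe lim sys lin smallI WI[OF ix(1)] ix(2,3)] by blast
    obtain j where j: "j \<in> W" "(k, j) \<in> leq" using cofinal k by blast
    have fkj: "f k j \<in> module_Hom R (X k) (X j)" using sys k j WI by (simp add: direct_system_def)
    have "f i j x = f k j (f i k x)"
      using sys ix k j WI unfolding direct_system_def by metis
    also have "\<dots> = \<zero>\<^bsub>X j\<^esub>"
      using k module_Hom_zero[OF fkj X(1)[OF k(1)] X(1)[OF WI[OF j(1)]]] by simp
    finally show "\<exists>j\<in>W. (i, j) \<in> leq \<and> f i j x = \<zero>\<^bsub>X j\<^esub>"
      using j trans[OF k(2) j(2)] by blast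
  next
    show "W \<noteq> {}" using nonempty cofinal by blast
  next
    fix i j assume "i \<in> W" "j \<in> W" "(i, j) \<in> leq"
    then show "A i \<subseteq> A j" using A(3)[of i j] by (cases "i = j") (auto simp: r_def)
  next
    fix i j k x assume "i \<in> W" "j \<in> W" "k \<in> W" "(i, j) \<in> leq" "(j, k) \<in> leq" "x \<in> carrier (X i)"
    then show "f j k (f i j x) = f i k x" using sys WI unfolding direct_system_def by blast
  next
    fix i j k assume "(i, j) \<in> leq" "(j, k) \<in> leq"
    then show "(i, k) \<in> leq" by (rule trans)
  next
    fix i j assume "(i, j) \<in> leq" "(j, i) \<in> leq"
    then show "i = j" by (rule antisym)
  qed (use sys cc WI X N refl least in \<open>auto simp: direct_system_def cocone_def\<close>)
  define V where "V = (\<Union>i\<in>W. A i)"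
  have V: "small V" unfolding V_def by (rule small_UN[OF universe smallW A(1)])
  have AV: "A i \<subseteq> V" if "i \<in> W" for i using that by (auto simp: V_def)
  obtain i0 where i0: "i0 \<in> W" using nonempty cofinal by blast
  have BaseV: "Base \<subseteq> V" using A(2) AV[OF i0] by blast
  have infV: "infinite V" using infBase BaseV infinite_super by blast
  have infA: "infinite (A i)" for i using infBase A(2) infinite_super by blast
  have WBase: "W \<subseteq> Base" using W by (auto simp: Base_def)
  have XBase: "(\<Union>j\<in>W. carrier (X j)) \<subseteq> Base" using W by (auto simp: Base_def)
  have PP: "|Pow (Pow (A i))| \<le>o |V|" if i: "i \<in> W" for i
  proof -
    \<comment> \<open>two steps up, one for each power set\<close>
    obtain j where j: "j \<in> W" "(i, j) \<in> r" using next_W[OF i] i by (auto simp: r_def)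
    obtain k where k: "k \<in> W" "(j, k) \<in> r" using next_W[OF j(1)] j by (auto simp: r_def)
    have "|Pow (Pow (A i))| \<le>o |Pow (A j)|" by (rule card_of_Pow_mono[OF A(4)[OF j(2)]])
    moreover have "|Pow (A j)| \<le>o |A k|" by (rule A(4)[OF k(2)])
    moreover have "|A k| \<le>o |V|" by (rule card_of_mono1[OF AV[OF k(1)]])
    ultimately show ?thesis by (blast intro: ordLeq_transitive)
  qed
  have "|bounded_part| \<le>o |V|"
    by (rule bounded_part_card_le[OF infA card_of_mono1[OF subset_trans[OF WBase A(2)]]
          card_of_mono1[OF subset_trans[OF XBase A(2)]] PP card_of_mono1[OF subset_trans[OF WBase BaseV]] infV])
  moreover have "|carrier C| \<le>o |V|"
    by (rule card_of_mono1) (use BaseV in \<open>auto simp: Base_def\<close>)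
  ultimately have "|bounded_part \<times> carrier C| \<le>o |V|"
    by (rule card_of_Times_ordLeq[OF infV])
  then have card: "|Pow (bounded_part \<times> carrier C)| \<le>o |branches|"
    unfolding branches_def V_def[symmetric] by (rule card_of_Pow_mono)
  have "|carrier tree_module| \<le>o |Pow (Pow V)|"
    by (rule tree_module_card_le[OF infV, of V V])
      (use WBase XBase BaseV AV in \<open>auto intro: ordIso_imp_ordLeq[OF card_of_refl]\<close>)
  moreover have "|Pow (Pow V)| <o |UNIV :: 'u set|"
    using V by (intro universe_Pow[OF universe]) (simp add: small_def)
  ultimately have "|carrier tree_module| <o |UNIV :: 'u set|" by (rule ordLeq_ordLess_trans)
  then obtain enc :: "('u set \<times> 'u \<Rightarrow> 'u) \<Rightarrow> 'u" where
    enc: "inj_on enc (carrier tree_module)" "small (enc ` carrier tree_module)"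
    by (rule card_less_imp_embedding)
  define L where "L = image_module enc tree_module"
  define dec where "dec = restrict (inv_into (carrier tree_module) enc) (enc ` carrier tree_module)"
  note iso = image_module_iso[OF left_module_tree enc(1), folded L_def dec_def]
  have car: "carrier L = enc ` carrier tree_module" by (simp add: L_def image_module_def)
  have "locally_factors R (X ` W) L"
    by (rule locally_factors_iso[OF _ left_module_tree iso(1,2,3) _ tree_module_locally_factors])
      (use X WI in \<open>auto simp: car dec_def inv_into_into f_inv_into_f inv_into_f_f[OF enc(1)]\<close>)
  then have "locally_factors R \<X> L"
    by (rule locally_factors_mono) (use XX WI in auto)
  moreover have "L \<in> left_modules R" using iso(1) enc(2) by (simp add: left_modules_def car)
  ultimately have "L \<in> \<X>" by (intro closed)
  then have "extends_from_syzygy R L C" by (rule ext)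
  moreover have "bij_betw (restrict enc (carrier tree_module)) (carrier tree_module) (carrier L)"
    using inj_on_imp_bij_betw[OF enc(1)] by (simp add: car)
  ultimately have "extends_from_syzygy R tree_module C"
    using extends_from_syzygy_bij[OF iso(1) left_module_tree C'(1) _ iso(2)] by blast
  then show ?thesis by (rule extends_from_syzygy_limit[OF C'(1) _ card])
qed

text \<open>
  A limit is zero if the system is empty, and isomorphic to the last term if there is one.
\<close>

theorem totally_ordered_limits_in_left_perp:
  fixes R :: "('r, 'e) ring_scheme" and \<X> :: "('r, 'u) module set"
  assumes universe: "set_universe TYPE('u)"
    and \<X>: "\<X> \<subseteq> left_modules R"
    and closed: "\<And>M. \<lbrakk>M \<in> left_modules R; locally_factors R \<X> M\<rbrakk> \<Longrightarrow> M \<in> \<X>"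
  shows "totally_ordered_limits R \<X> \<subseteq> left_perp R (right_perp R \<X>)"
proof
  fix N assume "N \<in> totally_ordered_limits R \<X>"
  then obtain I :: "'u set" and leq X f g where I: "small I" "linear_order_on I leq"
    and sys: "direct_system R I leq X f" and XX: "\<And>i. i \<in> I \<Longrightarrow> X i \<in> \<X>"
    and lim: "direct_limit R I leq X f N g"
    by (auto simp: totally_ordered_limits_def)
  have cc: "cocone R I leq X f N g" using lim by (simp add: direct_limit_def)
  then have N: "N \<in> left_modules R" by (simp add: cocone_def)
  then have N': "left_module R N" by (simp add: left_modules_def)
  show "N \<in> left_perp R (right_perp R \<X>)"
    unfolding left_perp_def
  proof (intro CollectI conjI ballI N)
    fix C assume "C \<in> right_perp R \<X>"
    then have C: "C \<in> left_modules R" and triv: "\<And>X. X \<in> \<X> \<Longrightarrow> trivial_group (Ext1 R X C)"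
      by (auto simp: right_perp_def)
    have C': "left_module R C" using C by (simp add: left_modules_def)
    have ext: "extends_from_syzygy R X C" if "X \<in> \<X>" for X
      using triv[OF that] trivial_Ext1_iff[OF _ C', of X] that \<X> by (auto simp: left_modules_def)
    consider "I = {}" | m where "m \<in> I" "\<And>i. i \<in> I \<Longrightarrow> (i, m) \<in> leq"
      | "I \<noteq> {}" "\<And>m. m \<in> I \<Longrightarrow> \<exists>i\<in>I. (i, m) \<notin> leq" by blast
    then have "extends_from_syzygy R N C"
    proof cases
      case 1
      then show ?thesis using direct_limit_empty lim extends_from_syzygy_zero_module[OF N'] by blast
    next
      case 2
      have "left_module R (X m)" using XX[OF 2(1)] \<X> by (auto simp: left_modules_def)
      then show ?thesis
        using extends_from_syzygy_bij[OF _ N' C' ext[OF XX[OF 2(1)]]] direct_limit_top[OF lim sys 2] by blast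
    next
      case 3
      show ?thesis
        by (rule extends_from_syzygy_direct_limit[OF universe closed C ext I sys XX lim 3])
    qed
    then show "trivial_group (Ext1 R N C)" by (simp add: trivial_Ext1_iff[OF N' C'])
  qed
qed

theorem corollary2p5:
  fixes R :: "('r, 'e) ring_scheme"
    and \<Y> :: "('r, 'u) module set"
  assumes universe: "set_universe TYPE('u)"
    and ring: "ring R"
    and small_ring: "|carrier R| <o |UNIV :: 'u set|"
    and class_Y: "\<Y> \<subseteq> right_modules R"
  shows "totally_ordered_limits R (mittag_leffler_modules R \<Y>) \<subseteq> left_perp R (right_perp R (mittag_leffler_modules R \<Y>))
       \<and> totally_ordered_limits R (flat_mittag_leffler_modules R \<Y>) \<subseteq> left_perp R (right_perp R (flat_mittag_leffler_modules R \<Y>))"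
proof
  show "totally_ordered_limits R (mittag_leffler_modules R \<Y>) \<subseteq> left_perp R (right_perp R (mittag_leffler_modules R \<Y>))"
    by (rule totally_ordered_limits_in_left_perp[OF universe])
      (rule subsetI, simp add: mittag_leffler_modules_def, rule mittag_leffler_modules_local[OF class_Y], auto)
  show "totally_ordered_limits R (flat_mittag_leffler_modules R \<Y>) \<subseteq> left_perp R (right_perp R (flat_mittag_leffler_modules R \<Y>))"
  proof (rule totally_ordered_limits_in_left_perp[OF universe])
    fix M :: "('r, 'u) module"
    assume M: "M \<in> left_modules R" and local: "locally_factors R (flat_mittag_leffler_modules R \<Y>) M"
    have "M \<in> mittag_leffler_modules R \<Y>"
      by (rule mittag_leffler_modules_local[OF class_Y M local])
        (auto simp: flat_mittag_leffler_modules_def mittag_leffler_modules_def)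
    moreover have "flat R M"
      by (rule flat_local[OF _ local]) (use M in \<open>auto simp: flat_mittag_leffler_modules_def left_modules_def\<close>)
    ultimately show "M \<in> flat_mittag_leffler_modules R \<Y>"
      by (simp add: flat_mittag_leffler_modules_def mittag_leffler_modules_def)
  qed (auto simp: flat_mittag_leffler_modules_def)
qed

end
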